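(* Let $\theta\in\Theta$ (i.e. $\rho(A_0)<1$), and assume that the noise $(\xi_n)_{n\ge1}$ satisfies: $r(n)=O(n^{-\alpha_1})$ as $n\to\infty$ for some $\alpha_1>0$; $\int_{-\pi}^{\pi}|\log f_\xi(\lambda)|\,d\lambda<\infty$; and $\beta_n^2=O(n^{-\alpha_2})$ for some $\alpha_2>1$. Then, when the true parameter is $\theta$, the maximum likelihood estimator satisfies the quadratic strong law $$\frac1{\log n}\sum_{k=1}^n(\widehat\theta_k-\theta)(\widehat\theta_k-\theta)^*\longrightarrow I(\theta)^{-1}\quad\text{almost surely as }n\to\infty,$$ where $I(\theta)$ is the unique solution of the Lyapunov equation $I(\theta)=A_0I(\theta)A_0^*+bb^*$.
   Context: Fix an integer $p\ge1$. $A^*$ is the transpose of $A$, $Id_p$ the $p\times p$ identity matrix, $\rho(\cdot)$ the spectral radius, $b=(1,0,\dots,0)^*\in\mathbb{R}^p$. Noise: $(\xi_n)_{n\ge1}$ is a real stationary centered Gaussian process with covariance function $r(n)=\mathbb{E}(\xi_1\xi_{1+n})$, $r(0)=1$, and spectral density $f_\xi$. Let $\sigma_1\varepsilon_1=\xi_1$, $\sigma_1=1$, and for $n\ge2$, $\sigma_n\varepsilon_n=\xi_n-\mathbb{E}(\xi_n\mid\xi_1,\dots,\xi_{n-1})$, where $\sigma_n>0$ and the $\varepsilon_n$ are i.i.d. $\mathcal N(0,1)$. Write $\sigma_n\varepsilon_n=\sum_{i=1}^n k(n,i)\xi_i$ with deterministic $k(n,i)$, $k(n,n)=1$. For $n\ge1$,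 $\beta_n=-k(n+1,1)$ (the partial autocorrelation function, PACF, of $(\xi_n)$); by convention $\beta_0=1$ (it plays no role below since $\zeta_0=0$). One has $\sigma_n^2=\prod_{i=1}^{n-1}(1-\beta_i^2)$. Model: $X_n=\sum_{i=1}^p\theta_iX_{n-i}+\xi_n$ for $n\ge1$, with $X_n=0$ for $n\le0$ and $\theta=(\theta_1,\dots,\theta_p)^*\in\mathbb{R}^p$. $A_0$ is the $p\times p$ companion matrix with first row $(\theta_1,\dots,\theta_p)$, ones on the subdiagonal and zeros elsewhere. $\Theta=\{\theta\in\mathbb{R}^p:\rho(A_0)<1\}$. Let $Y_n=(X_n,\dots,X_{n-p+1})^*$, $Z_n=\sum_{i=1}^nk(n,i)Y_i$, and $\zeta_n=\begin{pmatrix}Z_n\\ \sum_{k=1}^{n-1}\beta_kZ_k\end{pmatrix}\in\mathbb{R}^{2p}$ for $n\ge1$, $\zeta_0=0$. Then $\zeta_n=\widetilde A_{n-1}\zeta_{n-1}+\ell\sigma_n\varepsilon_n$ with $\widetilde A_n=\begin{pmatrix}A_0&\beta_nA_0\\ \beta_nId_p&Id_p\end{pmatrix}$ and $\ell=(1,0,\dots,0)^*\in\mathbb{R}^{2p}$. MLE: with $a_n=(Id_p,\beta_nId_p)^*$ (a $2p\times p$ matrix), $$\widehat\theta_n=\Big(\sum_{i=1}^n\frac{a_{i-1}^*\zeta_{i-1}\zeta_{i-1}^*a_{i-1}}{\sigma_i^2}\Big)^{-1}\Big(\sum_{i=1}^n\frac{a_{i-1}^*\zeta_{i-1}\,\ell^*\zeta_i}{\sigma_i^2}\Big)$$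 (defined when the matrix is invertible; for the finitely many $n$ for which it is not, $\widehat\theta_n$ is set to an arbitrary fixed value). *)

theory Defs
  imports
    "HOL-Probability.Probability"
    "HOL-Library.Landau_Symbols"
    "Jordan_Normal_Form.Gauss_Jordan_Elimination"
    "Jordan_Normal_Form.Spectral_Radius"
begin

text \<open>
  Vectors and matrices are those of Jordan Normal Form, with components indexed from \<open>0\<close>;
  the autoregressive coefficient \<open>\<theta>\<^sub>i\<close> is \<open>\<theta> $ (i - 1)\<close>. Processes \<open>nat \<Rightarrow> 'a \<Rightarrow> real\<close> are indexed by \<open>n \<ge> 1\<close>:
  the value at time \<open>0\<close> is unconstrained and never used.
\<close>

no_notation inner (infix "\<bullet>" 70)
no_notation vec_nth (infixl "$" 90)


subsection \<open>The noise\<close>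

definition normal_law :: "real \<Rightarrow> real \<Rightarrow> real measure" where
  "normal_law m s = (if s = 0 then return borel m else density lborel (normal_density m s))"

definition gaussian_process :: "'a measure \<Rightarrow> (nat \<Rightarrow> 'a \<Rightarrow> real) \<Rightarrow> bool" where
  "gaussian_process M \<xi> \<longleftrightarrow>
     (\<forall>n\<ge>1. \<xi> n \<in> borel_measurable M) \<and>
     (\<forall>J c. finite J \<and> J \<subseteq> {1..} \<longrightarrow>
        (\<exists>m s. s \<ge> 0 \<and> distr M borel (\<lambda>\<omega>. \<Sum>n\<in>J. c n * \<xi> n \<omega>) = normal_law m s))"

definition stationary_process :: "'a measure \<Rightarrow> (nat \<Rightarrow> 'a \<Rightarrow> real) \<Rightarrow> bool" where
  "stationary_process M \<xi> \<longleftrightarrow>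
     (\<forall>n\<ge>1. \<xi> n \<in> borel_measurable M) \<and>
     (\<forall>J h. finite J \<and> J \<subseteq> {1..} \<longrightarrow>
        distr M (\<Pi>\<^sub>M n\<in>J. borel) (\<lambda>\<omega>. \<lambda>n\<in>J. \<xi> (n + h) \<omega>) =
        distr M (\<Pi>\<^sub>M n\<in>J. borel) (\<lambda>\<omega>. \<lambda>n\<in>J. \<xi> n \<omega>))"

definition centered_process :: "'a measure \<Rightarrow> (nat \<Rightarrow> 'a \<Rightarrow> real) \<Rightarrow> bool" where
  "centered_process M \<xi> \<longleftrightarrow> (\<forall>n\<ge>1. integrable M (\<xi> n) \<and> integral\<^sup>L M (\<xi> n) = 0)"

definition autocov :: "'a measure \<Rightarrow> (nat \<Rightarrow> 'a \<Rightarrow> real) \<Rightarrow> nat \<Rightarrow> real" where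
  "autocov M \<xi> n = (\<integral>\<omega>. \<xi> 1 \<omega> * \<xi> (1 + n) \<omega> \<partial>M)"

definition is_spectral_density :: "(real \<Rightarrow> real) \<Rightarrow> (nat \<Rightarrow> real) \<Rightarrow> bool" where
  "is_spectral_density f r \<longleftrightarrow>
     (\<forall>x\<in>{-pi..pi}. 0 \<le> f x) \<and>
     set_integrable lborel {-pi..pi} f \<and>
     (\<forall>n. complex_of_real (r n) =
        (CLINT x:{-pi..pi}|lborel. exp (\<i> * of_real (real n * x)) * of_real (f x)))"

text \<open>\<open>\<bar>log x\<bar>\<close> for \<open>x \<ge> 0\<close>, with \<open>\<bar>log 0\<bar> = \<infinity>\<close> instead of the library's \<open>ln 0 = 0\<close>; a spectral
  density vanishing on a set of positive measure must violate log-integrability.\<close>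

definition abs_log :: "real \<Rightarrow> ennreal" where
  "abs_log x = (if x > 0 then ennreal \<bar>ln x\<bar> else \<infinity>)"

definition log_integrable :: "(real \<Rightarrow> real) \<Rightarrow> bool" where
  "log_integrable f \<longleftrightarrow> (\<integral>\<^sup>+x\<in>{-pi..pi}. abs_log (f x) \<partial>lborel) < \<infinity>"


subsection \<open>Innovations and partial autocorrelations\<close>

definition past :: "'a measure \<Rightarrow> (nat \<Rightarrow> 'a \<Rightarrow> real) \<Rightarrow> nat \<Rightarrow> 'a measure" where
  "past M \<xi> n = sigma (space M) {\<xi> i -` B \<inter> space M | i B. i \<in> {1..n} \<and> B \<in> sets borel}"

definition innovations ::
    "'a measure \<Rightarrow> (nat \<Rightarrow> 'a \<Rightarrow> real) \<Rightarrow> (nat \<Rightarrow> real) \<Rightarrow> (nat \<Rightarrow> 'a \<Rightarrow> real) \<Rightarrow> bool" where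
  "innovations M \<xi> \<sigma> \<epsilon> \<longleftrightarrow>
     \<sigma> 1 = 1 \<and> (\<forall>n\<ge>1. \<sigma> n > 0) \<and>
     (AE \<omega> in M. \<sigma> 1 * \<epsilon> 1 \<omega> = \<xi> 1 \<omega>) \<and>
     (\<forall>n\<ge>2. AE \<omega> in M.
        \<sigma> n * \<epsilon> n \<omega> = \<xi> n \<omega> - real_cond_exp M (past M \<xi> (n - 1)) (\<xi> n) \<omega>) \<and>
     prob_space.indep_vars M (\<lambda>_. borel) \<epsilon> {1..} \<and>
     (\<forall>n\<ge>1. distributed M lborel (\<epsilon> n) std_normal_density)"

text \<open>The deterministic coefficients \<open>k(n,i)\<close>, \<open>1 \<le> i \<le> n\<close>, of the innovations; they are unique
  because every \<open>\<sigma> n\<close> is positive.\<close>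

definition innovation_coeffs ::
    "'a measure \<Rightarrow> (nat \<Rightarrow> 'a \<Rightarrow> real) \<Rightarrow> (nat \<Rightarrow> real) \<Rightarrow> (nat \<Rightarrow> 'a \<Rightarrow> real)
      \<Rightarrow> (nat \<Rightarrow> nat \<Rightarrow> real) \<Rightarrow> bool" where
  "innovation_coeffs M \<xi> \<sigma> \<epsilon> k \<longleftrightarrow>
     (\<forall>n\<ge>1. k n n = 1 \<and> (AE \<omega> in M. \<sigma> n * \<epsilon> n \<omega> = (\<Sum>i=1..n. k n i * \<xi> i \<omega>)))"

definition pacf :: "(nat \<Rightarrow> nat \<Rightarrow> real) \<Rightarrow> nat \<Rightarrow> real" where
  "pacf k n = (if n = 0 then 1 else - k (n + 1) 1)"


subsection \<open>The autoregressive model\<close>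

definition companion :: "real vec \<Rightarrow> real mat" where
  "companion \<theta> = mat (dim_vec \<theta>) (dim_vec \<theta>)
     (\<lambda>(i, j). if i = 0 then \<theta> $ j else if i = Suc j then 1 else 0)"

definition Theta :: "nat \<Rightarrow> real vec set" where
  "Theta p = {\<theta> \<in> carrier_vec p. spectral_radius (map_mat complex_of_real (companion \<theta>)) < 1}"

function ar :: "real vec \<Rightarrow> (nat \<Rightarrow> 'a \<Rightarrow> real) \<Rightarrow> int \<Rightarrow> 'a \<Rightarrow> real" where
  "ar \<theta> \<xi> n \<omega> =
     (if n \<le> 0 then 0
      else (\<Sum>i=1..dim_vec \<theta>. \<theta> $ (i - 1) * ar \<theta> \<xi> (n - int i) \<omega>) + \<xi> (nat n) \<omega>)"
  by pat_completeness auto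
termination
  by (relation "Wellfounded.measure (\<lambda>(\<theta>, \<xi>, n, \<omega>). nat n)") auto

declare ar.simps [simp del]

definition Y_vec :: "real vec \<Rightarrow> (nat \<Rightarrow> 'a \<Rightarrow> real) \<Rightarrow> nat \<Rightarrow> 'a \<Rightarrow> real vec" where
  "Y_vec \<theta> \<xi> n \<omega> = vec (dim_vec \<theta>) (\<lambda>j. ar \<theta> \<xi> (int n - int j) \<omega>)"

definition vec_sum :: "nat \<Rightarrow> ('i \<Rightarrow> real vec) \<Rightarrow> 'i set \<Rightarrow> real vec" where
  "vec_sum d v I = vec d (\<lambda>j. \<Sum>i\<in>I. v i $ j)"

definition mat_sum :: "nat \<Rightarrow> nat \<Rightarrow> ('i \<Rightarrow> real mat) \<Rightarrow> 'i set \<Rightarrow> real mat" where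
  "mat_sum d e A I = mat d e (\<lambda>(r, c). \<Sum>i\<in>I. A i $$ (r, c))"

definition outer_prod :: "real vec \<Rightarrow> real vec \<Rightarrow> real mat" where
  "outer_prod u v = mat (dim_vec u) (dim_vec v) (\<lambda>(i, j). u $ i * v $ j)"

definition Z_vec ::
    "(nat \<Rightarrow> nat \<Rightarrow> real) \<Rightarrow> real vec \<Rightarrow> (nat \<Rightarrow> 'a \<Rightarrow> real) \<Rightarrow> nat \<Rightarrow> 'a \<Rightarrow> real vec" where
  "Z_vec k \<theta> \<xi> n \<omega> = vec_sum (dim_vec \<theta>) (\<lambda>i. k n i \<cdot>\<^sub>v Y_vec \<theta> \<xi> i \<omega>) {1..n}"

definition zeta ::
    "(nat \<Rightarrow> nat \<Rightarrow> real) \<Rightarrow> real vec \<Rightarrow> (nat \<Rightarrow> 'a \<Rightarrow> real) \<Rightarrow> nat \<Rightarrow> 'a \<Rightarrow> real vec" where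
  "zeta k \<theta> \<xi> n \<omega> =
     (if n = 0 then 0\<^sub>v (2 * dim_vec \<theta>)
      else Z_vec k \<theta> \<xi> n \<omega> @\<^sub>v
           vec_sum (dim_vec \<theta>) (\<lambda>j. pacf k j \<cdot>\<^sub>v Z_vec k \<theta> \<xi> j \<omega>) {1..<n})"


subsection \<open>The maximum likelihood estimator\<close>

definition a_mat :: "(nat \<Rightarrow> nat \<Rightarrow> real) \<Rightarrow> nat \<Rightarrow> nat \<Rightarrow> real mat" where
  "a_mat k p n = 1\<^sub>m p @\<^sub>r (pacf k n \<cdot>\<^sub>m 1\<^sub>m p)"

definition mle_mat ::
    "(nat \<Rightarrow> nat \<Rightarrow> real) \<Rightarrow> (nat \<Rightarrow> real) \<Rightarrow> real vec \<Rightarrow> (nat \<Rightarrow> 'a \<Rightarrow> real) \<Rightarrow> nat \<Rightarrow> 'a \<Rightarrow> real mat"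
where
  "mle_mat k \<sigma> \<theta> \<xi> n \<omega> = (let p = dim_vec \<theta> in
     mat_sum p p (\<lambda>i. (1 / (\<sigma> i)\<^sup>2) \<cdot>\<^sub>m
       (transpose_mat (a_mat k p (i - 1))
          * outer_prod (zeta k \<theta> \<xi> (i - 1) \<omega>) (zeta k \<theta> \<xi> (i - 1) \<omega>)
          * a_mat k p (i - 1))) {1..n})"

definition mle_vec ::
    "(nat \<Rightarrow> nat \<Rightarrow> real) \<Rightarrow> (nat \<Rightarrow> real) \<Rightarrow> real vec \<Rightarrow> (nat \<Rightarrow> 'a \<Rightarrow> real) \<Rightarrow> nat \<Rightarrow> 'a \<Rightarrow> real vec"
where
  "mle_vec k \<sigma> \<theta> \<xi> n \<omega> = (let p = dim_vec \<theta> in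
     vec_sum p (\<lambda>i. ((unit_vec (2 * p) 0 \<bullet> zeta k \<theta> \<xi> i \<omega>) / (\<sigma> i)\<^sup>2) \<cdot>\<^sub>v
       (transpose_mat (a_mat k p (i - 1)) *\<^sub>v zeta k \<theta> \<xi> (i - 1) \<omega>)) {1..n})"

text \<open>The argument \<open>\<theta>\<close> is the true parameter, entering only through the observed path \<open>X\<close> on which
  \<open>zeta\<close> is computed; \<open>v\<^sub>0\<close> is the value taken when the normalising matrix is singular.\<close>

definition mle ::
    "real vec \<Rightarrow> (nat \<Rightarrow> nat \<Rightarrow> real) \<Rightarrow> (nat \<Rightarrow> real) \<Rightarrow> real vec \<Rightarrow> (nat \<Rightarrow> 'a \<Rightarrow> real)
      \<Rightarrow> nat \<Rightarrow> 'a \<Rightarrow> real vec" where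
  "mle v\<^sub>0 k \<sigma> \<theta> \<xi> n \<omega> =
     (case mat_inverse (mle_mat k \<sigma> \<theta> \<xi> n \<omega>) of
        Some B \<Rightarrow> B *\<^sub>v mle_vec k \<sigma> \<theta> \<xi> n \<omega>
      | None \<Rightarrow> v\<^sub>0)"


subsection \<open>The limit\<close>

definition lyapunov_solution :: "real vec \<Rightarrow> real mat \<Rightarrow> bool" where
  "lyapunov_solution \<theta> S \<longleftrightarrow> (let p = dim_vec \<theta>; A\<^sub>0 = companion \<theta>; b = unit_vec p 0 in
     S \<in> carrier_mat p p \<and> S = A\<^sub>0 * S * transpose_mat A\<^sub>0 + outer_prod b b)"

definition fisher :: "real vec \<Rightarrow> real mat" where
  "fisher \<theta> = (THE S. lyapunov_solution \<theta> S)"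

definition mat_tendsto :: "(nat \<Rightarrow> real mat) \<Rightarrow> real mat \<Rightarrow> bool" where
  "mat_tendsto A L \<longleftrightarrow>
     (\<forall>n. A n \<in> carrier_mat (dim_row L) (dim_col L)) \<and>
     (\<forall>i<dim_row L. \<forall>j<dim_col L. (\<lambda>n. A n $$ (i, j)) \<longlonglongrightarrow> L $$ (i, j))"

end

theory Submission
  imports Defs
begin

text \<open>
  With \<open>U\<^sub>n = a\<^sub>n\<^sup>* \<zeta>\<^sub>n\<close> and \<open>u\<^sub>n = U\<^sub>n / \<sigma>\<^sub>n\<^sub>+\<^sub>1\<close> the estimation error is \<open>P\<^sub>n\<^sup>-\<^sup>1 m\<^sub>n\<close>, where \<open>P\<^sub>n = \<Sum> u\<^sub>i\<^sub>-\<^sub>1 u\<^sub>i\<^sub>-\<^sub>1\<^sup>*\<close> and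
  \<open>m\<^sub>n = \<Sum> u\<^sub>i\<^sub>-\<^sub>1 \<epsilon>\<^sub>i\<close> is a martingale. The Durbin--Levinson recursion shows that \<open>u\<^sub>n\<close> is the autoregression
  \<open>A\<^sub>0 u\<^sub>n\<^sub>-\<^sub>1 + b \<epsilon>\<^sub>n\<close> up to a perturbation of order \<open>\<beta>\<^sub>n \<Sum>\<^sub>j\<^sub><\<^sub>n \<beta>\<^sub>j Z\<^sub>j\<close>. By Cauchy--Schwarz the variance of this
  perturbation is at most a constant times \<open>n \<beta>\<^sub>n\<^sup>2\<close>, so it averages out because \<open>\<alpha>\<^sub>2 > 1\<close>, and a norm contracted by
  \<open>A\<^sub>0\<close> bounds the fourth moments of \<open>u\<^sub>n\<close> uniformly. Hence \<open>P\<^sub>n / n\<close> satisfies the Lyapunov equation up to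
  \<open>o(1)\<close> and converges to \<open>I(\<theta>)\<close>.

  It remains to show that \<open>(1 / log n) \<Sum> m\<^sub>k m\<^sub>k\<^sup>* / k\<^sup>2\<close> tends to \<open>I(\<theta>)\<close>. By polarization it suffices to treat a scalar
  martingale with increments \<open>d\<^sub>k\<close>, for which Abel summation gives
  \<open>m\<^sub>n\<^sup>2 / n + \<Sum> m\<^sub>k\<^sup>2 / (k (k + 1)) = \<Sum> (2 m\<^sub>k d\<^sub>k\<^sub>+\<^sub>1 + d\<^sub>k\<^sub>+\<^sub>1\<^sup>2) / (k + 1)\<close>. Second moments show that \<open>m\<^sub>n\<^sup>2 / n\<close> and the
  martingale part of the right-hand side are \<open>o(log n)\<close> along \<open>n = 2\<^bsup>j\<^sup>2\<^esup>\<close>, and monotonicity fills the gaps.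
\<close>

subsection \<open>Averages of real sequences\<close>

text \<open>Every almost sure limit is extracted from summable expectations; no martingale
  convergence theorem is invoked. This forces moments of order four: E m_n^2 = O(n) gives only E
  (m_n / n)^2 = O(1/n), which is not summable, whereas E m_n^4 = O(n^2) makes E (m_n / n)^4
  summable. The obstacle in the moment bounds is that the accumulated sum of the beta_j Z_j
  remembers the whole past, so the recursion for Z does not contract the previous value alone. The
  past enters fourth moments with the coefficient (n beta_n^2)^2, which eventually falls below the
  gap left by the contraction. The processes are rebuilt from the innovations at every sample point,
  so that adaptedness to the filtration of the innovations is exact; they are identified with the
  observed vectors only at the end, on the almost sure event where all innovation equations
  hold.\<close>

lemma weighted_average:
  fixes a x q :: "nat \<Rightarrow> real"
  assumes a: "filterlim a at_top sequentially"
    and x: "(\<lambda>n. (\<Sum>k<n. x k) / a n) \<longlonglongrightarrow> L"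
    and B: "\<forall>\<^sub>F n in sequentially. (\<Sum>k<n. \<bar>x k\<bar>) \<le> B * a n"
    and q: "q \<longlonglongrightarrow> c"
  shows "(\<lambda>n. (\<Sum>k<n. q k * x k) / a n) \<longlonglongrightarrow> c * L"
proof -
  have "(\<lambda>n. (\<Sum>k<n. (q k - c) * x k) / a n) \<longlonglongrightarrow> 0"
  proof (rule LIMSEQ_I)
    fix e :: real assume e: "e > 0"
    \<comment> \<open>Terms with \<open>q k\<close> within \<open>d\<close> of \<open>c\<close>
      contribute at most half of the error \<open>e * a n\<close>. The finitely many others add up
      to the constant \<open>K\<close> below, which is negligible because \<open>a\<close>
      diverges.\<close>
    define d where "d = e / (2 * (\<bar>B\<bar> + 1))"
    have d: "d > 0" using e by (simp add: d_def)
    have "\<forall>\<^sub>F k in sequentially. \<bar>q k - c\<bar> < d"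
      using tendstoD[OF q d] by (simp add: dist_real_def)
    then obtain N where N: "\<And>k. k \<ge> N \<Longrightarrow> \<bar>q k - c\<bar> < d"
      by (auto simp: eventually_sequentially)
    define K where "K = (\<Sum>k<N. \<bar>q k - c\<bar> * \<bar>x k\<bar>)"
    have "\<forall>\<^sub>F n in sequentially. a n > max 0 (2 * K / e)"
      using a unfolding filterlim_at_top_dense by blast
    then have "\<forall>\<^sub>F n in sequentially. norm ((\<Sum>k<n. (q k - c) * x k) / a n - 0) < e"
      using B eventually_ge_at_top[of N]
    proof eventually_elim
      case (elim n)
      have an: "a n > 0" "K < e / 2 * a n" using elim(1) e by (auto simp: field_simps)
      have "\<bar>\<Sum>k<n. (q k - c) * x k\<bar> \<le> (\<Sum>k<n. \<bar>q k - c\<bar> * \<bar>x k\<bar>)"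
        by (rule order_trans[OF sum_abs]) (simp add: abs_mult)
      also have "\<dots> \<le> (\<Sum>k<n. (if k < N then \<bar>q k - c\<bar> * \<bar>x k\<bar> else 0) + d * \<bar>x k\<bar>)"
        using N d by (intro sum_mono) (force intro: mult_right_mono less_imp_le)
      also have "\<dots> = K + d * (\<Sum>k<n. \<bar>x k\<bar>)"
      proof -
        have "(\<Sum>k<n. (if k < N then \<bar>q k - c\<bar> * \<bar>x k\<bar> else 0)) = K"
          unfolding K_def using elim(3)
          by (subst sum.mono_neutral_cong_left[of "{..<n}" "{..<N}"]) auto
        then show ?thesis by (simp add: sum.distrib sum_distrib_left)
      qed
      also have "\<dots> \<le> K + d * (B * a n)"
        using elim(2) d by (intro add_left_mono mult_left_mono) auto
      also have "\<dots> \<le> K + d * ((\<bar>B\<bar> + 1) * a n)"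
        using an d by (intro add_left_mono mult_left_mono mult_right_mono) auto
      also have "d * ((\<bar>B\<bar> + 1) * a n) = e / 2 * a n"
        by (simp add: d_def field_simps)
      finally have "\<bar>\<Sum>k<n. (q k - c) * x k\<bar> < e * a n" using an by simp
      then show ?case using an by (simp add: field_simps)
    qed
    then show "\<exists>n0. \<forall>n\<ge>n0. norm ((\<Sum>k<n. (q k - c) * x k) / a n - 0) < e"
      by (simp add: eventually_sequentially)
  qed
  from tendsto_add[OF this tendsto_mult_left[OF x, of c]] show ?thesis
    by (simp add: algebra_simps sum_subtractf sum_distrib_left diff_divide_distrib
        sum_divide_distrib)
qed

text \<open>For nonnegative summands the convergence of the averages already supplies the bound on
  absolute sums.\<close>

lemma weighted_average_nonneg:
  fixes a x q :: "nat \<Rightarrow> real"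
  assumes a: "filterlim a at_top sequentially"
    and x: "(\<lambda>n. (\<Sum>k<n. x k) / a n) \<longlonglongrightarrow> L"
    and nonneg: "\<And>k. x k \<ge> 0"
    and q: "q \<longlonglongrightarrow> c"
  shows "(\<lambda>n. (\<Sum>k<n. q k * x k) / a n) \<longlonglongrightarrow> c * L"
proof (rule weighted_average[OF a x _ q])
  have "\<forall>\<^sub>F n in sequentially. (\<Sum>k<n. x k) / a n < L + 1"
    by (rule order_tendstoD[OF x]) simp
  moreover have "\<forall>\<^sub>F n in sequentially. a n > 0"
    using a unfolding filterlim_at_top_dense by blast
  ultimately show "\<forall>\<^sub>F n in sequentially. (\<Sum>k<n. \<bar>x k\<bar>) \<le> (L + 1) * a n"
    by eventually_elim (use nonneg in \<open>simp add: field_simps\<close>)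
qed

lemma cesaro:
  fixes q :: "nat \<Rightarrow> real"
  assumes "q \<longlonglongrightarrow> c"
  shows "(\<lambda>n. (\<Sum>k<n. q k) / real n) \<longlonglongrightarrow> c"
proof -
  have "(\<lambda>n. (\<Sum>k<n. 1) / real n) \<longlonglongrightarrow> 1"
    by (rule Lim_transform_eventually[OF tendsto_const])
      (use eventually_gt_at_top[of 0] in \<open>eventually_elim, simp\<close>)
  from weighted_average_nonneg[OF filterlim_real_sequentially this _ assms] show ?thesis by simp
qed

lemma ln_real_at_top: "filterlim (\<lambda>n. ln (real n)) at_top sequentially"
  by (rule filterlim_compose[OF ln_at_top filterlim_real_sequentially])

lemma harmonic_over_ln: "(\<lambda>n. (\<Sum>k<n. 1 / real (Suc k)) / ln (real n)) \<longlonglongrightarrow> 1"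
proof -
  have "(\<lambda>n. (harm n - ln (real n)) / ln (real n)) \<longlonglongrightarrow> 0"
    by (rule tendsto_divide_0[OF euler_mascheroni_LIMSEQ])
      (rule filterlim_mono[OF ln_real_at_top], auto simp: at_top_le_at_infinity)
  from tendsto_add[OF this tendsto_const[of 1]]
  have "(\<lambda>n. (harm n - ln (real n)) / ln (real n) + 1) \<longlonglongrightarrow> (1::real)" by simp
  then show ?thesis
  proof (rule Lim_transform_eventually)
    show "\<forall>\<^sub>F n in sequentially. (harm n - ln (real n)) / ln (real n) + 1
        = (\<Sum>k<n. 1 / real (Suc k)) / ln (real n)"
      using eventually_gt_at_top[of 1]
    proof eventually_elim
      case (elim n)
      have "harm n = (\<Sum>k<n. 1 / real (Suc k))"
        by (simp add: harm_altdef inverse_eq_divide)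
      then show ?case using elim by (simp add: field_simps)
    qed
  qed
qed

text \<open>Summation by parts, resting on 1/n = 1/(n+1) + 1/(n(n+1)). The last summand at
  \<open>k = 0\<close> is an empty sum divided by zero, hence zero.\<close>

lemma abel_sum:
  fixes x :: "nat \<Rightarrow> real"
  assumes "n > 0"
  shows "(\<Sum>k<n. x k / real (Suc k)) = (\<Sum>k<n. x k) / real n
    + (\<Sum>k<n. ((\<Sum>i<k. x i) / real k) * (1 / real (Suc k)))"
  using assms
proof (induction n)
  case (Suc n)
  show ?case
  proof (cases "n = 0")
    case False
    then have "(\<Sum>i<n. x i) / real n = (\<Sum>i<n. x i) / real (Suc n)
        + (\<Sum>i<n. x i) / real n * (1 / real (Suc n))"
      by (simp add: divide_simps) (simp add: algebra_simps)
    then show ?thesis using Suc False by (simp add: add_divide_distrib)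
  qed auto
qed simp

text \<open>By summation by parts the logarithmic mean is a Cesaro mean divided by
  \<open>ln n\<close>, which vanishes, plus an average of Cesaro means with harmonic weights, which
  keeps their limit.\<close>

lemma log_average:
  fixes x :: "nat \<Rightarrow> real"
  assumes x: "(\<lambda>n. (\<Sum>k<n. x k) / real n) \<longlonglongrightarrow> L"
  shows "(\<lambda>n. (\<Sum>k<n. x k / real (Suc k)) / ln (real n)) \<longlonglongrightarrow> L"
proof -
  have 1: "(\<lambda>n. (\<Sum>k<n. ((\<Sum>i<k. x i) / real k) * (1 / real (Suc k))) / ln (real n)) \<longlonglongrightarrow> L * 1"
    by (rule weighted_average_nonneg[OF ln_real_at_top harmonic_over_ln _ x]) simp
  have 2: "(\<lambda>n. (\<Sum>k<n. x k) / real n / ln (real n)) \<longlonglongrightarrow> 0"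
    by (rule tendsto_divide_0[OF x])
      (rule filterlim_mono[OF ln_real_at_top], auto simp: at_top_le_at_infinity)
  show ?thesis
  proof (rule Lim_transform_eventually)
    show "(\<lambda>n. (\<Sum>k<n. x k) / real n / ln (real n)
      + (\<Sum>k<n. ((\<Sum>i<k. x i) / real k) * (1 / real (Suc k))) / ln (real n)) \<longlonglongrightarrow> L"
      using tendsto_add[OF 2 1] by simp
    show "\<forall>\<^sub>F n in sequentially. (\<Sum>k<n. x k) / real n / ln (real n)
      + (\<Sum>k<n. ((\<Sum>i<k. x i) / real k) * (1 / real (Suc k))) / ln (real n)
      = (\<Sum>k<n. x k / real (Suc k)) / ln (real n)"
      using eventually_gt_at_top[of 0]
    proof eventually_elim
      case (elim n)
      show ?case unfolding abel_sum[OF elim] by (simp add: add_divide_distrib)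
    qed
  qed
qed

text \<open>Kronecker's lemma for the weights k + 1: if t denotes the partial sums of the series,
  the average of x is t_n minus the Cesaro mean of t, and both have the same limit.\<close>

lemma kronecker_average:
  fixes x :: "nat \<Rightarrow> real"
  assumes "summable (\<lambda>k. x k / real (Suc k))"
  shows "(\<lambda>n. (\<Sum>k<n. x k) / real n) \<longlonglongrightarrow> 0"
proof -
  define t where "t n = (\<Sum>k<n. x k / real (Suc k))" for n
  from assms have t: "t \<longlonglongrightarrow> suminf (\<lambda>k. x k / real (Suc k))"
    unfolding t_def by (rule summable_LIMSEQ)
  have eq: "(\<Sum>k<n. x k) = real n * t n - (\<Sum>k<n. t k)" for n
  proof (induction n)
    case (Suc n)
    have "t (Suc n) = t n + x n / real (Suc n)" by (simp add: t_def)
    then have "x n = real (Suc n) * (t (Suc n) - t n)" by simp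
    then show ?case using Suc.IH by (simp add: algebra_simps)
  qed simp
  show ?thesis
  proof (rule Lim_transform_eventually)
    show "(\<lambda>n. t n - (\<Sum>k<n. t k) / real n) \<longlonglongrightarrow> 0"
      using tendsto_diff[OF t cesaro[OF t]] by simp
    show "\<forall>\<^sub>F n in sequentially. t n - (\<Sum>k<n. t k) / real n = (\<Sum>k<n. x k) / real n"
      using eventually_gt_at_top[of 0] by eventually_elim (simp add: eq field_simps)
  qed
qed

text \<open>Between two consecutive nodes of \<open>g\<close> the monotone \<open>T\<close> and
  \<open>a\<close> are squeezed by their values at these nodes, and nothing is lost because
  \<open>a\<close> grows by a factor tending to 1.\<close>

lemma mono_interpolation:
  fixes T a :: "nat \<Rightarrow> real" and g :: "nat \<Rightarrow> nat"
  assumes T: "mono T" "\<And>n. T n \<ge> 0" and a: "mono a" and g: "strict_mono g"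
    and apos: "\<And>j. a (g j) > 0"
    and ratio: "(\<lambda>j. a (g (Suc j)) / a (g j)) \<longlonglongrightarrow> 1"
    and lim: "(\<lambda>j. T (g j) / a (g j)) \<longlonglongrightarrow> L"
  shows "(\<lambda>n. T n / a n) \<longlonglongrightarrow> L"
proof -
  define J where "J n = (GREATEST j. g j \<le> n)" for n
  have J: "g (J n) \<le> n" "n < g (Suc (J n))" if "g 0 \<le> n" for n
  proof -
    have bnd: "\<forall>j. g j \<le> n \<longrightarrow> j \<le> n"
      using seq_suble[OF g] order_trans by blast
    show "g (J n) \<le> n" unfolding J_def 
      by (rule GreatestI_nat[where P = "\<lambda>j. g j \<le> n" and k = 0 and b = n])
        (use that bnd in auto)
    show "n < g (Suc (J n))"
    proof (rule ccontr)
      assume "\<not> n < g (Suc (J n))"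
      then have "Suc (J n) \<le> J n" unfolding J_def
        by (intro Greatest_le_nat[of _ _ n]) (use bnd in auto)
      then show False by simp
    qed
  qed
  have Jlim: "filterlim J at_top sequentially"
    unfolding filterlim_at_top
  proof
    fix m
    have "\<forall>\<^sub>F n in sequentially. n \<ge> max (g 0) (g m)" by (rule eventually_ge_at_top)
    then show "\<forall>\<^sub>F n in sequentially. m \<le> J n"
    proof eventually_elim
      case (elim n)
      then have "g m < g (Suc (J n))" using J(2)[of n] by simp
      then show ?case using strict_mono_less[OF g] by simp
    qed
  qed
  have lim': "(\<lambda>j. T (g (Suc j)) / a (g (Suc j))) \<longlonglongrightarrow> L" by (rule LIMSEQ_Suc[OF lim])
  have ratio': "(\<lambda>j. a (g j) / a (g (Suc j))) \<longlonglongrightarrow> 1"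
    using tendsto_inverse[OF ratio] by simp
  have lo: "(\<lambda>j. T (g j) / a (g (Suc j))) \<longlonglongrightarrow> L"
    using tendsto_mult[OF lim ratio'] apos by (simp add: less_imp_neq[THEN not_sym])
  have hi: "(\<lambda>j. T (g (Suc j)) / a (g j)) \<longlonglongrightarrow> L"
    using tendsto_mult[OF lim' ratio] apos by (simp add: less_imp_neq[THEN not_sym])
  show ?thesis
  proof (rule tendsto_sandwich)
    show "(\<lambda>n. T (g (J n)) / a (g (Suc (J n)))) \<longlonglongrightarrow> L"
      by (rule filterlim_compose[OF lo Jlim])
    show "(\<lambda>n. T (g (Suc (J n))) / a (g (J n))) \<longlonglongrightarrow> L"
      by (rule filterlim_compose[OF hi Jlim])
    show "\<forall>\<^sub>F n in sequentially. T (g (J n)) / a (g (Suc (J n))) \<le> T n / a n"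
      using eventually_ge_at_top[of "g 0"]
    proof eventually_elim
      case (elim n)
      have "a (g (J n)) \<le> a n" "a n \<le> a (g (Suc (J n)))" "T (g (J n)) \<le> T n"
        using J[OF elim] monoD[OF a] monoD[OF T(1)] by auto
      then show ?case using apos[of "J n"] T(2)
        by (intro frac_le) auto
    qed
    show "\<forall>\<^sub>F n in sequentially. T n / a n \<le> T (g (Suc (J n))) / a (g (J n))"
      using eventually_ge_at_top[of "g 0"]
    proof eventually_elim
      case (elim n)
      have "a (g (J n)) \<le> a n" "T n \<le> T (g (Suc (J n)))"
        using J[OF elim] monoD[OF a] monoD[OF T(1)] by auto
      then show ?case using apos[of "J n"] T(2)
        by (intro frac_le) auto
    qed
  qed
qed

subsection \<open>Stable matrices and the Lyapunov equation\<close>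

text \<open>For \<open>r\<close> strictly between the spectral radius and 1, the matrix A / r still
  has spectral radius below 1, so its powers are bounded by Jordan normal form theory. Undoing the
  scaling yields the factor r^k.\<close>

lemma power_entry_bound:
  fixes A :: "real mat"
  assumes A: "A \<in> carrier_mat p p" and p: "p > 0"
    and sr: "spectral_radius (map_mat complex_of_real A) < 1"
  shows "\<exists>c r. c > 0 \<and> 0 < r \<and> r < 1 \<and>
    (\<forall>k. \<forall>i<p. \<forall>j<p. \<bar>(A ^\<^sub>m k) $$ (i, j)\<bar> \<le> c * r ^ k)"
proof -
  let ?C = "map_mat complex_of_real A"
  have C: "?C \<in> carrier_mat p p" using A by simp
  define r where "r = (1 + max 0 (spectral_radius ?C)) / 2"
  have r: "0 < r" "r < 1" "spectral_radius ?C < r" using sr by (auto simp: r_def)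
  define B where "B = map_mat complex_of_real ((1 / r) \<cdot>\<^sub>m A)"
  have B: "B \<in> carrier_mat p p" using A by (simp add: B_def)
  have "x < 1" if x: "x \<in> norm ` spectrum B" for x
  proof -
    from x obtain l v where l: "x = norm l" and v: "v \<in> carrier_vec p" "v \<noteq> 0\<^sub>v p"
      and ev: "B *\<^sub>v v = l \<cdot>\<^sub>v v"
      using B by (auto simp: spectrum_def eigenvalue_def eigenvector_def)
    have "?C = complex_of_real r \<cdot>\<^sub>m B" using r A by (auto simp: B_def)
    then have "?C *\<^sub>v v = complex_of_real r \<cdot>\<^sub>v (B *\<^sub>v v)"
      using B v by auto
    then have "?C *\<^sub>v v = (of_real r * l) \<cdot>\<^sub>v v" using ev by (simp add: smult_smult_assoc)
    then have "of_real r * l \<in> spectrum ?C"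
      using C v by (auto simp: spectrum_def eigenvalue_def eigenvector_def)
    then have "norm (complex_of_real r * l) \<le> spectral_radius ?C"
      by (intro spectral_radius_mem_max(2)[OF C p]) auto
    then have "r * x \<le> spectral_radius ?C" using r by (simp add: norm_mult l)
    then have "r * x < r * 1" using r by linarith
    then show ?thesis using r by (simp only: mult_less_cancel_left_pos)
  qed
  with spectral_radius_mem_max(1)[OF B p] have "spectral_radius B < 1" by blast
  from spectral_radius_jnf_norm_bound_less_1_upper_triangular[OF B this]
  obtain c where c: "\<And>k. norm_bound (B ^\<^sub>m k) c" by blast
  have pow: "(((1 / r) \<cdot>\<^sub>m A) ^\<^sub>m k) = (1 / r) ^ k \<cdot>\<^sub>m (A ^\<^sub>m k)" for k
  proof (induction k)
    case 0
    then show ?case using A by auto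
  next
    case (Suc k)
    have Ak: "A ^\<^sub>m k \<in> carrier_mat p p" using A by (rule pow_carrier_mat)
    have "((1 / r) ^ k \<cdot>\<^sub>m (A ^\<^sub>m k)) * ((1 / r) \<cdot>\<^sub>m A) = (1 / r) ^ k \<cdot>\<^sub>m ((1 / r) \<cdot>\<^sub>m (A ^\<^sub>m k * A))"
      unfolding mult_smult_assoc_mat[OF Ak smult_carrier_mat[OF A]] mult_smult_distrib[OF Ak A] ..
    also have "\<dots> = (1 / r) ^ Suc k \<cdot>\<^sub>m (A ^\<^sub>m Suc k)" by (rule eq_matI) auto
    finally show ?case using Suc by simp
  qed
  have "\<bar>(A ^\<^sub>m k) $$ (i, j)\<bar> \<le> max c 1 * r ^ k" if "i < p" "j < p" for k i j
  proof -
    have "B ^\<^sub>m k = map_mat complex_of_real (((1 / r) \<cdot>\<^sub>m A) ^\<^sub>m k)"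
      unfolding B_def using A by (intro of_real_hom.mat_hom_pow[symmetric]) auto
    then have "(B ^\<^sub>m k) $$ (i, j) = complex_of_real ((1 / r) ^ k * (A ^\<^sub>m k) $$ (i, j))"
      using A that by (simp add: pow)
    moreover have "norm ((B ^\<^sub>m k) $$ (i, j)) \<le> c"
      using c[of k] B that by (simp add: norm_bound_def)
    ultimately have "(1 / r) ^ k * \<bar>(A ^\<^sub>m k) $$ (i, j)\<bar> \<le> c"
      using r by (simp add: norm_mult norm_divide norm_power power_divide)
    then have "\<bar>(A ^\<^sub>m k) $$ (i, j)\<bar> \<le> c * r ^ k"
      using r by (simp add: power_divide field_simps)
    also have "\<dots> \<le> max c 1 * r ^ k" using r by (intro mult_right_mono) auto
    finally show ?thesis .
  qed
  then show ?thesis using r by (intro exI[of _ "max c 1"] exI[of _ r]) auto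
qed

lemma suminf_sum2:
  fixes f :: "nat \<Rightarrow> nat \<Rightarrow> nat \<Rightarrow> real"
  assumes "\<And>a b. a < p \<Longrightarrow> b < p \<Longrightarrow> summable (f a b)"
  shows "(\<Sum>k. \<Sum>a<p. \<Sum>b<p. f a b k) = (\<Sum>a<p. \<Sum>b<p. \<Sum>k. f a b k)"
proof -
  have "(\<Sum>k. \<Sum>a<p. \<Sum>b<p. f a b k) = (\<Sum>a<p. \<Sum>k. \<Sum>b<p. f a b k)"
    using assms by (intro suminf_sum summable_sum) auto
  also have "\<dots> = (\<Sum>a<p. \<Sum>b<p. \<Sum>k. f a b k)"
    using assms by (intro sum.cong refl suminf_sum) auto
  finally show ?thesis .
qed

locale stable_matrix =
  fixes A :: "real mat" and p :: nat and c r :: real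
  assumes A: "A \<in> carrier_mat p p" and p: "p > 0" and c: "c > 0" and r: "0 < r" "r < 1"
    and bound: "\<And>k i j. i < p \<Longrightarrow> j < p \<Longrightarrow> \<bar>(A ^\<^sub>m k) $$ (i, j)\<bar> \<le> c * r ^ k"
begin

text \<open>Inside this locale vectors and matrices are plain functions of their indices, of which
  only those below \<open>p\<close> matter; sums over \<open>{..<p}\<close> then carry no dimension
  conditions.\<close>

definition pw :: "nat \<Rightarrow> nat \<Rightarrow> nat \<Rightarrow> real" where
  "pw k i j = (A ^\<^sub>m k) $$ (i, j)"

definition mv :: "(nat \<Rightarrow> real) \<Rightarrow> nat \<Rightarrow> real" where
  "mv x i = (\<Sum>j<p. A $$ (i, j) * x j)"

lemma pw_bound: "i < p \<Longrightarrow> j < p \<Longrightarrow> \<bar>pw k i j\<bar> \<le> c * r ^ k"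
  using bound by (simp add: pw_def)

lemma pw_0: "i < p \<Longrightarrow> j < p \<Longrightarrow> pw 0 i j = (if i = j then 1 else 0)"
  using A by (simp add: pw_def)

lemma pw_Suc: "i < p \<Longrightarrow> j < p \<Longrightarrow> pw (Suc k) i j = (\<Sum>l<p. pw k i l * A $$ (l, j))"
  using A unfolding pw_def
  by (simp add: times_mat_def scalar_prod_def lessThan_atLeast0 row_def)

text \<open>Powers are built by multiplication on the right; the Lyapunov equation of the Gramian
  needs the new factor on the left.\<close>

lemma pw_Suc2: "i < p \<Longrightarrow> j < p \<Longrightarrow> pw (Suc k) i j = (\<Sum>l<p. A $$ (i, l) * pw k l j)"
proof (induction k arbitrary: j)
  case 0
  have "(\<Sum>l<p. pw 0 i l * A $$ (l, j)) = (\<Sum>l<p. if l = i then A $$ (i, j) else 0)"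
    using 0 by (intro sum.cong) (auto simp: pw_0)
  moreover have "(\<Sum>l<p. A $$ (i, l) * pw 0 l j) = (\<Sum>l<p. if l = j then A $$ (i, j) else 0)"
    using 0 by (intro sum.cong) (auto simp: pw_0)
  ultimately show ?case using 0 by (simp add: pw_Suc)
next
  case (Suc k)
  have "pw (Suc (Suc k)) i j = (\<Sum>l<p. (\<Sum>m<p. A $$ (i, m) * pw k m l) * A $$ (l, j))"
    using Suc by (simp add: pw_Suc[of i j "Suc k"])
  also have "\<dots> = (\<Sum>l<p. \<Sum>m<p. A $$ (i, m) * (pw k m l * A $$ (l, j)))"
    by (simp add: sum_distrib_right mult.assoc)
  also have "\<dots> = (\<Sum>m<p. A $$ (i, m) * (\<Sum>l<p. pw k m l * A $$ (l, j)))"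
    by (subst sum.swap) (simp add: sum_distrib_left)
  finally show ?case using Suc.prems by (simp add: pw_Suc[of _ j k])
qed


text \<open>Weighting the iterates \<open>A\<^sup>k x\<close> by \<open>rate\<^sup>-\<^sup>k\<close>, up to a horizon at which \<open>A\<^sup>k\<close> is smaller than
  \<open>rate\<^sup>k\<close>, gives a norm for which \<open>A\<close> itself is a contraction.\<close>

definition rate :: real where "rate = (1 + r) / 2"

definition horizon :: nat where "horizon = (SOME K. K > 0 \<and> real p * c * r ^ K \<le> rate ^ K)"

definition step_norm :: "nat \<Rightarrow> (nat \<Rightarrow> real) \<Rightarrow> real" where
  "step_norm k x = (\<Sum>i<p. \<bar>\<Sum>j<p. pw k i j * x j\<bar>)"

definition anorm :: "(nat \<Rightarrow> real) \<Rightarrow> real" where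
  "anorm x = (\<Sum>k<horizon. (1 / rate) ^ k * step_norm k x)"

lemma rate: "0 < rate" "rate < 1" "r < rate"
  using r by (auto simp: rate_def)

lemma horizon: "horizon > 0" "real p * c * r ^ horizon \<le> rate ^ horizon"
proof -
  have "(\<lambda>K. real p * c * (r / rate) ^ K) \<longlonglongrightarrow> real p * c * 0"
    by (intro tendsto_mult_left LIMSEQ_realpow_zero) (use r rate in auto)
  then have "\<forall>\<^sub>F K in sequentially. real p * c * (r / rate) ^ K < 1"
    by (intro order_tendstoD) auto
  then have "\<forall>\<^sub>F K in sequentially. K > 0 \<and> real p * c * r ^ K \<le> rate ^ K"
    using eventually_gt_at_top[of 0]
  proof eventually_elim
    case (elim K)
    then show ?case using rate by (simp add: power_divide field_simps)
  qed
  then have "\<exists>K. K > 0 \<and> real p * c * r ^ K \<le> rate ^ K"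
    by (auto simp: eventually_sequentially)
  from someI_ex[OF this] show "horizon > 0" "real p * c * r ^ horizon \<le> rate ^ horizon"
    unfolding horizon_def by auto
qed

lemma step_norm_nonneg: "step_norm k x \<ge> 0"
  by (simp add: step_norm_def sum_nonneg)

lemma step_norm_0: "step_norm 0 x = (\<Sum>i<p. \<bar>x i\<bar>)"
proof -
  have "(\<Sum>j<p. pw 0 i j * x j) = x i" if "i < p" for i
  proof -
    have "(\<Sum>j<p. pw 0 i j * x j) = (\<Sum>j<p. if j = i then x i else 0)"
      using that by (intro sum.cong) (auto simp: pw_0)
    then show ?thesis using that by simp
  qed
  then show ?thesis by (simp add: step_norm_def)
qed

lemma pw_mv: "i < p \<Longrightarrow> (\<Sum>j<p. pw k i j * mv x j) = (\<Sum>j<p. pw (Suc k) i j * x j)"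
proof -
  assume i: "i < p"
  have "(\<Sum>j<p. pw k i j * mv x j) = (\<Sum>j<p. \<Sum>l<p. pw k i j * A $$ (j, l) * x l)"
    by (simp add: mv_def sum_distrib_left mult.assoc)
  also have "\<dots> = (\<Sum>l<p. (\<Sum>j<p. pw k i j * A $$ (j, l)) * x l)"
    by (subst sum.swap) (simp add: sum_distrib_right)
  finally show ?thesis using i by (simp add: pw_Suc)
qed

lemma step_norm_mv: "step_norm k (mv x) = step_norm (Suc k) x"
  by (simp add: step_norm_def pw_mv)

lemma step_norm_bound: "step_norm k x \<le> real p * c * r ^ k * (\<Sum>i<p. \<bar>x i\<bar>)"
proof -
  have "step_norm k x \<le> (\<Sum>i<p. c * r ^ k * (\<Sum>j<p. \<bar>x j\<bar>))"
    unfolding step_norm_def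
  proof (rule sum_mono)
    fix i assume i: "i \<in> {..<p}"
    have "\<bar>\<Sum>j<p. pw k i j * x j\<bar> \<le> (\<Sum>j<p. \<bar>pw k i j\<bar> * \<bar>x j\<bar>)"
      by (rule order_trans[OF sum_abs]) (simp add: abs_mult)
    also have "\<dots> \<le> (\<Sum>j<p. c * r ^ k * \<bar>x j\<bar>)"
      using i pw_bound by (intro sum_mono mult_right_mono) auto
    finally show "\<bar>\<Sum>j<p. pw k i j * x j\<bar> \<le> c * r ^ k * (\<Sum>j<p. \<bar>x j\<bar>)"
      by (simp add: sum_distrib_left)
  qed
  then show ?thesis by simp
qed

lemma anorm_nonneg: "anorm x \<ge> 0"
  unfolding anorm_def using rate by (intro sum_nonneg mult_nonneg_nonneg step_norm_nonneg) auto

lemma anorm_add: "anorm (\<lambda>i. x i + y i) \<le> anorm x + anorm y"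
proof -
  have "step_norm k (\<lambda>i. x i + y i) \<le> step_norm k x + step_norm k y" for k
    unfolding step_norm_def sum.distrib[symmetric]
    by (rule sum_mono) (simp add: distrib_left sum.distrib abs_triangle_ineq)
  then have "anorm (\<lambda>i. x i + y i) \<le> (\<Sum>k<horizon. (1 / rate) ^ k * (step_norm k x + step_norm k y))"
    unfolding anorm_def using rate by (intro sum_mono mult_left_mono) auto
  then show ?thesis by (simp add: anorm_def distrib_left sum.distrib)
qed

lemma anorm_scale: "anorm (\<lambda>i. a * x i) = \<bar>a\<bar> * anorm x"
proof -
  have "step_norm k (\<lambda>i. a * x i) = \<bar>a\<bar> * step_norm k x" for k
    by (simp add: step_norm_def sum_distrib_left abs_mult mult.left_commute flip: sum_distrib_left)
  then show ?thesis by (simp add: anorm_def sum_distrib_left mult.left_commute)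
qed

lemma anorm_cong: "(\<And>i. i < p \<Longrightarrow> x i = y i) \<Longrightarrow> anorm x = anorm y"
  by (simp add: anorm_def step_norm_def)

lemma anorm_ge: "i < p \<Longrightarrow> \<bar>x i\<bar> \<le> anorm x"
proof -
  assume i: "i < p"
  have "\<bar>x i\<bar> \<le> step_norm 0 x" unfolding step_norm_0 using i by (intro member_le_sum) auto
  also have "\<dots> = (1 / rate) ^ 0 * step_norm 0 x" by simp
  also have "\<dots> \<le> anorm x" unfolding anorm_def
    using horizon rate step_norm_nonneg by (intro member_le_sum) auto
  finally show ?thesis .
qed

text \<open>Applying A shifts the weighted sum by one index, up to the factor \<open>rate\<close>.
  The term gained at the end is at most the term lost at the start; \<open>horizon\<close> is chosen
  for this purpose.\<close>

lemma anorm_mv: "anorm (mv x) \<le> rate * anorm x"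
proof -
  define t where "t k = (1 / rate) ^ k * step_norm k x" for k
  have "step_norm horizon x \<le> rate ^ horizon * step_norm 0 x"
    using step_norm_bound[of horizon x] horizon(2) mult_right_mono[OF horizon(2) step_norm_nonneg[of 0 x]]
    by (simp add: step_norm_0)
  then have tK: "t horizon \<le> t 0"
    using rate by (simp add: t_def power_divide field_simps)
  have "anorm (mv x) = rate * (\<Sum>k<horizon. t (Suc k))"
    using rate by (simp add: anorm_def step_norm_mv t_def sum_distrib_left)
  also have "(\<Sum>k<horizon. t (Suc k)) = (\<Sum>k<horizon. t k) + t horizon - t 0"
    using sum.lessThan_Suc_shift[of t horizon] by simp
  also have "rate * \<dots> \<le> rate * (\<Sum>k<horizon. t k)"
    using tK rate by (intro mult_left_mono) auto
  finally show ?thesis by (simp add: anorm_def t_def)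
qed

text \<open>The congruence A^k D (A^k)^T; \<open>congr 1\<close> is the linear map of the Lyapunov
  equation.\<close>

definition congr :: "nat \<Rightarrow> (nat \<Rightarrow> nat \<Rightarrow> real) \<Rightarrow> nat \<Rightarrow> nat \<Rightarrow> real" where
  "congr k D i j = (\<Sum>a<p. \<Sum>b<p. pw k i a * D a b * pw k j b)"

lemma congr_bound:
  assumes "i < p" "j < p"
  shows "\<bar>congr k D i j\<bar> \<le> c\<^sup>2 * (r\<^sup>2) ^ k * (\<Sum>a<p. \<Sum>b<p. \<bar>D a b\<bar>)"
proof -
  have "\<bar>congr k D i j\<bar> \<le> (\<Sum>a<p. \<Sum>b<p. \<bar>pw k i a * D a b * pw k j b\<bar>)"
    unfolding congr_def by (rule order_trans[OF sum_abs sum_mono[OF sum_abs]])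
  also have "\<dots> \<le> (\<Sum>a<p. \<Sum>b<p. c\<^sup>2 * (r\<^sup>2) ^ k * \<bar>D a b\<bar>)"
  proof (intro sum_mono)
    fix a b assume ab: "a \<in> {..<p}" "b \<in> {..<p}"
    have "\<bar>pw k i a\<bar> * \<bar>pw k j b\<bar> \<le> (c * r ^ k) * (c * r ^ k)"
      using assms ab c r by (intro mult_mono pw_bound) auto
    also have "\<dots> = c\<^sup>2 * (r\<^sup>2) ^ k" by (simp add: power2_eq_square power_mult_distrib)
    finally have "\<bar>pw k i a\<bar> * \<bar>pw k j b\<bar> * \<bar>D a b\<bar> \<le> c\<^sup>2 * (r\<^sup>2) ^ k * \<bar>D a b\<bar>"
      by (rule mult_right_mono) simp
    then show "\<bar>pw k i a * D a b * pw k j b\<bar> \<le> c\<^sup>2 * (r\<^sup>2) ^ k * \<bar>D a b\<bar>"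
      by (simp add: abs_mult mult_ac)
  qed
  finally show ?thesis by (simp add: sum_distrib_left)
qed

lemma congr_cong: "(\<And>a b. a < p \<Longrightarrow> b < p \<Longrightarrow> D a b = E a b) \<Longrightarrow> congr k D i j = congr k E i j"
  by (simp add: congr_def)

lemma congr_1:
  assumes "i < p" "j < p"
  shows "congr 1 D i j = (\<Sum>a<p. \<Sum>b<p. A $$ (i, a) * D a b * A $$ (j, b))"
  unfolding congr_def using A assms by (intro sum.cong refl) (simp add: pw_def)

lemma congr_congr:
  assumes ij: "i < p" "j < p"
  shows "congr k (congr 1 D) i j = congr (Suc k) D i j"
proof -
  have "congr k (congr 1 D) i j
      = congr k (\<lambda>i j. \<Sum>a<p. \<Sum>b<p. A $$ (i, a) * D a b * A $$ (j, b)) i j"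
    by (rule congr_cong) (rule congr_1)
  also have "\<dots> = (\<Sum>a<p. \<Sum>b<p. \<Sum>a'<p. \<Sum>b'<p.
      (pw k i a * A $$ (a, a')) * D a' b' * (pw k j b * A $$ (b, b')))"
    by (simp add: congr_def sum_distrib_left sum_distrib_right mult_ac)
  also have "\<dots> = (\<Sum>a<p. \<Sum>a'<p. \<Sum>b'<p. \<Sum>b<p.
      (pw k i a * A $$ (a, a')) * D a' b' * (pw k j b * A $$ (b, b')))"
  proof (rule sum.cong[OF refl])
    fix a
    have "(\<Sum>b<p. \<Sum>a'<p. \<Sum>b'<p. (pw k i a * A $$ (a, a')) * D a' b' * (pw k j b * A $$ (b, b')))
      = (\<Sum>a'<p. \<Sum>b<p. \<Sum>b'<p. (pw k i a * A $$ (a, a')) * D a' b' * (pw k j b * A $$ (b, b')))"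
      by (rule sum.swap)
    also have "\<dots> = (\<Sum>a'<p. \<Sum>b'<p. \<Sum>b<p. (pw k i a * A $$ (a, a')) * D a' b' * (pw k j b * A $$ (b, b')))"
      by (rule sum.cong[OF refl sum.swap])
    finally show "(\<Sum>b<p. \<Sum>a'<p. \<Sum>b'<p. (pw k i a * A $$ (a, a')) * D a' b' * (pw k j b * A $$ (b, b')))
      = (\<Sum>a'<p. \<Sum>b'<p. \<Sum>b<p. (pw k i a * A $$ (a, a')) * D a' b' * (pw k j b * A $$ (b, b')))" .
  qed
  also have "\<dots> = (\<Sum>a'<p. \<Sum>a<p. \<Sum>b'<p. \<Sum>b<p.
      (pw k i a * A $$ (a, a')) * D a' b' * (pw k j b * A $$ (b, b')))"
    by (rule sum.swap)
  also have "\<dots> = (\<Sum>a'<p. \<Sum>b'<p. \<Sum>a<p. \<Sum>b<p.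
      (pw k i a * A $$ (a, a')) * D a' b' * (pw k j b * A $$ (b, b')))"
    by (rule sum.cong[OF refl sum.swap])
  also have "\<dots> = (\<Sum>a'<p. \<Sum>b'<p. (\<Sum>a<p. pw k i a * A $$ (a, a')) * D a' b' *
      (\<Sum>b<p. pw k j b * A $$ (b, b')))"
    by (simp add: sum_distrib_left sum_distrib_right mult_ac)
  also have "\<dots> = congr (Suc k) D i j"
    unfolding congr_def using ij by (intro sum.cong refl) (simp add: pw_Suc)
  finally show ?thesis .
qed

lemma congr_add: "congr k (\<lambda>a b. D a b + E a b) i j = congr k D i j + congr k E i j"
  by (simp add: congr_def distrib_left distrib_right sum.distrib)

lemma congr_0:
  assumes "i < p" "j < p"
  shows "congr 0 D i j = D i j"
proof -
  have "congr 0 D i j = (\<Sum>a<p. if a = i then (\<Sum>b<p. if b = j then D i j else 0) else 0)"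
    unfolding congr_def
  proof (intro sum.cong refl)
    fix a assume a: "a \<in> {..<p}"
    have "(\<Sum>b<p. pw 0 i a * D a b * pw 0 j b)
        = (\<Sum>b<p. if b = j then (if a = i then D i j else 0) else 0)"
      using a assms by (intro sum.cong) (auto simp: pw_0)
    then show "(\<Sum>b<p. pw 0 i a * D a b * pw 0 j b)
        = (if a = i then (\<Sum>b<p. if b = j then D i j else 0) else 0)" by simp
  qed
  then show ?thesis using assms by simp
qed

text \<open>Unrolling the equation \<open>K\<close> times leaves A^K D (A^K)^T, which vanishes, and
  a partial sum of the A^k E (A^k)^T, dominated by a geometric series of ratio r^2. This single
  estimate yields both uniqueness and stability under perturbation.\<close>

lemma lyapunov_stability:
  assumes D: "\<And>i j. i < p \<Longrightarrow> j < p \<Longrightarrow> D i j = congr 1 D i j + E i j"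
    and ij: "i < p" "j < p"
  shows "\<bar>D i j\<bar> \<le> c\<^sup>2 / (1 - r\<^sup>2) * (\<Sum>a<p. \<Sum>b<p. \<bar>E a b\<bar>)"
proof -
  let ?e = "\<Sum>a<p. \<Sum>b<p. \<bar>E a b\<bar>" and ?d = "\<Sum>a<p. \<Sum>b<p. \<bar>D a b\<bar>"
  have rr: "0 \<le> r\<^sup>2" "r\<^sup>2 < 1" using r by (auto simp: power_less_one_iff abs_square_less_1)
  have unroll: "D i j = congr K D i j + (\<Sum>k<K. congr k E i j)" for K
  proof (induction K)
    case (Suc K)
    have "congr K D i j = congr K (\<lambda>a b. congr 1 D a b + E a b) i j"
      by (rule congr_cong) (rule D)
    then show ?case using Suc ij by (simp add: congr_add congr_congr del: One_nat_def)
  qed (simp add: congr_0 ij)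
  have ge: "(\<Sum>k<K. c\<^sup>2 * q ^ k * e) = c\<^sup>2 * e * (\<Sum>k<K. q ^ k)" for K and q e :: real
    by (subst sum_distrib_left) (simp add: mult_ac)
  have le: "\<bar>D i j\<bar> \<le> c\<^sup>2 * (r\<^sup>2) ^ K * ?d + c\<^sup>2 / (1 - r\<^sup>2) * ?e" for K
  proof -
    have "(\<Sum>k<K. (r\<^sup>2) ^ k) \<le> 1 / (1 - r\<^sup>2)"
      using rr sum_le_suminf[of "\<lambda>k. (r\<^sup>2) ^ k" "{..<K}"]
      by (simp add: suminf_geometric summable_geometric_iff)
    then have s: "c\<^sup>2 * ?e * (\<Sum>k<K. (r\<^sup>2) ^ k) \<le> c\<^sup>2 * ?e * (1 / (1 - r\<^sup>2))"
      by (intro mult_left_mono mult_nonneg_nonneg sum_nonneg) auto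
    have "\<bar>D i j\<bar> \<le> \<bar>congr K D i j\<bar> + (\<Sum>k<K. \<bar>congr k E i j\<bar>)"
      unfolding unroll[of K] by (rule order_trans[OF abs_triangle_ineq]) (simp add: sum_abs)
    also have "\<dots> \<le> c\<^sup>2 * (r\<^sup>2) ^ K * ?d + (\<Sum>k<K. c\<^sup>2 * (r\<^sup>2) ^ k * ?e)"
      by (intro add_mono sum_mono congr_bound ij)
    also have "(\<Sum>k<K. c\<^sup>2 * (r\<^sup>2) ^ k * ?e) = c\<^sup>2 * ?e * (\<Sum>k<K. (r\<^sup>2) ^ k)"
      by (rule ge)
    finally show ?thesis using s by simp
  qed
  have "(\<lambda>K. c\<^sup>2 * (r\<^sup>2) ^ K * ?d + c\<^sup>2 / (1 - r\<^sup>2) * ?e) \<longlonglongrightarrow> c\<^sup>2 * 0 * ?d + c\<^sup>2 / (1 - r\<^sup>2) * ?e"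
    using rr by (intro tendsto_intros LIMSEQ_realpow_zero)
  then show ?thesis
    using le by (intro LIMSEQ_le_const[of _ _ "\<bar>D i j\<bar>"]) auto
qed

text \<open>G_n - S satisfies the Lyapunov equation with forcing R_n - Q, which tends to zero, so
  stability controls it. Neither convergence nor boundedness of G has to be known
  beforehand.\<close>

lemma lyapunov_limit:
  assumes G: "\<And>n i j. i < p \<Longrightarrow> j < p \<Longrightarrow> G n i j = congr 1 (G n) i j + R n i j"
    and S: "\<And>i j. i < p \<Longrightarrow> j < p \<Longrightarrow> S i j = congr 1 S i j + Q i j"
    and R: "\<And>i j. i < p \<Longrightarrow> j < p \<Longrightarrow> (\<lambda>n. R n i j) \<longlonglongrightarrow> Q i j"
    and ij: "i < p" "j < p"
  shows "(\<lambda>n. G n i j) \<longlonglongrightarrow> S i j"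
proof -
  have sub: "congr 1 (\<lambda>a b. D a b - E a b) i j = congr 1 D i j - congr 1 E i j"
    for D E :: "nat \<Rightarrow> nat \<Rightarrow> real" and i j
    by (simp add: congr_def left_diff_distrib right_diff_distrib sum_subtractf)
  have le: "\<bar>G n i j - S i j\<bar> \<le> c\<^sup>2 / (1 - r\<^sup>2) * (\<Sum>a<p. \<Sum>b<p. \<bar>R n a b - Q a b\<bar>)" for n
  proof (rule lyapunov_stability[OF _ ij])
    fix i j assume ij: "i < p" "j < p"
    show "G n i j - S i j = congr 1 (\<lambda>a b. G n a b - S a b) i j + (R n i j - Q i j)"
      unfolding sub using G[OF ij, of n] S[OF ij] by simp
  qed
  have "(\<lambda>n. c\<^sup>2 / (1 - r\<^sup>2) * (\<Sum>a<p. \<Sum>b<p. \<bar>R n a b - Q a b\<bar>))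
      \<longlonglongrightarrow> c\<^sup>2 / (1 - r\<^sup>2) * (\<Sum>a<p. \<Sum>b<p. \<bar>Q a b - Q a b\<bar>)"
    by (intro tendsto_intros R) auto
  then have lim: "(\<lambda>n. c\<^sup>2 / (1 - r\<^sup>2) * (\<Sum>a<p. \<Sum>b<p. \<bar>R n a b - Q a b\<bar>)) \<longlonglongrightarrow> 0"
    by simp
  have "(\<lambda>n. G n i j - S i j) \<longlonglongrightarrow> 0"
    by (rule Lim_null_comparison[OF always_eventually lim]) (intro allI, unfold real_norm_def, rule le)
  then show ?thesis by (simp add: LIM_zero_iff)
qed

text \<open>The sum over k of A^k b (A^k b)^T with b the first unit vector: the controllability
  Gramian of the pair (A, b), and the explicit form of the Fisher matrix.\<close>

definition gram :: "nat \<Rightarrow> nat \<Rightarrow> real" where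
  "gram i j = (\<Sum>k. pw k i 0 * pw k j 0)"

lemma gram_summable:
  assumes "i < p" "j < p"
  shows "summable (\<lambda>k. pw k i 0 * pw k j 0)"
proof (rule summable_comparison_test')
  show "summable (\<lambda>k. c\<^sup>2 * (r\<^sup>2) ^ k)"
    using r by (intro summable_mult summable_geometric) (simp add: power_less_one_iff abs_square_less_1)
  fix k
  have "\<bar>pw k i 0\<bar> * \<bar>pw k j 0\<bar> \<le> (c * r ^ k) * (c * r ^ k)"
    using assms p c r by (intro mult_mono pw_bound) auto
  then show "norm (pw k i 0 * pw k j 0) \<le> c\<^sup>2 * (r\<^sup>2) ^ k"
    by (simp add: abs_mult power2_eq_square power_mult_distrib mult_ac)
qed

lemma gram_eq:
  assumes ij: "i < p" "j < p"
  shows "gram i j = congr 1 gram i j + (if i = 0 \<and> j = 0 then 1 else 0)"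
proof -
  have "gram i j = (\<Sum>k. pw (Suc k) i 0 * pw (Suc k) j 0) + pw 0 i 0 * pw 0 j 0"
    unfolding gram_def using suminf_split_head[OF gram_summable[OF ij]] by simp
  also have "pw 0 i 0 * pw 0 j 0 = (if i = 0 \<and> j = 0 then 1 else 0)"
    using ij p by (simp add: pw_0)
  also have "(\<Sum>k. pw (Suc k) i 0 * pw (Suc k) j 0)
      = (\<Sum>k. \<Sum>a<p. \<Sum>b<p. (A $$ (i, a) * A $$ (j, b)) * (pw k a 0 * pw k b 0))"
    using ij p by (simp add: pw_Suc2 sum_product mult_ac)
  also have "\<dots> = (\<Sum>a<p. \<Sum>b<p. \<Sum>k. (A $$ (i, a) * A $$ (j, b)) * (pw k a 0 * pw k b 0))"
    by (intro suminf_sum2 summable_mult gram_summable)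
  also have "\<dots> = congr 1 gram i j"
    unfolding congr_1[OF ij]
    by (intro sum.cong refl) (use p in \<open>simp add: suminf_mult[OF gram_summable] gram_def\<close>)
  finally show ?thesis .
qed

lemma gram_sym: "gram i j = gram j i"
  by (simp add: gram_def mult.commute)

text \<open>The quadratic form of the Gramian at x is the sum of the squares of the scalar products
  of x with A^k b, so it vanishes only if each of them does.\<close>

lemma gram_kernel:
  assumes x: "\<And>i. i < p \<Longrightarrow> (\<Sum>j<p. gram i j * x j) = 0"
  shows "(\<Sum>i<p. x i * pw k i 0) = 0"
proof -
  have sm: "summable (\<lambda>k. \<Sum>i<p. \<Sum>j<p. (x i * x j) * (pw k i 0 * pw k j 0))"
    by (intro summable_sum summable_mult gram_summable) auto
  have "0 = (\<Sum>i<p. x i * (\<Sum>j<p. gram i j * x j))" using x by simp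
  also have "\<dots> = (\<Sum>i<p. \<Sum>j<p. \<Sum>k. (x i * x j) * (pw k i 0 * pw k j 0))"
    unfolding sum_distrib_left
    by (intro sum.cong refl) (simp add: suminf_mult[OF gram_summable] gram_def)
  also have "\<dots> = (\<Sum>k. \<Sum>i<p. \<Sum>j<p. (x i * x j) * (pw k i 0 * pw k j 0))"
    by (intro suminf_sum2[symmetric] summable_mult gram_summable)
  finally have z: "(\<Sum>k. \<Sum>i<p. \<Sum>j<p. (x i * x j) * (pw k i 0 * pw k j 0)) = 0" by simp
  have sq: "(\<Sum>i<p. \<Sum>j<p. (x i * x j) * (pw k i 0 * pw k j 0)) = (\<Sum>i<p. x i * pw k i 0)\<^sup>2" for k
    by (simp add: power2_eq_square sum_product mult_ac)
  have "(\<Sum>i<p. x i * pw k i 0)\<^sup>2 = 0"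
    using z suminf_eq_zero_iff[OF sm] by (simp add: sq)
  then show ?thesis by simp
qed


lemma congr_1_mat:
  assumes S: "S \<in> carrier_mat p p" and ij: "i < p" "j < p"
  shows "(A * S * transpose_mat A) $$ (i, j) = congr 1 (\<lambda>a b. S $$ (a, b)) i j"
proof -
  have "(A * S * transpose_mat A) $$ (i, j) = (\<Sum>b<p. (\<Sum>a<p. A $$ (i, a) * S $$ (a, b)) * A $$ (j, b))"
    using A S ij by (simp add: times_mat_def scalar_prod_def lessThan_atLeast0)
  also have "\<dots> = congr 1 (\<lambda>a b. S $$ (a, b)) i j"
    unfolding congr_1[OF ij] by (subst sum.swap) (simp add: sum_distrib_right)
  finally show ?thesis .
qed

lemma lyapunov_entries:
  assumes \<theta>: "A = companion \<theta>"
  shows "lyapunov_solution \<theta> S \<longleftrightarrow> S \<in> carrier_mat p p \<and>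
    (\<forall>i<p. \<forall>j<p. S $$ (i, j) = congr 1 (\<lambda>a b. S $$ (a, b)) i j + (if i = 0 \<and> j = 0 then 1 else 0))"
proof -
  have "dim_row A = p" using A by simp
  then have dim: "dim_vec \<theta> = p" unfolding \<theta> companion_def by simp
  have "S = A * S * transpose_mat A + outer_prod (unit_vec p 0) (unit_vec p 0) \<longleftrightarrow>
    (\<forall>i<p. \<forall>j<p. S $$ (i, j) = congr 1 (\<lambda>a b. S $$ (a, b)) i j + (if i = 0 \<and> j = 0 then 1 else 0))"
    (is "S = ?R \<longleftrightarrow> ?all") if S: "S \<in> carrier_mat p p"
  proof -
    have R: "?R \<in> carrier_mat p p" using A S by (simp add: outer_prod_def)
    have "S = ?R \<longleftrightarrow> (\<forall>i<p. \<forall>j<p. S $$ (i, j) = ?R $$ (i, j))"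
    proof
      assume eq: "S = ?R"
      show "\<forall>i<p. \<forall>j<p. S $$ (i, j) = ?R $$ (i, j)"
        by (intro allI impI arg_cong[OF eq, of "\<lambda>X. X $$ (_, _)"])
    next
      assume all: "\<forall>i<p. \<forall>j<p. S $$ (i, j) = ?R $$ (i, j)"
      show "S = ?R"
        by (rule eq_matI) (use all carrier_matD[OF R] carrier_matD[OF S] in metis)+
    qed
    moreover have "?R $$ (i, j) = congr 1 (\<lambda>a b. S $$ (a, b)) i j + (if i = 0 \<and> j = 0 then 1 else 0)"
      if "i < p" "j < p" for i j
      using that A S congr_1_mat[OF S that]
      by (simp add: outer_prod_def unit_vec_def)
    ultimately show ?thesis by auto
  qed
  then show ?thesis unfolding lyapunov_solution_def Let_def dim \<theta>[symmetric] by blast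
qed

definition gram_mat :: "real mat" where
  "gram_mat = mat p p (\<lambda>(i, j). gram i j)"

lemma gram_mat_lyapunov:
  assumes \<theta>: "A = companion \<theta>"
  shows "lyapunov_solution \<theta> S \<longleftrightarrow> S = gram_mat"
proof
  assume "S = gram_mat"
  moreover have "congr 1 (\<lambda>a b. gram_mat $$ (a, b)) i j = congr 1 gram i j" for i j
    by (rule congr_cong) (simp add: gram_mat_def)
  ultimately show "lyapunov_solution \<theta> S"
    unfolding lyapunov_entries[OF \<theta>] using gram_eq by (simp add: gram_mat_def)
next
  assume "lyapunov_solution \<theta> S"
  then have S: "S \<in> carrier_mat p p" and
    eq: "\<And>i j. i < p \<Longrightarrow> j < p \<Longrightarrow>
      S $$ (i, j) = congr 1 (\<lambda>a b. S $$ (a, b)) i j + (if i = 0 \<and> j = 0 then 1 else 0)"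
    unfolding lyapunov_entries[OF \<theta>] by auto
  \<comment> \<open>Uniqueness is the limit lemma for a constant sequence: any solution converges to
    the Gramian, hence equals it.\<close>
  have "(\<lambda>n::nat. S $$ (i, j)) \<longlonglongrightarrow> gram i j" if "i < p" "j < p" for i j
    by (rule lyapunov_limit[OF eq gram_eq tendsto_const that])
  then have "S $$ (i, j) = gram i j" if "i < p" "j < p" for i j
    using that LIMSEQ_const_iff by blast
  then show "S = gram_mat" using S by (intro eq_matI) (auto simp: gram_mat_def)
qed

text \<open>Controllability of the companion form: a kernel vector is orthogonal to every A^k b, and
  these vectors span the space because A sends each unit vector to the next one up to a multiple of
  the first.\<close>

lemma gram_mat_det:
  assumes \<theta>: "A = companion \<theta>"
  shows "det gram_mat \<noteq> 0"
proof
  have G: "gram_mat \<in> carrier_mat p p" by (simp add: gram_mat_def)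
  have "dim_row A = p" using A by simp
  then have dim: "dim_vec \<theta> = p" unfolding \<theta> companion_def by simp
  assume "det gram_mat = 0"
  then obtain v where v: "v \<in> carrier_vec p" "v \<noteq> 0\<^sub>v p" "gram_mat *\<^sub>v v = 0\<^sub>v p"
    using det_0_iff_vec_prod_zero_field[OF G] by blast
  have "(\<Sum>j<p. gram i j * v $ j) = 0" if i: "i < p" for i
  proof -
    have "(gram_mat *\<^sub>v v) $ i = (\<Sum>j<p. gram i j * v $ j)"
      using i v(1) by (simp add: gram_mat_def mult_mat_vec_def scalar_prod_def lessThan_atLeast0)
    then show ?thesis using v(3) i by simp
  qed
  then have 0: "(\<Sum>i<p. v $ i * pw k i 0) = 0" for k
    by (rule gram_kernel)
  define y where "y k j = (\<Sum>i<p. v $ i * pw k i j)" for k j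
  text \<open>Multiplying a row vector by the companion matrix shifts it, up to a multiple of its first
    entry.\<close>
  have shift: "y (Suc k) j = y k (Suc j)" if j: "Suc j < p" for k j
  proof -
    have "y (Suc k) j = (\<Sum>i<p. \<Sum>l<p. v $ i * pw k i l * A $$ (l, j))"
      using j by (simp add: y_def pw_Suc sum_distrib_left mult.assoc)
    also have "\<dots> = (\<Sum>l<p. y k l * A $$ (l, j))"
      by (subst sum.swap) (simp add: y_def sum_distrib_right)
    also have "\<dots> = (\<Sum>l<p. if l = Suc j then y k (Suc j) else 0)"
      using 0 j by (intro sum.cong) (auto simp: \<theta> companion_def dim y_def)
    finally show ?thesis using j by simp
  qed
  have y0: "y k j = 0" if "j < p" for k j
    using that
  proof (induction j arbitrary: k)
    case (Suc j)
    then show ?case using shift[of j k] by simp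
  qed (use 0 in \<open>simp add: y_def\<close>)
  have "v $ j = 0" if j: "j < p" for j
  proof -
    have "y 0 j = (\<Sum>i<p. if i = j then v $ j else 0)"
      unfolding y_def using j by (intro sum.cong) (auto simp: pw_0)
    then show ?thesis using y0[OF j, of 0] j by simp
  qed
  then have "v = 0\<^sub>v p" using v(1) by (intro eq_vecI) auto
  with v(2) show False ..
qed

end

lemma stable_matrix_companion:
  assumes "\<theta> \<in> Theta p" "p \<ge> 1"
  shows "\<exists>c r. stable_matrix (companion \<theta>) p c r"
proof -
  have "companion \<theta> \<in> carrier_mat p p"
    using assms by (auto simp: Theta_def companion_def)
  moreover have "spectral_radius (map_mat complex_of_real (companion \<theta>)) < 1"
    using assms by (simp add: Theta_def)
  ultimately show ?thesis
    using power_entry_bound[of "companion \<theta>" p] assms(2) unfolding stable_matrix_def by simp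
qed

section \<open>Continuity of the determinant and of matrix inversion\<close>

lemma tendsto_det:
  fixes H :: "nat \<Rightarrow> real mat"
  assumes H: "\<And>n. H n \<in> carrier_mat p p" "L \<in> carrier_mat p p"
    and lim: "\<And>i j. i < p \<Longrightarrow> j < p \<Longrightarrow> (\<lambda>n. H n $$ (i, j)) \<longlonglongrightarrow> L $$ (i, j)"
  shows "(\<lambda>n. det (H n)) \<longlonglongrightarrow> det L"
proof -
  have "(\<lambda>n. \<Sum>q\<in>{q. q permutes {0..<p}}. signof q * (\<Prod>i = 0..<p. H n $$ (i, q i)))
    \<longlonglongrightarrow> (\<Sum>q\<in>{q. q permutes {0..<p}}. signof q * (\<Prod>i = 0..<p. L $$ (i, q i)))"
    by (intro tendsto_intros lim) (auto dest: permutes_in_image)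
  then show ?thesis unfolding det_def'[OF H(1)] det_def'[OF H(2)] .
qed

text \<open>Cramer's rule writes each entry of an inverse as a cofactor over the determinant, and
  both are continuous in the entries. \<open>B n\<close> is constrained only where
  \<open>H n\<close> is invertible, which leaves room for a default value elsewhere.\<close>

lemma tendsto_mat_inverse:
  fixes H B :: "nat \<Rightarrow> real mat"
  assumes H: "\<And>n. H n \<in> carrier_mat p p" and L: "L \<in> carrier_mat p p"
    and lim: "\<And>i j. i < p \<Longrightarrow> j < p \<Longrightarrow> (\<lambda>n. H n $$ (i, j)) \<longlonglongrightarrow> L $$ (i, j)"
    and J: "J \<in> carrier_mat p p" "L * J = 1\<^sub>m p"
    and B: "\<And>n. det (H n) \<noteq> 0 \<Longrightarrow> B n \<in> carrier_mat p p \<and> B n * H n = 1\<^sub>m p"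
    and ij: "i < p" "j < p"
  shows "(\<lambda>n. B n $$ (i, j)) \<longlonglongrightarrow> J $$ (i, j)"
    and "\<forall>\<^sub>F n in sequentially. det (H n) \<noteq> 0"
proof -
  have inv: "C $$ (i, j) = cofactor M j i / det M"
    if M: "M \<in> carrier_mat p p" and C: "C \<in> carrier_mat p p" "C * M = 1\<^sub>m p" for M C :: "real mat"
  proof -
    have "det C * det M = 1" using det_mult[OF C(1) M] C(2) by simp
    then have dM: "det M \<noteq> 0" by auto
    have "adj_mat M = C * M * adj_mat M" using C adj_mat(1)[OF M] by simp
    also have "\<dots> = C * (M * adj_mat M)"
      by (rule assoc_mult_mat[OF C(1) M adj_mat(1)[OF M]])
    also have "M * adj_mat M = det M \<cdot>\<^sub>m 1\<^sub>m p" by (rule adj_mat(2)[OF M])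
    also have "C * \<dots> = det M \<cdot>\<^sub>m C" 
      unfolding mult_smult_distrib[OF C(1) one_carrier_mat] right_mult_one_mat[OF C(1)] ..
    finally have "adj_mat M $$ (i, j) = det M * C $$ (i, j)" using C ij by simp
    then show ?thesis using dM M ij by (simp add: adj_mat_def field_simps)
  qed
  have dJ: "det L * det J = 1" using det_mult[OF L J(1)] J(2) by simp
  then have dL: "det L \<noteq> 0" by auto
  have JL: "J * L = 1\<^sub>m p" using mat_mult_left_right_inverse[OF L J] .
  have dlim: "(\<lambda>n. det (H n)) \<longlonglongrightarrow> det L" by (rule tendsto_det[OF H L lim])
  show ev: "\<forall>\<^sub>F n in sequentially. det (H n) \<noteq> 0"
    using tendsto_imp_eventually_ne[OF dlim dL] .
  have minor: "(\<lambda>n. det (mat_delete (H n) j i)) \<longlonglongrightarrow> det (mat_delete L j i)"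
  proof (rule tendsto_det)
    fix a b assume ab: "a < p - 1" "b < p - 1"
    have "mat_delete M j i $$ (a, b) = M $$ (insert_index j a, insert_index i b)"
      if "M \<in> carrier_mat p p" for M :: "real mat"
      using ab that by (simp add: mat_delete_def insert_index_def)
    moreover have "insert_index j a < p" "insert_index i b < p"
      using ab by (auto simp: insert_index_def)
    ultimately show "(\<lambda>n. mat_delete (H n) j i $$ (a, b)) \<longlonglongrightarrow> mat_delete L j i $$ (a, b)"
      using H L lim by simp
  qed (rule mat_delete_carrier[OF H] mat_delete_carrier[OF L])+
  have "(\<lambda>n. cofactor (H n) j i) \<longlonglongrightarrow> cofactor L j i"
    unfolding cofactor_def by (rule tendsto_mult_left[OF minor])
  then have "(\<lambda>n. cofactor (H n) j i / det (H n)) \<longlonglongrightarrow> cofactor L j i / det L"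
    using dlim dL by (rule tendsto_divide)
  then show "(\<lambda>n. B n $$ (i, j)) \<longlonglongrightarrow> J $$ (i, j)"
    unfolding inv[OF L J(1) JL]
  proof (rule Lim_transform_eventually)
    show "\<forall>\<^sub>F n in sequentially. cofactor (H n) j i / det (H n) = B n $$ (i, j)"
      using ev
    proof eventually_elim
      case (elim n)
      show ?case by (rule inv[OF H, symmetric]) (rule conjunct1[OF B[OF elim]] conjunct2[OF B[OF elim]])+
    qed
  qed
qed

subsection \<open>Martingale sums with finite fourth moments\<close>

text \<open>By monotone convergence the series has finite expectation, hence is finite almost
  surely. Together with its corollary on null sequences this takes the place of Borel--Cantelli
  arguments.\<close>

lemma AE_summable_if_summable_integral:
  fixes X :: "nat \<Rightarrow> 'a \<Rightarrow> real"
  assumes X: "\<And>n. integrable M (X n)" "\<And>n \<omega>. X n \<omega> \<ge> 0"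
    and s: "summable (\<lambda>n. integral\<^sup>L M (X n))"
  shows "AE \<omega> in M. summable (\<lambda>n. X n \<omega>)"
proof -
  have [measurable]: "X n \<in> borel_measurable M" for n using X(1) by blast
  have "(\<integral>\<^sup>+\<omega>. (\<Sum>n. ennreal (X n \<omega>)) \<partial>M) = (\<Sum>n. \<integral>\<^sup>+\<omega>. ennreal (X n \<omega>) \<partial>M)"
    by (rule nn_integral_suminf) simp
  also have "\<dots> = (\<Sum>n. ennreal (integral\<^sup>L M (X n)))"
    using X by (simp add: nn_integral_eq_integral)
  also have "\<dots> = ennreal (\<Sum>n. integral\<^sup>L M (X n))"
    using X(2) s by (intro suminf_ennreal2) auto
  finally have "(\<integral>\<^sup>+\<omega>. (\<Sum>n. ennreal (X n \<omega>)) \<partial>M) \<noteq> \<infinity>" by simp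
  then have "AE \<omega> in M. (\<Sum>n. ennreal (X n \<omega>)) \<noteq> \<infinity>"
    by (intro nn_integral_PInf_AE) auto
  then show ?thesis
    by eventually_elim (intro summable_suminf_not_top X(2), auto)
qed

lemma AE_tendsto_0_if_summable_integral:
  fixes X :: "nat \<Rightarrow> 'a \<Rightarrow> real"
  assumes X: "\<And>n. integrable M (X n)" "\<And>n \<omega>. X n \<omega> \<ge> 0"
    and le: "\<And>n. n \<ge> N \<Longrightarrow> integral\<^sup>L M (X n) \<le> B n" and s: "summable B"
  shows "AE \<omega> in M. (\<lambda>n. X n \<omega>) \<longlonglongrightarrow> 0"
proof -
  have "summable (\<lambda>n. integral\<^sup>L M (X n))"
    by (rule summable_comparison_test'[OF s, of N]) (use X(2) le in \<open>simp add: integral_nonneg_AE\<close>)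
  from AE_summable_if_summable_integral[OF X this] show ?thesis
    by eventually_elim (rule summable_LIMSEQ_zero)
qed

section \<open>Random variables with finite fourth moment\<close>

lemma quartic_cubic_bound:
  fixes x y :: real
  shows "\<bar>x ^ 3 * y\<bar> \<le> x ^ 4 + y ^ 4"
proof -
  have sq: "2 * (a * b) \<le> a * a + b * b" for a b :: real
    using zero_le_square[of "a - b"] by (simp add: algebra_simps)
  have half: "(P + Q) / 2 \<le> P + R" if "2 * Q \<le> P + R" "0 \<le> P" "0 \<le> R" for P Q R :: real
    using that by (simp add: field_simps)
  have "\<bar>x ^ 3 * y\<bar> = (x * x) * (\<bar>x\<bar> * \<bar>y\<bar>)" by (simp add: abs_mult power3_eq_cube)
  also have "\<dots> \<le> (x * x) * ((x * x + y * y) / 2)"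
    using sq[of "\<bar>x\<bar>" "\<bar>y\<bar>"] by (intro mult_left_mono) auto
  also have "\<dots> = ((x * x) * (x * x) + (x * x) * (y * y)) / 2" by (simp add: algebra_simps)
  also have "\<dots> \<le> (x * x) * (x * x) + (y * y) * (y * y)"
    by (rule half[OF sq zero_le_square zero_le_square])
  finally show ?thesis by (simp add: power4_eq_xxxx mult.assoc)
qed

text \<open>Crude dominations by fourth powers, from which all the mixed products of degree at most
  four that occur below inherit integrability.\<close>

lemma quartic_bounds:
  fixes x y :: real
  shows "\<bar>x ^ 3 * y\<bar> \<le> x ^ 4 + y ^ 4" "x\<^sup>2 * y\<^sup>2 \<le> x ^ 4 + y ^ 4" "\<bar>x * y ^ 3\<bar> \<le> x ^ 4 + y ^ 4"
    "(x + y) ^ 4 \<le> 8 * (x ^ 4 + y ^ 4)" "x\<^sup>2 \<le> 1 + x ^ 4" "\<bar>x * y\<bar> \<le> 1 + (x ^ 4 + y ^ 4)"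
    "\<bar>x\<bar> \<le> 1 + x ^ 4"
proof -
  define X Y where "X = x * x" and "Y = y * y"
  have eqs: "x ^ 4 = X * X" "y ^ 4 = Y * Y" "x\<^sup>2 = X" "y\<^sup>2 = Y"
    by (simp_all add: X_def Y_def power4_eq_xxxx power2_eq_square mult.assoc)
  have sq: "2 * (a * b) \<le> a * a + b * b" for a b :: real
    using zero_le_square[of "a - b"] by (simp add: algebra_simps)
  have nn: "0 \<le> X" "0 \<le> Y" "0 \<le> X * X" "0 \<le> Y * Y" "0 \<le> X * Y" by (auto simp: X_def Y_def)
  have XY: "2 * (X * Y) \<le> X * X + Y * Y" by (rule sq)
  have x1: "2 * X \<le> 1 + X * X" "2 * Y \<le> 1 + Y * Y" using sq[of 1 X] sq[of 1 Y] by auto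
  have xy: "2 * (\<bar>x\<bar> * \<bar>y\<bar>) \<le> X + Y" using sq[of "\<bar>x\<bar>" "\<bar>y\<bar>"] by (simp add: X_def Y_def)
  have ax: "2 * \<bar>x\<bar> \<le> 1 + X" using sq[of 1 "\<bar>x\<bar>"] by (simp add: X_def)
  show "\<bar>x ^ 3 * y\<bar> \<le> x ^ 4 + y ^ 4" by (rule quartic_cubic_bound)
  show "\<bar>x * y ^ 3\<bar> \<le> x ^ 4 + y ^ 4"
    using quartic_cubic_bound[of y x] by (simp only: mult.commute add.commute)
  show "x\<^sup>2 * y\<^sup>2 \<le> x ^ 4 + y ^ 4" unfolding eqs using XY nn by linarith
  show "x\<^sup>2 \<le> 1 + x ^ 4" unfolding eqs using x1 nn by linarith
  show "\<bar>x * y\<bar> \<le> 1 + (x ^ 4 + y ^ 4)"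
    unfolding eqs abs_mult using xy x1 nn by linarith
  show "\<bar>x\<bar> \<le> 1 + x ^ 4" unfolding eqs using ax x1 nn by linarith
  have s: "(x + y) * (x + y) \<le> 2 * (X + Y)"
    using sq[of x y] by (simp add: X_def Y_def algebra_simps)
  have "((x + y) * (x + y)) * ((x + y) * (x + y)) \<le> (2 * (X + Y)) * (2 * (X + Y))"
    by (rule mult_mono[OF s s]) (use nn in auto)
  also have "\<dots> = 4 * (X * X) + 8 * (X * Y) + 4 * (Y * Y)" by (simp add: algebra_simps)
  also have "\<dots> \<le> 8 * (X * X + Y * Y)"
  proof -
    have "4 * P + 8 * Q + 4 * R \<le> 8 * (P + R)" if "2 * Q \<le> P + R" for P Q R :: real
      using that by simp
    then show ?thesis using XY .
  qed
  finally show "(x + y) ^ 4 \<le> 8 * (x ^ 4 + y ^ 4)"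
    unfolding eqs by (simp only: power4_eq_xxxx mult.assoc)
qed

text \<open>Measurability is a separate requirement because it does not follow from that of the
  fourth power, which forgets the sign.\<close>

definition L4 :: "'a measure \<Rightarrow> ('a \<Rightarrow> real) \<Rightarrow> bool" where
  "L4 M f \<longleftrightarrow> f \<in> borel_measurable M \<and> integrable M (\<lambda>\<omega>. f \<omega> ^ 4)"

lemma L4_measurable: "L4 M f \<Longrightarrow> f \<in> borel_measurable M"
  and L4_integrable: "L4 M f \<Longrightarrow> integrable M (\<lambda>\<omega>. f \<omega> ^ 4)"
  by (simp_all add: L4_def)

lemma L4_add:
  assumes "L4 M f" "L4 M g"
  shows "L4 M (\<lambda>\<omega>. f \<omega> + g \<omega>)"
proof -
  note [measurable] = assms[THEN L4_measurable]
  have "integrable M (\<lambda>\<omega>. (f \<omega> + g \<omega>) ^ 4)"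
    by (rule Bochner_Integration.integrable_bound[of _ "\<lambda>\<omega>. 8 * (f \<omega> ^ 4 + g \<omega> ^ 4)"])
      (use assms[THEN L4_integrable] quartic_bounds(4) in auto)
  then show ?thesis by (simp add: L4_def)
qed

lemma L4_cmult: "L4 M f \<Longrightarrow> L4 M (\<lambda>\<omega>. c * f \<omega>)"
  by (auto simp: L4_def power_mult_distrib)

lemma L4_zero: "L4 M (\<lambda>\<omega>. 0)"
  by (simp add: L4_def)

lemma L4_sum: "(\<And>i. i \<in> I \<Longrightarrow> L4 M (f i)) \<Longrightarrow> L4 M (\<lambda>\<omega>. \<Sum>i\<in>I. f i \<omega>)"
  by (induction I rule: infinite_finite_induct) (auto intro: L4_add simp: L4_zero)

lemma L4_diff: "L4 M f \<Longrightarrow> L4 M g \<Longrightarrow> L4 M (\<lambda>\<omega>. f \<omega> - g \<omega>)"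
  using L4_add[of M f "\<lambda>\<omega>. (-1) * g \<omega>"] L4_cmult[of M g "-1"] by simp

context prob_space begin

lemma L4_const: "L4 M (\<lambda>\<omega>. c)"
  by (simp add: L4_def)

lemma L4_products:
  assumes f: "L4 M f" and g: "L4 M g"
  shows "integrable M (\<lambda>\<omega>. f \<omega> ^ 3 * g \<omega>)" "integrable M (\<lambda>\<omega>. (f \<omega>)\<^sup>2 * (g \<omega>)\<^sup>2)"
    "integrable M (\<lambda>\<omega>. f \<omega> * g \<omega> ^ 3)" "integrable M (\<lambda>\<omega>. f \<omega> * g \<omega>)"
    "integrable M (\<lambda>\<omega>. (f \<omega>)\<^sup>2)" "integrable M f" "integrable M (\<lambda>\<omega>. f \<omega> ^ 3)"
    "integrable M (\<lambda>\<omega>. \<bar>f \<omega> * g \<omega>\<bar>)"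
proof -
  note [measurable] = L4_measurable[OF f] L4_measurable[OF g]
  note I = L4_integrable[OF f] L4_integrable[OF g]
  show "integrable M (\<lambda>\<omega>. f \<omega> ^ 3 * g \<omega>)"
    by (rule Bochner_Integration.integrable_bound[of _ "\<lambda>\<omega>. f \<omega> ^ 4 + g \<omega> ^ 4"])
      (use I quartic_bounds(1) in auto)
  show "integrable M (\<lambda>\<omega>. (f \<omega>)\<^sup>2 * (g \<omega>)\<^sup>2)"
    by (rule Bochner_Integration.integrable_bound[of _ "\<lambda>\<omega>. f \<omega> ^ 4 + g \<omega> ^ 4"])
      (use I quartic_bounds(2) in auto)
  show "integrable M (\<lambda>\<omega>. f \<omega> * g \<omega> ^ 3)"
    by (rule Bochner_Integration.integrable_bound[of _ "\<lambda>\<omega>. f \<omega> ^ 4 + g \<omega> ^ 4"])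
      (use I quartic_bounds(3) in auto)
  show fg: "integrable M (\<lambda>\<omega>. f \<omega> * g \<omega>)"
    by (rule Bochner_Integration.integrable_bound[of _ "\<lambda>\<omega>. 1 + (f \<omega> ^ 4 + g \<omega> ^ 4)"])
      (use I quartic_bounds(6) in auto)
  show "integrable M (\<lambda>\<omega>. \<bar>f \<omega> * g \<omega>\<bar>)" by (rule integrable_abs[OF fg])
  show "integrable M (\<lambda>\<omega>. (f \<omega>)\<^sup>2)"
    by (rule Bochner_Integration.integrable_bound[of _ "\<lambda>\<omega>. 1 + f \<omega> ^ 4"])
      (use I quartic_bounds(5) in auto)
  show "integrable M f"
    by (rule Bochner_Integration.integrable_bound[of _ "\<lambda>\<omega>. 1 + f \<omega> ^ 4"])
      (use I quartic_bounds(7) in auto)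
  show "integrable M (\<lambda>\<omega>. f \<omega> ^ 3)"
    by (rule Bochner_Integration.integrable_bound[of _ "\<lambda>\<omega>. f \<omega> ^ 4 + 1 ^ 4"])
      (use I quartic_bounds(1)[of _ 1] in auto)
qed

lemma L4_second_moment: "L4 M f \<Longrightarrow> expectation (\<lambda>\<omega>. (f \<omega>)\<^sup>2) \<le> 1 + expectation (\<lambda>\<omega>. f \<omega> ^ 4)"
proof -
  assume f: "L4 M f"
  have "expectation (\<lambda>\<omega>. (f \<omega>)\<^sup>2) \<le> expectation (\<lambda>\<omega>. 1 + f \<omega> ^ 4)"
    by (intro integral_mono) (use L4_products(5)[OF f f] L4_integrable[OF f] quartic_bounds(5) in auto)
  then show ?thesis using L4_integrable[OF f] by (simp add: prob_space)
qed

end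

section \<open>The filtration of the innovations\<close>

locale gaussian_noise = prob_space M for M :: "'a measure" +
  fixes \<epsilon> :: "nat \<Rightarrow> 'a \<Rightarrow> real"
  assumes indep: "indep_vars (\<lambda>_. borel) \<epsilon> {1..}"
    and normal: "\<And>n. n \<ge> 1 \<Longrightarrow> distributed M lborel (\<epsilon> n) std_normal_density"
begin

text \<open>The sigma-algebra of the first \<open>n\<close> innovations, encoded as a pull-back
  along their joint vector; its sets are then literally those for which independence of disjoint
  blocks is available.\<close>

definition F :: "nat \<Rightarrow> 'a measure" where
  "F n = vimage_algebra (space M) (\<lambda>\<omega>. \<lambda>i\<in>{1..n}. \<epsilon> i \<omega>) (Pi\<^sub>M {1..n} (\<lambda>_. borel))"

lemma space_F [simp]: "space (F n) = space M"
  by (simp add: F_def)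

lemma eps_measurable: "n \<ge> 1 \<Longrightarrow> \<epsilon> n \<in> borel_measurable M"
  using distributed_measurable[OF normal] by simp

lemma restrict_eps_space: "(\<lambda>\<omega>. \<lambda>i\<in>{1..n}. \<epsilon> i \<omega>) \<in> space M \<rightarrow> space (Pi\<^sub>M {1..n} (\<lambda>_. borel))"
  by (auto simp: space_PiM)

lemma eps_F: "1 \<le> i \<Longrightarrow> i \<le> n \<Longrightarrow> \<epsilon> i \<in> borel_measurable (F n)"
proof -
  assume i: "1 \<le> i" "i \<le> n"
  have "(\<lambda>\<omega>. \<lambda>i\<in>{1..n}. \<epsilon> i \<omega>) \<in> measurable (F n) (Pi\<^sub>M {1..n} (\<lambda>_. borel))"
    unfolding F_def by (rule measurable_vimage_algebra1[OF restrict_eps_space])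
  from measurable_compose[OF this measurable_component_singleton[of i "{1..n}" "\<lambda>_. borel"]]
  show ?thesis using i by simp
qed

text \<open>Minimality of \<open>F n\<close>: whenever the first \<open>n\<close> innovations are
  measurable for \<open>N\<close>, the identity is measurable from \<open>N\<close> to
  \<open>F n\<close>.\<close>

lemma F_mono_eq:
  assumes "\<And>i. 1 \<le> i \<Longrightarrow> i \<le> n \<Longrightarrow> \<epsilon> i \<in> borel_measurable N" "space N = space M"
    and f: "f \<in> borel_measurable (F n)"
  shows "f \<in> borel_measurable N"
proof -
  have "(\<lambda>\<omega>. \<lambda>i\<in>{1..n}. \<epsilon> i \<omega>) \<in> measurable N (Pi\<^sub>M {1..n} (\<lambda>_. borel))"
    using assms by (intro measurable_restrict) auto
  then have "(\<lambda>\<omega>. \<omega>) \<in> measurable N (F n)"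
    unfolding F_def using assms(2) by (intro measurable_vimage_algebra2) auto
  from measurable_compose[OF this f] show ?thesis .
qed

lemma F_M: "f \<in> borel_measurable (F n) \<Longrightarrow> f \<in> borel_measurable M"
  by (rule F_mono_eq[of n]) (auto intro: eps_measurable)

lemma F_mono: "n \<le> m \<Longrightarrow> f \<in> borel_measurable (F n) \<Longrightarrow> f \<in> borel_measurable (F m)"
  by (rule F_mono_eq[of n]) (auto intro: eps_F)

lemma indep_next:
  fixes f :: "'a \<Rightarrow> real" and g :: "real \<Rightarrow> real"
  assumes f: "f \<in> borel_measurable (F n)" and g: "g \<in> borel_measurable borel"
  shows "indep_var borel f borel (\<lambda>\<omega>. g (\<epsilon> (Suc n) \<omega>))"
proof -
  let ?R = "\<lambda>I \<omega>. \<lambda>i\<in>I. \<epsilon> i \<omega>" and ?P = "\<lambda>I. Pi\<^sub>M I (\<lambda>_. borel :: real measure)"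
  let ?S = "\<lambda>I. sigma_sets (space M) {?R I -` A \<inter> space M | A. A \<in> sets (?P I)}"
  let ?G = "\<lambda>I. vimage_algebra (space M) (?R I) (?P I)"
  have ind: "indep_set (?S {1..n}) (?S {Suc n})"
    using indep_var_restrict[OF indep, of "{1..n}" "{Suc n}"] unfolding indep_var_eq by auto
  have sub: "sigma_sets (space M) {h -` A \<inter> space M | A. A \<in> sets borel} \<subseteq> ?S I"
    if h: "h \<in> borel_measurable (?G I)" for h :: "'a \<Rightarrow> real" and I
  proof (rule sigma_sets_mono, rule subsetI)
    fix a assume "a \<in> {h -` A \<inter> space M | A. A \<in> sets borel}"
    then have "a \<in> sets (?G I)" using measurable_sets[OF h] by auto
    then show "a \<in> ?S I" by (simp add: sets_vimage_algebra)
  qed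
  have "?R {Suc n} \<in> measurable (?G {Suc n}) (?P {Suc n})"
    by (rule measurable_vimage_algebra1) (auto simp: space_PiM)
  from measurable_compose[OF this measurable_component_singleton[of "Suc n" "{Suc n}"]]
  have "\<epsilon> (Suc n) \<in> borel_measurable (?G {Suc n})" by simp
  from measurable_compose[OF this g]
  have 2: "(\<lambda>\<omega>. g (\<epsilon> (Suc n) \<omega>)) \<in> borel_measurable (?G {Suc n})" .
  have gm: "(\<lambda>\<omega>. g (\<epsilon> (Suc n) \<omega>)) \<in> borel_measurable M"
    by (rule measurable_compose[OF eps_measurable g]) simp
  have "indep_set (sigma_sets (space M) {f -` A \<inter> space M | A. A \<in> sets borel})
      (sigma_sets (space M) {(\<lambda>\<omega>. g (\<epsilon> (Suc n) \<omega>)) -` A \<inter> space M | A. A \<in> sets borel})"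
    using ind sub[OF f[unfolded F_def]] sub[OF 2] unfolding indep_sets2_eq by blast
  then show ?thesis unfolding indep_var_eq using F_M[OF f] gm by auto
qed

text \<open>The martingale property in the only form that is used. Conditioning on the past is
  replaced by independence of the next innovation from every variable measurable for
  \<open>F n\<close>.\<close>

lemma expectation_next:
  fixes f :: "'a \<Rightarrow> real" and g :: "real \<Rightarrow> real"
  assumes f: "f \<in> borel_measurable (F n)" "integrable M f"
    and g: "g \<in> borel_measurable borel" "integrable M (\<lambda>\<omega>. g (\<epsilon> (Suc n) \<omega>))"
  shows "integrable M (\<lambda>\<omega>. f \<omega> * g (\<epsilon> (Suc n) \<omega>))"
    and "expectation (\<lambda>\<omega>. f \<omega> * g (\<epsilon> (Suc n) \<omega>))
      = expectation f * expectation (\<lambda>\<omega>. g (\<epsilon> (Suc n) \<omega>))"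
  using indep_var_integrable[OF indep_next[OF f(1) g(1)] f(2) g(2)]
    indep_var_lebesgue_integral[OF indep_next[OF f(1) g(1)] f(2) g(2)] by auto

lemma eps_integrable:
  assumes "n \<ge> 1"
  shows "integrable M (\<lambda>\<omega>. \<epsilon> n \<omega> ^ k)"
  using distributed_integrable[OF normal[OF assms], of "\<lambda>x. x ^ k"] integrable_std_normal_moment[of k]
  by simp

lemma eps_expectation:
  assumes "n \<ge> 1"
  shows "expectation (\<lambda>\<omega>. \<epsilon> n \<omega> ^ k) = (\<integral>x. std_normal_density x * x ^ k \<partial>lborel)"
  using distributed_integral[OF normal[OF assms], of "\<lambda>x. x ^ k"] by simp

lemma eps_moments:
  assumes "n \<ge> 1"
  shows "expectation (\<epsilon> n) = 0" "expectation (\<lambda>\<omega>. (\<epsilon> n \<omega>)\<^sup>2) = 1"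
    "expectation (\<lambda>\<omega>. \<epsilon> n \<omega> ^ 3) = 0" "expectation (\<lambda>\<omega>. \<epsilon> n \<omega> ^ 4) = 3"
  using eps_expectation[OF assms, of 1] eps_expectation[OF assms, of 2]
    eps_expectation[OF assms, of 3] eps_expectation[OF assms, of 4]
    integral_std_normal_moment_odd[of 0] integral_std_normal_moment_even[of 1]
    integral_std_normal_moment_odd[of 1] integral_std_normal_moment_even[of 2]
  by (simp_all add: fact_numeral numeral_3_eq_3)

lemma eps_L4: "n \<ge> 1 \<Longrightarrow> L4 M (\<epsilon> n)"
  using eps_measurable eps_integrable by (simp add: L4_def)

lemma L4_next:
  assumes w: "w \<in> borel_measurable (F n)" "L4 M w"
    and g: "g \<in> borel_measurable borel" "integrable M (\<lambda>\<omega>. g (\<epsilon> (Suc n) \<omega>) ^ 4)"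
  shows "L4 M (\<lambda>\<omega>. w \<omega> * g (\<epsilon> (Suc n) \<omega>))"
    and "expectation (\<lambda>\<omega>. (w \<omega> * g (\<epsilon> (Suc n) \<omega>)) ^ 4)
      = expectation (\<lambda>\<omega>. w \<omega> ^ 4) * expectation (\<lambda>\<omega>. g (\<epsilon> (Suc n) \<omega>) ^ 4)"
proof -
  note [measurable] = g(1) w(1) eps_measurable
  have ge: "(\<lambda>\<omega>. g (\<epsilon> (Suc n) \<omega>)) \<in> borel_measurable M"
    by (rule measurable_compose[OF eps_measurable g(1)]) simp
  have *: "(\<lambda>\<omega>. w \<omega> ^ 4) \<in> borel_measurable (F n)" "(\<lambda>x. g x ^ 4) \<in> borel_measurable borel"
    by measurable
  note e = expectation_next[OF *(1) L4_integrable[OF w(2)] *(2) g(2)]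
  show "L4 M (\<lambda>\<omega>. w \<omega> * g (\<epsilon> (Suc n) \<omega>))"
    unfolding L4_def power_mult_distrib using e(1) L4_measurable[OF w(2)] ge by simp
  show "expectation (\<lambda>\<omega>. (w \<omega> * g (\<epsilon> (Suc n) \<omega>)) ^ 4)
      = expectation (\<lambda>\<omega>. w \<omega> ^ 4) * expectation (\<lambda>\<omega>. g (\<epsilon> (Suc n) \<omega>) ^ 4)"
    unfolding power_mult_distrib using e(2) by simp
qed


text \<open>A martingale transform when \<open>g\<close> is centered: the weight \<open>w i\<close>
  is known at time i and multiplies a function of the next innovation. The identity as
  \<open>g\<close> gives the score martingale, x^2 - 1 gives the law of large numbers for squared
  innovations.\<close>

definition msum :: "(nat \<Rightarrow> 'a \<Rightarrow> real) \<Rightarrow> (real \<Rightarrow> real) \<Rightarrow> nat \<Rightarrow> 'a \<Rightarrow> real" where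
  "msum w g n \<omega> = (\<Sum>i<n. w i \<omega> * g (\<epsilon> (Suc i) \<omega>))"

lemma msum_measurable:
  assumes w: "\<And>i. w i \<in> borel_measurable (F i)" and g: "g \<in> borel_measurable borel"
  shows "msum w g n \<in> borel_measurable (F n)"
  unfolding msum_def
proof (intro borel_measurable_sum borel_measurable_times)
  fix i assume i: "i \<in> {..<n}"
  show "w i \<in> borel_measurable (F n)" using F_mono[OF _ w] i by simp
  show "(\<lambda>\<omega>. g (\<epsilon> (Suc i) \<omega>)) \<in> borel_measurable (F n)"
    by (rule measurable_compose[OF eps_F g]) (use i in auto)
qed

lemma msum_L4:
  assumes w: "\<And>i. w i \<in> borel_measurable (F i)" "\<And>i. L4 M (w i)"
    and g: "g \<in> borel_measurable borel" "\<And>n. integrable M (\<lambda>\<omega>. g (\<epsilon> (Suc n) \<omega>) ^ 4)"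
  shows "L4 M (msum w g n)"
  unfolding msum_def by (rule L4_sum) (rule L4_next(1)[OF w g])

text \<open>A discrete Gronwall bound: from n to n + 1 the claimed bound grows by 4Bn + 2B, of which
  the recursion uses 3Bn + B. At \<open>n = 0\<close> the quotient 1/n is 0.\<close>

lemma quadratic_growth:
  fixes x :: "nat \<Rightarrow> real"
  assumes "x 0 = 0" "\<And>n. x n \<ge> 0" "\<And>n. x (Suc n) \<le> x n * (1 + 1 / real n) + B * real n + B" "B \<ge> 0"
  shows "x n \<le> 2 * B * (real n)\<^sup>2"
proof (induction n)
  case (Suc n)
  show ?case
  proof (cases "n = 0")
    case True
    then show ?thesis using assms(1) assms(3)[of 0] assms(4) by simp
  next
    case False
    have "x (Suc n) \<le> x n * (1 + 1 / real n) + B * real n + B" by (rule assms(3))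
    also have "\<dots> \<le> 2 * B * (real n)\<^sup>2 * (1 + 1 / real n) + B * real n + B"
      by (intro add_right_mono mult_right_mono Suc.IH) auto
    also have "\<dots> = 2 * B * (real n)\<^sup>2 + 3 * B * real n + B"
      using False by (simp add: power2_eq_square field_simps)
    also have "\<dots> \<le> 2 * B * (real (Suc n))\<^sup>2"
      using assms(4) by (simp add: power2_eq_square algebra_simps)
    finally show ?thesis .
  qed
qed (use assms in simp)

text \<open>Burkholder's inequality of order four, with the cubic terms of the binomial expansion
  absorbed by the quadratic and quartic ones.\<close>

lemma msum_fourth_moment:
  assumes w: "\<And>i. w i \<in> borel_measurable (F i)" "\<And>i. L4 M (w i)"
    and C: "\<And>i. expectation (\<lambda>\<omega>. w i \<omega> ^ 4) \<le> C"
    and g: "g \<in> borel_measurable borel" "\<And>n. integrable M (\<lambda>\<omega>. g (\<epsilon> (Suc n) \<omega>) ^ 4)"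
    and g0: "\<And>n. expectation (\<lambda>\<omega>. g (\<epsilon> (Suc n) \<omega>)) = 0"
    and K: "\<And>n. expectation (\<lambda>\<omega>. g (\<epsilon> (Suc n) \<omega>) ^ 4) \<le> K"
  shows "\<exists>D\<ge>0. \<forall>n. expectation (\<lambda>\<omega>. msum w g n \<omega> ^ 4) \<le> D * (real n)\<^sup>2"
proof -
  define m where "m = msum w g"
  define x where "x n = expectation (\<lambda>\<omega>. m n \<omega> ^ 4)" for n
  \<comment> \<open>\<open>a\<close> collects the coefficients of the mixed moment E m^2 w^2: 6 (1 +
    K) from the quadratic term of the expansion and 2 (1 + K) from its share of the cubic
    one.\<close>
  define a where "a = 8 * (1 + K)"
  define B where "B = a\<^sup>2 * C + (2 * (1 + K) + K) * C"
  have mF: "m n \<in> borel_measurable (F n)" for n unfolding m_def by (rule msum_measurable[OF w(1) g(1)])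
  have mL: "L4 M (m n)" for n unfolding m_def by (rule msum_L4[OF w g])
  have gL: "L4 M (\<lambda>\<omega>. g (\<epsilon> (Suc n) \<omega>))" for n
    using measurable_compose[OF eps_measurable[of "Suc n"] g(1)] g(2) by (simp add: L4_def)
  have K0: "K \<ge> 0" by (rule order_trans[OF Bochner_Integration.integral_nonneg K[of 0]]) simp
  have C0: "C \<ge> 0" by (rule order_trans[OF Bochner_Integration.integral_nonneg C[of 0]]) simp
  have a0: "a > 0" using K0 by (simp add: a_def)
  have B0: "B \<ge> 0" using K0 C0 by (simp add: B_def)
  have g2: "expectation (\<lambda>\<omega>. (g (\<epsilon> (Suc n) \<omega>))\<^sup>2) \<le> 1 + K" for n
    using L4_second_moment[OF gL[of n]] K[of n] by simp
  have g3: "\<bar>expectation (\<lambda>\<omega>. (g (\<epsilon> (Suc n) \<omega>)) ^ 3)\<bar> \<le> 1 + K" for n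
  proof -
    have "\<bar>expectation (\<lambda>\<omega>. (g (\<epsilon> (Suc n) \<omega>)) ^ 3)\<bar> \<le> expectation (\<lambda>\<omega>. \<bar>g (\<epsilon> (Suc n) \<omega>) ^ 3\<bar>)"
      by (rule integral_abs_bound)
    also have "\<dots> \<le> expectation (\<lambda>\<omega>. g (\<epsilon> (Suc n) \<omega>) ^ 4 + 1 ^ 4)"
    proof (rule integral_mono)
      show "\<bar>g (\<epsilon> (Suc n) \<omega>) ^ 3\<bar> \<le> g (\<epsilon> (Suc n) \<omega>) ^ 4 + 1 ^ 4" for \<omega>
        using quartic_bounds(1)[of "g (\<epsilon> (Suc n) \<omega>)" 1] by simp
    qed (intro integrable_abs Bochner_Integration.integrable_add L4_products(7)[OF gL gL] g(2)
        integrable_const)+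
    also have "\<dots> \<le> 1 + K" using K[of n] g(2)[of n] by (simp add: prob_space)
    finally show ?thesis .
  qed
  have step: "x (Suc n) \<le> x n * (1 + 1 / real n) + B * real n + B" for n
  proof -
    let ?g = "\<lambda>\<omega>. g (\<epsilon> (Suc n) \<omega>)"
    note [measurable] = mF w(1)
    have meas: "(\<lambda>\<omega>. m n \<omega> ^ 3 * w n \<omega>) \<in> borel_measurable (F n)"
      "(\<lambda>\<omega>. (m n \<omega>)\<^sup>2 * (w n \<omega>)\<^sup>2) \<in> borel_measurable (F n)"
      "(\<lambda>\<omega>. m n \<omega> * w n \<omega> ^ 3) \<in> borel_measurable (F n)"
      "(\<lambda>\<omega>. w n \<omega> ^ 4) \<in> borel_measurable (F n)"
      by measurable
    have gm: "(\<lambda>x. (g x)\<^sup>2) \<in> borel_measurable borel" "(\<lambda>x. g x ^ 3) \<in> borel_measurable borel"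
      "(\<lambda>x. g x ^ 4) \<in> borel_measurable borel"
      using g(1) by measurable
    note I = L4_products[OF mL[of n] w(2)[of n]] L4_integrable[OF w(2)[of n]]
    note J = L4_products[OF gL[of n] gL[of n]]
    note e1 = expectation_next[OF meas(1) I(1) g(1) J(6)]
    note e2 = expectation_next[OF meas(2) I(2) gm(1) J(5)]
    note e3 = expectation_next[OF meas(3) I(3) gm(2) J(7)]
    note e4 = expectation_next[OF meas(4) I(9) gm(3) g(2)]
    let ?E2 = "expectation (\<lambda>\<omega>. (m n \<omega>)\<^sup>2 * (w n \<omega>)\<^sup>2)"
    let ?E3 = "expectation (\<lambda>\<omega>. m n \<omega> * w n \<omega> ^ 3)"
    let ?E4 = "expectation (\<lambda>\<omega>. w n \<omega> ^ 4)"
    have exp4: "(u + v * z) ^ 4 = u ^ 4 + 4 * ((u ^ 3 * v) * z) + 6 * ((u\<^sup>2 * v\<^sup>2) * z\<^sup>2)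
        + 4 * ((u * v ^ 3) * z ^ 3) + v ^ 4 * z ^ 4" for u v z :: real
      by (simp add: power2_eq_square power3_eq_cube power4_eq_xxxx algebra_simps)
    have "m (Suc n) \<omega> = m n \<omega> + w n \<omega> * ?g \<omega>" for \<omega> by (simp add: m_def msum_def)
    then have "x (Suc n) = x n + 4 * expectation (\<lambda>\<omega>. (m n \<omega> ^ 3 * w n \<omega>) * ?g \<omega>)
        + 6 * expectation (\<lambda>\<omega>. ((m n \<omega>)\<^sup>2 * (w n \<omega>)\<^sup>2) * (?g \<omega>)\<^sup>2)
        + 4 * expectation (\<lambda>\<omega>. (m n \<omega> * w n \<omega> ^ 3) * ?g \<omega> ^ 3)
        + expectation (\<lambda>\<omega>. w n \<omega> ^ 4 * ?g \<omega> ^ 4)"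
      unfolding x_def using e1(1) e2(1) e3(1) e4(1) L4_integrable[OF mL[of n]]
      by (simp add: exp4)
    also have "\<dots> = x n + 6 * (?E2 * expectation (\<lambda>\<omega>. (?g \<omega>)\<^sup>2))
        + 4 * (?E3 * expectation (\<lambda>\<omega>. ?g \<omega> ^ 3)) + ?E4 * expectation (\<lambda>\<omega>. ?g \<omega> ^ 4)"
      unfolding e1(2) e2(2) e3(2) e4(2) g0 by simp
    also have "\<dots> \<le> x n + 6 * (?E2 * (1 + K)) + 4 * ((?E2 + ?E4) / 2 * (1 + K)) + ?E4 * K"
    proof -
      have E2: "?E2 \<ge> 0" and E4: "?E4 \<ge> 0" by (simp_all add: integral_nonneg_AE)
      have "\<bar>?E3\<bar> \<le> expectation (\<lambda>\<omega>. \<bar>m n \<omega> * w n \<omega> ^ 3\<bar>)" by (rule integral_abs_bound)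
      also have "\<dots> \<le> expectation (\<lambda>\<omega>. ((m n \<omega>)\<^sup>2 * (w n \<omega>)\<^sup>2 + w n \<omega> ^ 4) / 2)"
      proof (rule integral_mono)
        fix \<omega>
        have "2 * (\<bar>m n \<omega> * w n \<omega>\<bar> * (w n \<omega>)\<^sup>2) \<le> (m n \<omega> * w n \<omega>)\<^sup>2 + ((w n \<omega>)\<^sup>2)\<^sup>2"
          using zero_le_power2[of "\<bar>m n \<omega> * w n \<omega>\<bar> - (w n \<omega>)\<^sup>2"] by (simp add: power2_diff)
        moreover have "\<bar>m n \<omega> * w n \<omega> ^ 3\<bar> = \<bar>m n \<omega> * w n \<omega>\<bar> * (w n \<omega>)\<^sup>2"
          by (simp add: abs_mult power2_eq_square power3_eq_cube)
        moreover have "((w n \<omega>)\<^sup>2)\<^sup>2 = w n \<omega> ^ 4" by simp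
        ultimately show "\<bar>m n \<omega> * w n \<omega> ^ 3\<bar> \<le> ((m n \<omega>)\<^sup>2 * (w n \<omega>)\<^sup>2 + w n \<omega> ^ 4) / 2"
          by (simp add: power_mult_distrib)
      qed (intro integrable_abs integrable_divide Bochner_Integration.integrable_add I)+
      also have "\<dots> = (?E2 + ?E4) / 2" using I by simp
      finally have E3: "\<bar>?E3\<bar> \<le> (?E2 + ?E4) / 2" .
      have "?E3 * expectation (\<lambda>\<omega>. ?g \<omega> ^ 3) \<le> \<bar>?E3\<bar> * \<bar>expectation (\<lambda>\<omega>. ?g \<omega> ^ 3)\<bar>"
        by (simp add: abs_mult[symmetric])
      also have "\<dots> \<le> (?E2 + ?E4) / 2 * (1 + K)"
        using E2 E4 by (intro mult_mono E3 g3) auto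
      finally show ?thesis
        using mult_left_mono[OF g2 E2, of n] mult_left_mono[OF K E4, of n] by linarith
    qed
    also have "\<dots> = x n + a * ?E2 + (2 * (1 + K) + K) * ?E4"
      by (simp add: a_def algebra_simps)
    also have "\<dots> \<le> x n + (x n / real n + a\<^sup>2 * C * real n) + (2 * (1 + K) + K) * C"
    proof (intro add_mono order_refl mult_left_mono C)
      \<comment> \<open>Young's inequality with a weight proportional to n: a s t is at most s^2 / n
        + a^2 n t^2 for s = m^2 and t = w^2. This produces exactly the factor 1 + 1/n that quadratic
        growth tolerates.\<close>
      show "a * ?E2 \<le> x n / real n + a\<^sup>2 * C * real n"
      proof (cases "n = 0")
        case True
        then show ?thesis by (simp add: m_def msum_def)
      next
        case False
        have "a * ?E2 = expectation (\<lambda>\<omega>. a * ((m n \<omega>)\<^sup>2 * (w n \<omega>)\<^sup>2))" by simp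
        also have "\<dots> \<le> expectation (\<lambda>\<omega>. (1 / real n) * m n \<omega> ^ 4 + (a\<^sup>2 * real n) * w n \<omega> ^ 4)"
        proof (rule integral_mono)
          fix \<omega>
          let ?s = "(m n \<omega>)\<^sup>2" and ?t = "(w n \<omega>)\<^sup>2"
          have "0 \<le> (?s - a * real n * ?t)\<^sup>2" by simp
          then have "2 * (a * real n * (?s * ?t)) \<le> ?s\<^sup>2 + a\<^sup>2 * (real n)\<^sup>2 * ?t\<^sup>2"
            by (simp add: power2_diff power_mult_distrib mult_ac)
          moreover have "0 \<le> a * real n * (?s * ?t)" using a0 by simp
          ultimately have "a * real n * (?s * ?t) \<le> ?s\<^sup>2 + a\<^sup>2 * (real n)\<^sup>2 * ?t\<^sup>2" by linarith
          then have "a * (?s * ?t) * real n \<le> ((1 / real n) * ?s\<^sup>2 + (a\<^sup>2 * real n) * ?t\<^sup>2) * real n"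
            using False by (simp add: algebra_simps power2_eq_square)
          then have "a * (?s * ?t) \<le> (1 / real n) * ?s\<^sup>2 + (a\<^sup>2 * real n) * ?t\<^sup>2"
            using False by (simp only: mult_le_cancel_right_pos of_nat_0_less_iff not_gr_zero)
          moreover have "?s\<^sup>2 = m n \<omega> ^ 4" "?t\<^sup>2 = w n \<omega> ^ 4"
            unfolding power_mult[symmetric] by simp_all
          ultimately show "a * (?s * ?t) \<le> (1 / real n) * m n \<omega> ^ 4 + (a\<^sup>2 * real n) * w n \<omega> ^ 4"
            by metis
        qed (intro integrable_mult_right Bochner_Integration.integrable_add I L4_integrable[OF mL])+
        also have "\<dots> = (1 / real n) * x n + (a\<^sup>2 * real n) * ?E4"
          using I L4_integrable[OF mL] by (simp add: x_def)
        also have "\<dots> \<le> (1 / real n) * x n + (a\<^sup>2 * real n) * C"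
          by (intro add_left_mono mult_left_mono C) auto
        finally show ?thesis by (simp add: mult_ac)
      qed
    qed (use K0 in auto)
    also have "\<dots> \<le> x n * (1 + 1 / real n) + B * real n + B"
    proof -
      have "a\<^sup>2 * C * real n \<le> B * real n"
        using K0 C0 by (intro mult_right_mono) (simp_all add: B_def)
      moreover have "(2 * (1 + K) + K) * C \<le> B" using C0 by (simp add: B_def)
      ultimately show ?thesis by (simp add: distrib_left)
    qed
    finally show ?thesis .
  qed
  have "x n \<le> 2 * B * (real n)\<^sup>2" for n
    by (rule quadratic_growth[OF _ _ step B0])
      (simp_all add: x_def m_def msum_def integral_nonneg_AE)
  then show ?thesis using B0 unfolding x_def m_def by (intro exI[of _ "2 * B"]) auto
qed

lemma msum_strong_law:
  assumes w: "\<And>i. w i \<in> borel_measurable (F i)" "\<And>i. L4 M (w i)"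
    and C: "\<And>i. expectation (\<lambda>\<omega>. w i \<omega> ^ 4) \<le> C"
    and g: "g \<in> borel_measurable borel" "\<And>n. integrable M (\<lambda>\<omega>. g (\<epsilon> (Suc n) \<omega>) ^ 4)"
    and g0: "\<And>n. expectation (\<lambda>\<omega>. g (\<epsilon> (Suc n) \<omega>)) = 0"
    and K: "\<And>n. expectation (\<lambda>\<omega>. g (\<epsilon> (Suc n) \<omega>) ^ 4) \<le> K"
  shows "AE \<omega> in M. (\<lambda>n. msum w g n \<omega> / real n) \<longlonglongrightarrow> 0"
proof -
  obtain D where D: "D \<ge> 0" "\<And>n. expectation (\<lambda>\<omega>. msum w g n \<omega> ^ 4) \<le> D * (real n)\<^sup>2"
    using msum_fourth_moment[OF w C g g0 K] by blast
  have mL: "L4 M (msum w g n)" for n by (rule msum_L4[OF w g])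
  have "AE \<omega> in M. (\<lambda>n. (msum w g n \<omega> / real n) ^ 4) \<longlonglongrightarrow> 0"
  proof (rule AE_tendsto_0_if_summable_integral)
    show "integrable M (\<lambda>\<omega>. (msum w g n \<omega> / real n) ^ 4)" for n
      using L4_integrable[OF mL] by (simp add: power_divide)
    show "summable (\<lambda>n. D * (1 / (real n)\<^sup>2))"
      using inverse_power_summable[of 2] by (intro summable_mult) (simp add: inverse_eq_divide)
    show "expectation (\<lambda>\<omega>. (msum w g n \<omega> / real n) ^ 4) \<le> D * (1 / (real n)\<^sup>2)" if "n \<ge> 1" for n
    proof -
      have "expectation (\<lambda>\<omega>. (msum w g n \<omega> / real n) ^ 4)
          = expectation (\<lambda>\<omega>. msum w g n \<omega> ^ 4) / real n ^ 4"
        by (simp add: power_divide)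
      also have "\<dots> \<le> D * (real n)\<^sup>2 / real n ^ 4" by (intro divide_right_mono D) auto
      also have "\<dots> = D * (1 / (real n)\<^sup>2)" using that by (simp add: power2_eq_square power4_eq_xxxx)
      finally show ?thesis .
    qed
  qed auto
  then show ?thesis
  proof eventually_elim
    case (elim \<omega>)
    then show ?case by (simp only: power_tendsto_0_iff zero_less_numeral)
  qed
qed

end

subsection \<open>The quadratic strong law for scalar weights\<close>

context gaussian_noise begin

lemma integrable_prod_if_squares:
  fixes f g :: "'a \<Rightarrow> real"
  assumes [measurable]: "f \<in> borel_measurable M" "g \<in> borel_measurable M"
    and "integrable M (\<lambda>\<omega>. (f \<omega>)\<^sup>2)" "integrable M (\<lambda>\<omega>. (g \<omega>)\<^sup>2)"
  shows "integrable M (\<lambda>\<omega>. f \<omega> * g \<omega>)"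
proof (rule Bochner_Integration.integrable_bound[of _ "\<lambda>\<omega>. (f \<omega>)\<^sup>2 + (g \<omega>)\<^sup>2"])
  show "AE \<omega> in M. norm (f \<omega> * g \<omega>) \<le> norm ((f \<omega>)\<^sup>2 + (g \<omega>)\<^sup>2)"
  proof (rule AE_I2)
    fix \<omega>
    have "2 * (\<bar>f \<omega>\<bar> * \<bar>g \<omega>\<bar>) \<le> \<bar>f \<omega>\<bar>\<^sup>2 + \<bar>g \<omega>\<bar>\<^sup>2"
      using sum_squares_bound[of "\<bar>f \<omega>\<bar>" "\<bar>g \<omega>\<bar>"] by (simp add: mult.assoc)
    moreover have "0 \<le> \<bar>f \<omega>\<bar> * \<bar>g \<omega>\<bar>" by simp
    ultimately have "\<bar>f \<omega>\<bar> * \<bar>g \<omega>\<bar> \<le> (f \<omega>)\<^sup>2 + (g \<omega>)\<^sup>2" unfolding power2_abs by linarith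
    then show "norm (f \<omega> * g \<omega>) \<le> norm ((f \<omega>)\<^sup>2 + (g \<omega>)\<^sup>2)" by (simp add: abs_mult)
  qed
qed (use assms in simp_all)

text \<open>The new innovation enters through the Hermite polynomials x and x^2 - 1. Under the
  normal law these are centered, mutually orthogonal and of variance 1 and 2, and they are
  independent of the past; hence second moments simply add.\<close>

lemma second_moment_step:
  assumes N: "N \<in> borel_measurable (F n)" "integrable M (\<lambda>\<omega>. (N \<omega>)\<^sup>2)"
    and f: "f \<in> borel_measurable (F n)" "integrable M (\<lambda>\<omega>. (f \<omega>)\<^sup>2)"
    and h: "h \<in> borel_measurable (F n)" "integrable M (\<lambda>\<omega>. (h \<omega>)\<^sup>2)"
  defines "N' \<equiv> \<lambda>\<omega>. N \<omega> + (f \<omega> * \<epsilon> (Suc n) \<omega> + h \<omega> * ((\<epsilon> (Suc n) \<omega>)\<^sup>2 - 1))"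
  shows "N' \<in> borel_measurable (F (Suc n))" "integrable M (\<lambda>\<omega>. (N' \<omega>)\<^sup>2)"
    "expectation (\<lambda>\<omega>. (N' \<omega>)\<^sup>2) = expectation (\<lambda>\<omega>. (N \<omega>)\<^sup>2)
      + (expectation (\<lambda>\<omega>. (f \<omega>)\<^sup>2) + 2 * expectation (\<lambda>\<omega>. (h \<omega>)\<^sup>2))"
proof -
  let ?e = "\<epsilon> (Suc n)"
  have FS: "N \<in> borel_measurable (F (Suc n))" "f \<in> borel_measurable (F (Suc n))"
    "h \<in> borel_measurable (F (Suc n))" "?e \<in> borel_measurable (F (Suc n))"
    using F_mono[of n "Suc n"] N f h eps_F[of "Suc n" "Suc n"] by auto
  show "N' \<in> borel_measurable (F (Suc n))"
    unfolding N'_def using FS by measurable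
  note MM = F_M[OF N(1)] F_M[OF f(1)] F_M[OF h(1)]
  note [measurable] = N(1) f(1) h(1)
  have eI: "integrable M (\<lambda>\<omega>. ?e \<omega> ^ k)" for k by (rule eps_integrable) simp
  note em = eps_moments[of "Suc n", simplified]
  have I: "integrable M (\<lambda>\<omega>. N \<omega> * f \<omega>)" "integrable M (\<lambda>\<omega>. N \<omega> * h \<omega>)" "integrable M (\<lambda>\<omega>. f \<omega> * h \<omega>)"
    using integrable_prod_if_squares[OF MM(1) MM(2) N(2) f(2)] integrable_prod_if_squares[OF MM(1) MM(3) N(2) h(2)]
      integrable_prod_if_squares[OF MM(2) MM(3) f(2) h(2)] .
  have me: "(\<lambda>\<omega>. N \<omega> * f \<omega>) \<in> borel_measurable (F n)" "(\<lambda>\<omega>. N \<omega> * h \<omega>) \<in> borel_measurable (F n)"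
    "(\<lambda>\<omega>. f \<omega> * h \<omega>) \<in> borel_measurable (F n)" "(\<lambda>\<omega>. (f \<omega>)\<^sup>2) \<in> borel_measurable (F n)"
    "(\<lambda>\<omega>. (h \<omega>)\<^sup>2) \<in> borel_measurable (F n)"
    by measurable
  have g1: "integrable M (\<lambda>\<omega>. ?e \<omega>)" using eI[of 1] by simp
  have g2: "integrable M (\<lambda>\<omega>. (?e \<omega>)\<^sup>2 - 1)" using eI[of 2] by simp
  have g3: "integrable M (\<lambda>\<omega>. ?e \<omega> ^ 3 - ?e \<omega>)" using eI[of 3] g1 by simp
  have g4: "integrable M (\<lambda>\<omega>. ?e \<omega> ^ 4 - 2 * (?e \<omega>)\<^sup>2 + 1)" using eI[of 4] eI[of 2] by simp
  have E2: "expectation (\<lambda>\<omega>. (?e \<omega>)\<^sup>2 - 1) = 0" using eI[of 2] em by (simp add: prob_space)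
  have E3: "expectation (\<lambda>\<omega>. ?e \<omega> ^ 3 - ?e \<omega>) = 0" using eI[of 3] g1 em by simp
  have E4: "expectation (\<lambda>\<omega>. ?e \<omega> ^ 4 - 2 * (?e \<omega>)\<^sup>2 + 1) = 2"
    using eI[of 4] eI[of 2] em by (simp add: prob_space)
  note e1 = expectation_next[OF me(1) I(1), of "\<lambda>x. x", OF _ g1, simplified em mult_zero_right]
  note e2 = expectation_next[OF me(2) I(2), of "\<lambda>x. x\<^sup>2 - 1", OF _ g2, unfolded E2 mult_zero_right]
  note e3 = expectation_next[OF me(3) I(3), of "\<lambda>x. x ^ 3 - x", OF _ g3, unfolded E3 mult_zero_right]
  note e4 = expectation_next[OF me(4) f(2), of "\<lambda>x. x\<^sup>2", OF _ eI[of 2], unfolded em(2) mult_1_right]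
  note e5 = expectation_next[OF me(5) h(2), of "\<lambda>x. x ^ 4 - 2 * x\<^sup>2 + 1", OF _ g4, unfolded E4]
  \<comment> \<open>Each summand after the first is a past factor times a function of the new
    innovation, so its expectation factors. In the three cross terms the innovation factor has mean
    zero.\<close>
  have eq: "(N' \<omega>)\<^sup>2 = (N \<omega>)\<^sup>2 + 2 * ((N \<omega> * f \<omega>) * ?e \<omega>) + 2 * ((N \<omega> * h \<omega>) * ((?e \<omega>)\<^sup>2 - 1))
      + 2 * ((f \<omega> * h \<omega>) * (?e \<omega> ^ 3 - ?e \<omega>)) + (f \<omega>)\<^sup>2 * (?e \<omega>)\<^sup>2
      + (h \<omega>)\<^sup>2 * (?e \<omega> ^ 4 - 2 * (?e \<omega>)\<^sup>2 + 1)" for \<omega>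
    by (simp add: N'_def power2_eq_square power3_eq_cube power4_eq_xxxx algebra_simps)
  have mm: "(\<lambda>x::real. x) \<in> borel_measurable borel" "(\<lambda>x::real. x\<^sup>2 - 1) \<in> borel_measurable borel"
    "(\<lambda>x::real. x ^ 3 - x) \<in> borel_measurable borel" "(\<lambda>x::real. x\<^sup>2) \<in> borel_measurable borel"
    "(\<lambda>x::real. x ^ 4 - 2 * x\<^sup>2 + 1) \<in> borel_measurable borel"
    by measurable
  note J = N(2) e1(1)[OF mm(1)] e2(1)[OF mm(2)] e3(1)[OF mm(3)] e4(1)[OF mm(4)] e5(1)[OF mm(5)]
  show "integrable M (\<lambda>\<omega>. (N' \<omega>)\<^sup>2)"
    unfolding eq by (intro Bochner_Integration.integrable_add integrable_mult_right J)
  show "expectation (\<lambda>\<omega>. (N' \<omega>)\<^sup>2) = expectation (\<lambda>\<omega>. (N \<omega>)\<^sup>2)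
      + (expectation (\<lambda>\<omega>. (f \<omega>)\<^sup>2) + 2 * expectation (\<lambda>\<omega>. (h \<omega>)\<^sup>2))"
    unfolding eq
    by (simp only: Bochner_Integration.integral_add Bochner_Integration.integrable_add
        integrable_mult_right integral_mult_right_zero J
        e1(2)[OF mm(1)] e2(2)[OF mm(2)] e3(2)[OF mm(3)] e4(2)[OF mm(4)] e5(2)[OF mm(5)])
qed


abbreviation mart :: "(nat \<Rightarrow> 'a \<Rightarrow> real) \<Rightarrow> nat \<Rightarrow> 'a \<Rightarrow> real" where
  "mart w \<equiv> msum w (\<lambda>x. x)"

text \<open>With d_{k+1} the product of w_k and the next innovation, the increment is (2 m_k d_{k+1}
  + d_{k+1}^2 - w_k^2) / (k + 1): the summed right-hand side of the square identity after removal of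
  its compensator.\<close>

definition compens :: "(nat \<Rightarrow> 'a \<Rightarrow> real) \<Rightarrow> nat \<Rightarrow> 'a \<Rightarrow> real" where
  "compens w n \<omega> = (\<Sum>k<n. 2 * (mart w k \<omega> * w k \<omega>) / real (Suc k) * \<epsilon> (Suc k) \<omega>
     + (w k \<omega>)\<^sup>2 / real (Suc k) * ((\<epsilon> (Suc k) \<omega>)\<^sup>2 - 1))"

text \<open>The inductive step is m^2/n = m^2/(n+1) + m^2/(n(n+1)). It holds at n = 0 too, where m =
  0 and division by zero yields zero.\<close>

lemma mart_square_decomposition:
  "(mart w n \<omega>)\<^sup>2 / real n + (\<Sum>k<n. (mart w k \<omega>)\<^sup>2 / (real k * real (Suc k)))
    = compens w n \<omega> + (\<Sum>k<n. (w k \<omega>)\<^sup>2 / real (Suc k))"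
proof (induction n)
  case 0
  then show ?case by (simp add: compens_def)
next
  case (Suc n)
  define s where "s = real (Suc n)"
  have s: "s > 0" by (simp add: s_def)
  define m where "m = mart w n \<omega>"
  define d where "d = w n \<omega>"
  define e where "e = \<epsilon> (Suc n) \<omega>"
  have m': "mart w (Suc n) \<omega> = m + d * e" by (simp add: msum_def m_def d_def e_def)
  have "m\<^sup>2 / (real n * s) + m\<^sup>2 / s = m\<^sup>2 / real n"
  proof (cases "n = 0")
    case True
    then have "m = 0" by (simp add: m_def msum_def)
    then show ?thesis by simp
  next
    case False
    then have "m\<^sup>2 / (real n * s) + m\<^sup>2 / s = m\<^sup>2 * (1 + real n) / (real n * s)"
      using s by (simp add: field_simps)
    then show ?thesis using False s by (simp add: s_def)
  qed
  moreover have "(m + d * e)\<^sup>2 / s = m\<^sup>2 / s + (2 * (m * d) / s * e + d\<^sup>2 / s * (e\<^sup>2 - 1)) + d\<^sup>2 / s"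
    using s by (simp add: field_simps power2_eq_square)
  moreover have "compens w (Suc n) \<omega> = compens w n \<omega> + (2 * (m * d) / s * e + d\<^sup>2 / s * (e\<^sup>2 - 1))"
    by (simp add: compens_def m_def d_def e_def s_def)
  ultimately show ?case using Suc by (simp add: m' del: of_nat_Suc flip: s_def m_def d_def e_def)
qed

lemma eps_id_moments:
  "(\<lambda>x::real. x) \<in> borel_measurable borel" "\<And>n. integrable M (\<lambda>\<omega>. \<epsilon> (Suc n) \<omega> ^ 4)"
  "\<And>n. expectation (\<lambda>\<omega>. \<epsilon> (Suc n) \<omega>) = 0" "\<And>n. expectation (\<lambda>\<omega>. \<epsilon> (Suc n) \<omega> ^ 4) \<le> 3"
  using eps_moments eps_integrable by simp_all

text \<open>Orthogonality of the increments turns the second moment into a sum, and E m_k^2 w_k^2 =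
  O(k + 1) makes its terms O(1 / (k + 1)).\<close>

lemma compens_second_moment:
  assumes w: "\<And>i. w i \<in> borel_measurable (F i)" "\<And>i. L4 M (w i)"
    and C: "\<And>i. expectation (\<lambda>\<omega>. w i \<omega> ^ 4) \<le> C"
  shows "\<exists>B\<ge>0. \<forall>n. expectation (\<lambda>\<omega>. (compens w n \<omega>)\<^sup>2) \<le> B * (\<Sum>k<n. 1 / real (Suc k))"
    and "integrable M (\<lambda>\<omega>. (compens w n \<omega>)\<^sup>2)"
proof -
  obtain D where D: "D \<ge> 0" "\<And>n. expectation (\<lambda>\<omega>. mart w n \<omega> ^ 4) \<le> D * (real n)\<^sup>2"
    using msum_fourth_moment[OF w C eps_id_moments] by blast
  have mF: "mart w n \<in> borel_measurable (F n)" for n by (rule msum_measurable[OF w(1) eps_id_moments(1)])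
  have mL: "L4 M (mart w n)" for n by (rule msum_L4[OF w eps_id_moments(1,2)])
  have C0: "C \<ge> 0" by (rule order_trans[OF Bochner_Integration.integral_nonneg C[of 0]]) simp
  define f where "f k \<omega> = 2 * (mart w k \<omega> * w k \<omega>) / real (Suc k)" for k \<omega>
  define h where "h k \<omega> = (w k \<omega>)\<^sup>2 / real (Suc k)" for k \<omega>
  have f2: "(f k \<omega>)\<^sup>2 = 4 / (real (Suc k))\<^sup>2 * ((mart w k \<omega>)\<^sup>2 * (w k \<omega>)\<^sup>2)" for k \<omega>
    by (simp add: f_def power_mult_distrib power_divide)
  have h2: "(h k \<omega>)\<^sup>2 = 1 / (real (Suc k))\<^sup>2 * w k \<omega> ^ 4" for k \<omega>
    by (simp add: h_def power_divide)
  have fF: "f k \<in> borel_measurable (F k)" and hF: "h k \<in> borel_measurable (F k)" for k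
    using mF[of k] w(1)[of k] unfolding f_def h_def by measurable
  have fI: "integrable M (\<lambda>\<omega>. (f k \<omega>)\<^sup>2)" and hI: "integrable M (\<lambda>\<omega>. (h k \<omega>)\<^sup>2)" for k
    unfolding f2 h2 by (intro integrable_mult_right L4_products(2)[OF mL w(2)] L4_integrable[OF w(2)])+
  have N: "compens w n \<in> borel_measurable (F n) \<and> integrable M (\<lambda>\<omega>. (compens w n \<omega>)\<^sup>2) \<and>
    expectation (\<lambda>\<omega>. (compens w n \<omega>)\<^sup>2)
      = (\<Sum>k<n. expectation (\<lambda>\<omega>. (f k \<omega>)\<^sup>2) + 2 * expectation (\<lambda>\<omega>. (h k \<omega>)\<^sup>2))" for n
  proof (induction n)
    case (Suc n)
    have "compens w (Suc n) = (\<lambda>\<omega>. compens w n \<omega>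
        + (f n \<omega> * \<epsilon> (Suc n) \<omega> + h n \<omega> * ((\<epsilon> (Suc n) \<omega>)\<^sup>2 - 1)))"
      by (simp add: compens_def f_def h_def fun_eq_iff)
    then show ?case
      using Suc second_moment_step[OF conjunct1[OF Suc] conjunct1[OF conjunct2[OF Suc]] fF fI hF hI]
      by simp
  qed (simp_all add: compens_def)
  then show "integrable M (\<lambda>\<omega>. (compens w n \<omega>)\<^sup>2)" by blast
  \<comment> \<open>4 (D + C) bounds the part linear in the innovation, 2 C the part with its
    centered square.\<close>
  define B where "B = 4 * (D + C) + 2 * C"
  have B: "B \<ge> 0" using D(1) C0 by (simp add: B_def)
  have "expectation (\<lambda>\<omega>. (f k \<omega>)\<^sup>2) + 2 * expectation (\<lambda>\<omega>. (h k \<omega>)\<^sup>2) \<le> B * (1 / real (Suc k))" for k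
  proof -
    define s where "s = real (Suc k)"
    have s: "s > 0" by (simp add: s_def)
    have "expectation (\<lambda>\<omega>. (mart w k \<omega>)\<^sup>2 * (w k \<omega>)\<^sup>2)
        \<le> expectation (\<lambda>\<omega>. (1 / s) * mart w k \<omega> ^ 4 + s * w k \<omega> ^ 4)"
    proof (rule integral_mono)
      fix \<omega>
      have gen: "x\<^sup>2 * y\<^sup>2 \<le> (1 / s) * x ^ 4 + s * y ^ 4" for x y :: real
      proof -
        have "0 \<le> (x\<^sup>2 - s * y\<^sup>2)\<^sup>2" by simp
        then have "2 * (s * (x\<^sup>2 * y\<^sup>2)) \<le> (x\<^sup>2)\<^sup>2 + (s * y\<^sup>2)\<^sup>2"
          by (simp add: power2_diff mult_ac)
        moreover have "0 \<le> s * (x\<^sup>2 * y\<^sup>2)" using s by simp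
        ultimately have "s * (x\<^sup>2 * y\<^sup>2) \<le> (x\<^sup>2)\<^sup>2 + (s * y\<^sup>2)\<^sup>2" by linarith
        also have "\<dots> = s * ((1 / s) * x ^ 4 + s * y ^ 4)"
          using s by (simp add: power_mult_distrib distrib_left power2_eq_square power4_eq_xxxx)
        finally show ?thesis using s by (simp only: mult_le_cancel_left_pos)
      qed
      show "(mart w k \<omega>)\<^sup>2 * (w k \<omega>)\<^sup>2 \<le> (1 / s) * mart w k \<omega> ^ 4 + s * w k \<omega> ^ 4" by (rule gen)
    qed (intro integrable_mult_right Bochner_Integration.integrable_add L4_products(2)[OF mL w(2)]
        L4_integrable[OF w(2)] L4_integrable[OF mL])+
    also have "\<dots> = (1 / s) * expectation (\<lambda>\<omega>. mart w k \<omega> ^ 4) + s * expectation (\<lambda>\<omega>. w k \<omega> ^ 4)"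
      using L4_integrable[OF mL] L4_integrable[OF w(2)] by simp
    also have "\<dots> \<le> (1 / s) * (D * s\<^sup>2) + s * C"
    proof (intro add_mono mult_left_mono C)
      have "D * (real k)\<^sup>2 \<le> D * s\<^sup>2" using D(1) by (intro mult_left_mono power_mono) (auto simp: s_def)
      then show "expectation (\<lambda>\<omega>. mart w k \<omega> ^ 4) \<le> D * s\<^sup>2" using D(2)[of k] by linarith
    qed (use s in auto)
    also have "\<dots> = s * (D + C)" using s by (simp add: power2_eq_square algebra_simps)
    finally have 1: "expectation (\<lambda>\<omega>. (mart w k \<omega>)\<^sup>2 * (w k \<omega>)\<^sup>2) \<le> s * (D + C)" .
    have "expectation (\<lambda>\<omega>. (f k \<omega>)\<^sup>2) + 2 * expectation (\<lambda>\<omega>. (h k \<omega>)\<^sup>2)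
        = 4 / s\<^sup>2 * expectation (\<lambda>\<omega>. (mart w k \<omega>)\<^sup>2 * (w k \<omega>)\<^sup>2)
          + 2 * (1 / s\<^sup>2 * expectation (\<lambda>\<omega>. w k \<omega> ^ 4))"
      unfolding f2 h2 s_def by (simp only: integral_mult_right_zero)
    also have "\<dots> \<le> 4 / s\<^sup>2 * (s * (D + C)) + 2 * (1 / s\<^sup>2 * (s * C))"
    proof -
      have "C \<le> s * C" using C0 mult_right_mono[of 1 s C] by (simp add: s_def)
      then have "expectation (\<lambda>\<omega>. w k \<omega> ^ 4) \<le> s * C" using C[of k] by linarith
      then show ?thesis using 1 by (intro add_mono mult_left_mono) auto
    qed
    also have "\<dots> = B * (1 / s)" using s by (simp add: B_def field_simps power2_eq_square)
    finally show ?thesis by (simp add: s_def)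
  qed
  then have "expectation (\<lambda>\<omega>. (compens w n \<omega>)\<^sup>2) \<le> B * (\<Sum>k<n. 1 / real (Suc k))" for n
    using N[of n] by (simp only: sum_distrib_left) (intro sum_mono, simp)
  then show "\<exists>B\<ge>0. \<forall>n. expectation (\<lambda>\<omega>. (compens w n \<omega>)\<^sup>2) \<le> B * (\<Sum>k<n. 1 / real (Suc k))"
    using B by blast
qed

text \<open>Along \<open>n\<^sub>j = 2\<^bsup>(j+1)\<^sup>2\<^esup>\<close> the series of \<open>1 / ln n\<^sub>j\<close> converges, so Chebyshev bounds of order
  \<open>1 / ln n\<close> give almost sure convergence; and \<open>ln n\<^sub>j\<^sub>+\<^sub>1 / ln n\<^sub>j \<longrightarrow> 1\<close>, so monotonicity fills the gaps.\<close>

definition fast_index :: "nat \<Rightarrow> nat" where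
  "fast_index j = 2 ^ (Suc j)\<^sup>2"

lemma ln_fast_index: "ln (real (fast_index j)) = (real (Suc j))\<^sup>2 * ln 2"
  unfolding fast_index_def of_nat_power of_nat_numeral by (simp add: ln_realpow del: of_nat_Suc)

lemma fast_index_strict_mono: "strict_mono fast_index"
  by (rule strict_monoI) (simp add: fast_index_def power_strict_increasing power_strict_mono)

lemma summable_inverse_ln_fast_index: "summable (\<lambda>j. B / ln (real (fast_index j)))"
proof -
  have "summable (\<lambda>j. B / ln 2 * (1 / (real (Suc j))\<^sup>2))"
    using inverse_power_summable[of 2, where ?'a = real]
    by (intro summable_mult) (subst summable_Suc_iff, simp add: inverse_eq_divide)
  then show ?thesis by (simp add: ln_fast_index mult.commute del: of_nat_Suc)
qed

text \<open>The summand at \<open>k = 0\<close> is \<open>0 / 0 = 0\<close>.\<close>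

theorem quadratic_strong_law:
  assumes w: "\<And>i. w i \<in> borel_measurable (F i)" "\<And>i. L4 M (w i)"
    and C: "\<And>i. expectation (\<lambda>\<omega>. w i \<omega> ^ 4) \<le> C"
    and L: "AE \<omega> in M. (\<lambda>n. (\<Sum>k<n. (w k \<omega>)\<^sup>2) / real n) \<longlonglongrightarrow> L"
  shows "AE \<omega> in M. (\<lambda>n. (\<Sum>k<n. (mart w k \<omega> / real k)\<^sup>2) / ln (real n)) \<longlonglongrightarrow> L"
proof -
  let ?l = "\<lambda>j. ln (real (fast_index j))"
  have lpos: "?l j > 0" for j by (simp add: ln_fast_index del: of_nat_Suc)
  have spos: "real (fast_index j) > 0" for j by (simp add: fast_index_def)
  obtain D where D: "D \<ge> 0" "\<And>n. expectation (\<lambda>\<omega>. mart w n \<omega> ^ 4) \<le> D * (real n)\<^sup>2"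
    using msum_fourth_moment[OF w C eps_id_moments] by blast
  have mL: "L4 M (mart w n)" for n by (rule msum_L4[OF w eps_id_moments(1,2)])
  obtain B where B: "B \<ge> 0"
    "\<And>n. expectation (\<lambda>\<omega>. (compens w n \<omega>)\<^sup>2) \<le> B * (\<Sum>k<n. 1 / real (Suc k))"
    using compens_second_moment(1)[OF w C] by blast
  \<comment> \<open>E m_n^2 / n is at most 1 + D by y \<le> 1 + y^2 and the fourth moment bound;
    division by ln n makes this summable along the nodes.\<close>
  have lim1: "AE \<omega> in M. (\<lambda>j. ((mart w (fast_index j) \<omega>)\<^sup>2 / real (fast_index j)) / ?l j) \<longlonglongrightarrow> 0"
  proof (rule AE_tendsto_0_if_summable_integral)
    show "integrable M (\<lambda>\<omega>. (mart w (fast_index j) \<omega>)\<^sup>2 / real (fast_index j) / ?l j)" for j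
      using L4_products(5)[OF mL mL] by simp
    show "0 \<le> (mart w (fast_index j) \<omega>)\<^sup>2 / real (fast_index j) / ?l j" for j \<omega>
      using lpos[of j] by simp
    show "summable (\<lambda>j. (1 + D) / ?l j)" by (rule summable_inverse_ln_fast_index)
    show "expectation (\<lambda>\<omega>. (mart w (fast_index j) \<omega>)\<^sup>2 / real (fast_index j) / ?l j) \<le> (1 + D) / ?l j" for j
    proof -
      define s where "s = real (fast_index j)"
      have s: "s > 0" unfolding s_def by (rule spos)
      have "expectation (\<lambda>\<omega>. (mart w (fast_index j) \<omega>)\<^sup>2 / s)
          \<le> expectation (\<lambda>\<omega>. 1 + mart w (fast_index j) \<omega> ^ 4 / s\<^sup>2)"
      proof (rule integral_mono)
        fix \<omega>
        have gen: "x\<^sup>2 / s \<le> 1 + x ^ 4 / s\<^sup>2" for x :: real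
        proof -
          have "(x\<^sup>2 / s)\<^sup>2 = x ^ 4 / s\<^sup>2" by (simp add: power_divide)
          moreover have "y \<le> 1 + y\<^sup>2" for y :: real
            using sum_squares_bound[of 1 y] by (cases "y \<ge> 0") (auto intro: order_trans[of y 0])
          ultimately show ?thesis by metis
        qed
        show "(mart w (fast_index j) \<omega>)\<^sup>2 / s \<le> 1 + mart w (fast_index j) \<omega> ^ 4 / s\<^sup>2" by (rule gen)
      qed (use L4_products(5)[OF mL mL] L4_integrable[OF mL] in auto)
      also have "\<dots> = 1 + expectation (\<lambda>\<omega>. mart w (fast_index j) \<omega> ^ 4) / s\<^sup>2"
        using L4_integrable[OF mL] by (simp add: prob_space)
      also have "\<dots> \<le> 1 + D * s\<^sup>2 / s\<^sup>2"
        unfolding s_def by (intro add_left_mono divide_right_mono D) auto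
      also have "\<dots> = 1 + D" using s by simp
      finally have "expectation (\<lambda>\<omega>. (mart w (fast_index j) \<omega>)\<^sup>2 / s) / ?l j \<le> (1 + D) / ?l j"
        using lpos[of j] by (intro divide_right_mono) auto
      then show ?thesis by (simp add: s_def)
    qed
  qed
  have "\<forall>\<^sub>F n in sequentially. (\<Sum>k<n. 1 / real (Suc k)) / ln (real n) < 2"
    by (rule order_tendstoD(2)[OF harmonic_over_ln]) simp
  \<comment> \<open>From here on the harmonic sum is below 2 ln n, so the second moment of
    \<open>compens\<close> divided by ln n is at most 2B / ln n.\<close>
  then obtain J where J: "\<And>n. n \<ge> J \<Longrightarrow> (\<Sum>k<n. 1 / real (Suc k)) / ln (real n) < 2"
    by (auto simp: eventually_sequentially)
  have "AE \<omega> in M. (\<lambda>j. (compens w (fast_index j) \<omega> / ?l j)\<^sup>2) \<longlonglongrightarrow> 0"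
  proof (rule AE_tendsto_0_if_summable_integral)
    show "integrable M (\<lambda>\<omega>. (compens w (fast_index j) \<omega> / ?l j)\<^sup>2)" for j
      using compens_second_moment(2)[OF w C] by (simp add: power_divide)
    show "summable (\<lambda>j. (2 * B) / ?l j)" by (rule summable_inverse_ln_fast_index)
    show "expectation (\<lambda>\<omega>. (compens w (fast_index j) \<omega> / ?l j)\<^sup>2) \<le> (2 * B) / ?l j" if "j \<ge> J" for j
    proof -
      have "fast_index j \<ge> J" using seq_suble[OF fast_index_strict_mono, of j] that by simp
      then have "(\<Sum>k<fast_index j. 1 / real (Suc k)) / ?l j \<le> 2" using J less_imp_le by blast
      then have h: "(\<Sum>k<fast_index j. 1 / real (Suc k)) \<le> 2 * ?l j" using lpos[of j] by (simp add: field_simps)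
      have "expectation (\<lambda>\<omega>. (compens w (fast_index j) \<omega> / ?l j)\<^sup>2)
          = expectation (\<lambda>\<omega>. (compens w (fast_index j) \<omega>)\<^sup>2) / (?l j)\<^sup>2"
        by (simp add: power_divide)
      also have "\<dots> \<le> B * (2 * ?l j) / (?l j)\<^sup>2"
        by (intro divide_right_mono order_trans[OF B(2)] mult_left_mono h B(1)) simp
      also have "\<dots> = (2 * B) / ?l j" using lpos[of j] by (simp add: power2_eq_square)
      finally show ?thesis .
    qed
  qed simp
  then have lim2: "AE \<omega> in M. (\<lambda>j. compens w (fast_index j) \<omega> / ?l j) \<longlonglongrightarrow> 0"
    by eventually_elim (simp only: power_tendsto_0_iff zero_less_numeral)
  show ?thesis
    using lim1 lim2 L
  proof eventually_elim
    case (elim \<omega>)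
    define T where "T n = (\<Sum>k<n. (mart w k \<omega>)\<^sup>2 / (real k * real (Suc k)))" for n
    have "(\<lambda>n. (\<Sum>k<n. (w k \<omega>)\<^sup>2 / real (Suc k)) / ln (real n)) \<longlonglongrightarrow> L"
      by (rule log_average[OF elim(3)])
    then have lim3: "(\<lambda>j. (\<Sum>k<fast_index j. (w k \<omega>)\<^sup>2 / real (Suc k)) / ?l j) \<longlonglongrightarrow> L"
      using LIMSEQ_subseq_LIMSEQ[OF _ fast_index_strict_mono] by (fastforce simp: comp_def)
    \<comment> \<open>Only \<open>T\<close> is monotone, so the interpolation is applied to it
      alone; its values at the nodes come from the square identity.\<close>
    have "(\<lambda>n. T n / ln (real n)) \<longlonglongrightarrow> L"
    proof (rule mono_interpolation[where g = fast_index])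
      show "mono T" by (rule incseq_SucI) (simp add: T_def)
      show "T n \<ge> 0" for n by (simp add: T_def sum_nonneg)
      show "mono (\<lambda>n. ln (real n))"
      proof (rule monoI)
        fix x y :: nat assume "x \<le> y"
        then show "ln (real x) \<le> ln (real y)" by (cases "x = 0"; cases "y = 0") auto
      qed
      have "(\<lambda>j. (real (Suc (Suc j)) / real (Suc j))\<^sup>2) \<longlonglongrightarrow> 1\<^sup>2"
        by (intro tendsto_power LIMSEQ_Suc[OF LIMSEQ_Suc_n_over_n])
      then show "(\<lambda>j. ?l (Suc j) / ?l j) \<longlonglongrightarrow> 1"
        by (simp add: ln_fast_index power_divide del: of_nat_Suc)
      have "(\<lambda>j. compens w (fast_index j) \<omega> / ?l j + (\<Sum>k<fast_index j. (w k \<omega>)\<^sup>2 / real (Suc k)) / ?l j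
          - ((mart w (fast_index j) \<omega>)\<^sup>2 / real (fast_index j)) / ?l j) \<longlonglongrightarrow> 0 + L - 0"
        by (intro tendsto_intros elim lim3)
      moreover have "T n = compens w n \<omega> + (\<Sum>k<n. (w k \<omega>)\<^sup>2 / real (Suc k)) - (mart w n \<omega>)\<^sup>2 / real n" for n
        using mart_square_decomposition[of w n \<omega>] by (simp add: T_def)
      ultimately show "(\<lambda>j. T (fast_index j) / ?l j) \<longlonglongrightarrow> L"
        by (simp add: add_divide_distrib diff_divide_distrib)
    qed (use lpos fast_index_strict_mono in auto)
    \<comment> \<open>Passage from the weights 1 / (k (k + 1)) to 1 / k^2: the correcting factor (k
      + 1) / k tends to 1.\<close>
    then have "(\<lambda>n. (\<Sum>k<n. (real (Suc k) / real k) * ((mart w k \<omega>)\<^sup>2 / (real k * real (Suc k)))) / ln (real n))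
        \<longlonglongrightarrow> 1 * L"
      unfolding T_def
      by (rule weighted_average_nonneg[OF ln_real_at_top _ _ LIMSEQ_Suc_n_over_n]) simp
    moreover have "(real (Suc k) / real k) * ((mart w k \<omega>)\<^sup>2 / (real k * real (Suc k)))
        = (mart w k \<omega> / real k)\<^sup>2" for k
      by (simp add: power_divide power2_eq_square del: of_nat_Suc)
    ultimately show ?case by (simp only: mult_1_left)
  qed
qed

end

subsection \<open>Moment bounds for the filtered autoregression\<close>

text \<open>Convexity of the fourth power with weights \<open>l\<close> and 1 - \<open>l\<close>. If
  \<open>l\<close> is the contraction factor, (l a)^4 / l^3 = l a^4, so the contraction survives the
  fourth power.\<close>

lemma weighted_quartic:
  fixes a b l :: real
  assumes l: "0 < l" "l < 1"
  shows "(a + b) ^ 4 \<le> a ^ 4 / l ^ 3 + b ^ 4 / (1 - l) ^ 3"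
proof -
  have sq: "(x + y)\<^sup>2 \<le> x\<^sup>2 / l + y\<^sup>2 / (1 - l)" for x y :: real
  proof -
    have "0 \<le> ((1 - l) * x - l * y)\<^sup>2 / (l * (1 - l))" using l by simp
    also have "\<dots> = x\<^sup>2 / l + y\<^sup>2 / (1 - l) - (x + y)\<^sup>2"
      using l by (simp add: divide_simps power2_eq_square) (simp add: algebra_simps)
    finally show ?thesis by simp
  qed
  have "(a + b) ^ 4 = ((a + b)\<^sup>2)\<^sup>2" by simp
  also have "\<dots> \<le> (a\<^sup>2 / l + b\<^sup>2 / (1 - l))\<^sup>2"
    using sq[of a b] by (intro power_mono) auto
  also have "\<dots> \<le> (a\<^sup>2 / l)\<^sup>2 / l + (b\<^sup>2 / (1 - l))\<^sup>2 / (1 - l)" by (rule sq)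
  also have "\<dots> = a ^ 4 / l ^ 3 + b ^ 4 / (1 - l) ^ 3"
    by (simp add: power_divide power3_eq_cube power2_eq_square power4_eq_xxxx mult_ac)
  finally show ?thesis .
qed

text \<open>The step may depend on a bound for all earlier values and not just on the previous one,
  since the accumulated sum involves the whole past. The bound is the fixed point D / (1 - q), or
  the total of the initial values if that is larger.\<close>

lemma bounded_if_contracting:
  fixes y :: "nat \<Rightarrow> real"
  assumes q: "0 \<le> q" "q < 1" and D: "D \<ge> 0" and pos: "\<And>n. y n \<ge> 0"
    and step: "\<And>n Y. n \<ge> N \<Longrightarrow> (\<And>j. j \<le> n \<Longrightarrow> y j \<le> Y) \<Longrightarrow> y (Suc n) \<le> q * Y + D"
  shows "\<exists>C. \<forall>n. y n \<le> C"
proof -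
  define C where "C = max (\<Sum>j\<le>N. y j) (D / (1 - q))"
  have "D \<le> (1 - q) * C"
  proof -
    have "D / (1 - q) \<le> C" by (simp add: C_def)
    then show ?thesis using q by (simp add: field_simps)
  qed
  then have qC: "q * C + D \<le> C" by (simp add: algebra_simps)
  have "y n \<le> C" for n
  proof (induction n rule: less_induct)
    case (less n)
    show ?case
    proof (cases "n \<le> N")
      case True
      then have "y n \<le> (\<Sum>j\<le>N. y j)" using pos by (intro member_le_sum) auto
      then show ?thesis by (simp add: C_def)
    next
      case False
      then obtain m where m: "n = Suc m" "m \<ge> N" by (cases n) auto
      have "y (Suc m) \<le> q * C + D" using less m by (intro step) auto
      then show ?thesis using m qC by simp
    qed
  qed
  then show ?thesis by blast
qed

lemma sum_square_le:
  fixes f :: "nat \<Rightarrow> real"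
  shows "(\<Sum>j<n. f j)\<^sup>2 \<le> real n * (\<Sum>j<n. (f j)\<^sup>2)"
  using Cauchy_Schwarz_ineq_sum[of "\<lambda>_. 1" f "{..<n}"] by simp

text \<open>The covariance structure of the noise is visible here only through
  \<open>\<sigma>\<close> and \<open>\<beta>\<close>: the variance recursion and the decay. Both are
  derived for the actual process later.\<close>

locale ar_noise = gaussian_noise M \<epsilon> + stable_matrix A p c r
  for M :: "'a measure" and \<epsilon> and A p c r +
  fixes \<sigma> \<beta> :: "nat \<Rightarrow> real" and H \<alpha> :: real
  assumes sig_pos: "\<And>n. n \<ge> 1 \<Longrightarrow> \<sigma> n > 0" and sig_1: "\<sigma> 1 = 1"
    and sig_Suc: "\<And>n. n \<ge> 1 \<Longrightarrow> (\<sigma> (Suc n))\<^sup>2 = (\<sigma> n)\<^sup>2 * (1 - (\<beta> n)\<^sup>2)"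
    and alpha: "\<alpha> > 1" and beta: "\<And>n. n \<ge> 1 \<Longrightarrow> (\<beta> n)\<^sup>2 \<le> H * real n powr (- \<alpha>)"
begin

text \<open>The two components are \<open>Z\<^sub>n\<close> and \<open>S\<^sub>n = \<Sum>\<^sub>j\<^sub><\<^sub>n \<beta>\<^sub>j Z\<^sub>j\<close>, the two blocks of the vector \<open>zeta\<close>, expressed through
  the innovations alone.\<close>

primrec ZS :: "nat \<Rightarrow> 'a \<Rightarrow> (nat \<Rightarrow> real) \<times> (nat \<Rightarrow> real)" where
  "ZS 0 \<omega> = (\<lambda>_. 0, \<lambda>_. 0)"
| "ZS (Suc n) \<omega> =
    (\<lambda>i. mv (\<lambda>j. fst (ZS n \<omega>) j + \<beta> n * snd (ZS n \<omega>) j) i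
      + (if i = 0 then \<sigma> (Suc n) * \<epsilon> (Suc n) \<omega> else 0),
     \<lambda>i. snd (ZS n \<omega>) i + \<beta> n * fst (ZS n \<omega>) i)"

definition Z :: "nat \<Rightarrow> 'a \<Rightarrow> nat \<Rightarrow> real" where "Z n \<omega> = fst (ZS n \<omega>)"
definition S :: "nat \<Rightarrow> 'a \<Rightarrow> nat \<Rightarrow> real" where "S n \<omega> = snd (ZS n \<omega>)"
definition U :: "nat \<Rightarrow> 'a \<Rightarrow> nat \<Rightarrow> real" where "U n \<omega> i = Z n \<omega> i + \<beta> n * S n \<omega> i"
definition u :: "nat \<Rightarrow> nat \<Rightarrow> 'a \<Rightarrow> real" where "u i n \<omega> = U n \<omega> i / \<sigma> (Suc n)"

lemma Z_0: "Z 0 \<omega> i = 0" and S_0: "S 0 \<omega> i = 0" and U_0: "U 0 \<omega> i = 0"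
  by (simp_all add: Z_def S_def U_def)

lemma Z_Suc: "Z (Suc n) \<omega> i = mv (U n \<omega>) i + (if i = 0 then \<sigma> (Suc n) * \<epsilon> (Suc n) \<omega> else 0)"
  by (simp add: Z_def U_def S_def mv_def)

lemma S_Suc: "S (Suc n) \<omega> i = S n \<omega> i + \<beta> n * Z n \<omega> i"
  by (simp add: Z_def S_def)

lemma S_sum: "S n \<omega> i = (\<Sum>j<n. \<beta> j * Z j \<omega> i)"
  by (induction n) (simp_all add: S_0 S_Suc)

lemma ZS_adapted:
  "\<forall>i. (\<lambda>\<omega>. Z n \<omega> i) \<in> borel_measurable (F n) \<and> L4 M (\<lambda>\<omega>. Z n \<omega> i)
    \<and> (\<lambda>\<omega>. S n \<omega> i) \<in> borel_measurable (F n) \<and> L4 M (\<lambda>\<omega>. S n \<omega> i)"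
proof (induction n)
  case 0
  show ?case by (simp add: Z_0 S_0 L4_zero)
next
  case (Suc n)
  have ZF: "(\<lambda>\<omega>. Z n \<omega> i) \<in> borel_measurable (F (Suc n))"
    and SF: "(\<lambda>\<omega>. S n \<omega> i) \<in> borel_measurable (F (Suc n))" for i
    using Suc F_mono[of n "Suc n"] by auto
  have ZL: "L4 M (\<lambda>\<omega>. Z n \<omega> i)" and SL: "L4 M (\<lambda>\<omega>. S n \<omega> i)" for i using Suc by auto
  have eF: "\<epsilon> (Suc n) \<in> borel_measurable (F (Suc n))" by (rule eps_F) auto
  have eL: "L4 M (\<epsilon> (Suc n))" by (rule eps_L4) simp
  have UF: "(\<lambda>\<omega>. U n \<omega> i) \<in> borel_measurable (F (Suc n))" for i
    unfolding U_def using ZF[of i] SF[of i] by measurable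
  have UL: "L4 M (\<lambda>\<omega>. U n \<omega> i)" for i
    unfolding U_def by (rule L4_add[OF ZL L4_cmult[OF SL]])
  have "(\<lambda>\<omega>. Z (Suc n) \<omega> i) \<in> borel_measurable (F (Suc n))" for i
    unfolding Z_Suc mv_def using eF
    by (intro borel_measurable_add borel_measurable_sum borel_measurable_times borel_measurable_const UF)
      (cases "i = 0"; simp)
  moreover have "L4 M (\<lambda>\<omega>. Z (Suc n) \<omega> i)" for i
    unfolding Z_Suc mv_def
    by (rule L4_add[OF L4_sum[OF L4_cmult[OF UL]]])
      (cases "i = 0"; simp add: L4_zero L4_cmult eL)
  moreover have "(\<lambda>\<omega>. S (Suc n) \<omega> i) \<in> borel_measurable (F (Suc n))" for i
    unfolding S_Suc using ZF[of i] SF[of i] by measurable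
  moreover have "L4 M (\<lambda>\<omega>. S (Suc n) \<omega> i)" for i
    unfolding S_Suc by (rule L4_add[OF SL L4_cmult[OF ZL]])
  ultimately show ?case by blast
qed

lemma Z_F: "(\<lambda>\<omega>. Z n \<omega> i) \<in> borel_measurable (F n)" and Z_L4: "L4 M (\<lambda>\<omega>. Z n \<omega> i)"
  and S_F: "(\<lambda>\<omega>. S n \<omega> i) \<in> borel_measurable (F n)" and S_L4: "L4 M (\<lambda>\<omega>. S n \<omega> i)"
  using ZS_adapted by blast+

lemma U_F: "(\<lambda>\<omega>. U n \<omega> i) \<in> borel_measurable (F n)"
  unfolding U_def using Z_F S_F by measurable

lemma U_L4: "L4 M (\<lambda>\<omega>. U n \<omega> i)"
  unfolding U_def by (rule L4_add[OF Z_L4 L4_cmult[OF S_L4]])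

lemma u_F: "u i n \<in> borel_measurable (F n)"
  unfolding u_def using U_F by measurable

lemma u_L4: "L4 M (u i n)"
  using L4_cmult[OF U_L4, of "1 / \<sigma> (Suc n)" n i] by (simp add: u_def[abs_def])

section \<open>Decay of \<beta> and bounds for \<sigma>\<close>

lemma beta_less_1: "n \<ge> 1 \<Longrightarrow> (\<beta> n)\<^sup>2 < 1"
proof -
  assume n: "n \<ge> 1"
  have "0 < (\<sigma> n)\<^sup>2 * (1 - (\<beta> n)\<^sup>2)"
    using sig_Suc[OF n] sig_pos[of "Suc n"] by (metis le_add1 plus_1_eq_Suc zero_less_power)
  then show ?thesis using sig_pos[OF n] by (simp add: zero_less_mult_iff)
qed

lemma H_nonneg: "H \<ge> 0"
  using beta[of 1] order_trans[OF zero_le_power2[of "\<beta> 1"]] by simp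

lemma beta_summable: "summable (\<lambda>n. (\<beta> n)\<^sup>2)"
proof (rule summable_comparison_test')
  show "summable (\<lambda>n. H * real n powr (- \<alpha>))"
    using alpha by (intro summable_mult) (simp add: summable_real_powr_iff)
  show "norm ((\<beta> n)\<^sup>2) \<le> H * real n powr (- \<alpha>)" if "n \<ge> 1" for n using beta[OF that] by simp
qed

definition bsum :: real where "bsum = (\<Sum>n. (\<beta> n)\<^sup>2)"

lemma bsum: "(\<Sum>j<n. (\<beta> j)\<^sup>2) \<le> bsum" "bsum \<ge> 0"
  unfolding bsum_def
  by (auto intro!: sum_le_suminf suminf_nonneg beta_summable)

lemma beta_n: "n \<ge> 1 \<Longrightarrow> (\<beta> n)\<^sup>2 * real n \<le> H * real n powr (1 - \<alpha>)"
proof -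
  assume n: "n \<ge> 1"
  have "(\<beta> n)\<^sup>2 * real n \<le> H * real n powr (- \<alpha>) * real n"
    by (rule mult_right_mono[OF beta[OF n]]) simp
  also have "real n powr (1 - \<alpha>) = real n powr (- \<alpha>) * real n"
    using n powr_add[of "real n" "- \<alpha>" 1] by simp
  then have "H * real n powr (- \<alpha>) * real n = H * real n powr (1 - \<alpha>)" by simp
  finally show ?thesis .
qed

lemma beta_n_le: "(\<beta> n)\<^sup>2 * real n \<le> H"
proof (cases "n = 0")
  case False
  then have n: "n \<ge> 1" by simp
  have "real n powr (1 - \<alpha>) \<le> real n powr 0" using n alpha by (intro powr_mono) auto
  then have "H * real n powr (1 - \<alpha>) \<le> H * 1" using n H_nonneg by (intro mult_left_mono) auto
  then show ?thesis using beta_n[OF n] by linarith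
qed (use H_nonneg in simp)

lemma beta_n_lim: "(\<lambda>n. (\<beta> n)\<^sup>2 * real n) \<longlonglongrightarrow> 0"
proof (rule Lim_null_comparison)
  show "\<forall>\<^sub>F n in sequentially. norm ((\<beta> n)\<^sup>2 * real n) \<le> H * real n powr (1 - \<alpha>)"
    using eventually_ge_at_top[of 1] by eventually_elim (use beta_n in simp)
  have "(\<lambda>n. real n powr (1 - \<alpha>)) \<longlonglongrightarrow> 0"
    by (rule tendsto_neg_powr[OF _ filterlim_real_sequentially]) (use alpha in simp)
  from tendsto_mult_left[OF this, of H] show "(\<lambda>n. H * real n powr (1 - \<alpha>)) \<longlonglongrightarrow> 0" by simp
qed

lemma sig_le_1: "n \<ge> 1 \<Longrightarrow> \<sigma> n \<le> 1"
proof (induction n rule: dec_induct)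
  case (step n)
  have "(\<sigma> (Suc n))\<^sup>2 \<le> (\<sigma> n)\<^sup>2"
    unfolding sig_Suc[OF step(1)] by (simp add: mult_left_le)
  then have "\<sigma> (Suc n) \<le> \<sigma> n"
    by (rule power2_le_imp_le[OF _ less_imp_le[OF sig_pos[OF step(1)]]])
  then show ?case using step.IH by (rule order_trans)
qed (simp only: sig_1 order_refl)

text \<open>Over a tail the product of the 1 - beta_n^2 is at least 1 minus the sum of the beta_n^2.
  Once that sum is at most 1/2, the standard deviation cannot fall below half its value at the start
  of the tail.\<close>

lemma sig_lower: "\<exists>s>0. \<forall>n\<ge>1. s \<le> \<sigma> n"
proof -
  have "\<forall>\<^sub>F N in sequentially. norm (\<Sum>n. (\<beta> (n + N))\<^sup>2) < 1 / 2"
    using suminf_exist_split[OF _ beta_summable, of "1 / 2"] by (auto simp: eventually_sequentially)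
  then obtain N0 where N0: "\<And>N. N \<ge> N0 \<Longrightarrow> norm (\<Sum>n. (\<beta> (n + N))\<^sup>2) < 1 / 2"
    by (auto simp: eventually_sequentially)
  define N where "N = max N0 1"
  have N: "norm (\<Sum>n. (\<beta> (n + N))\<^sup>2) < 1 / 2" "N \<ge> 1" using N0[of N] by (auto simp: N_def)
  have low: "(\<sigma> (k + N))\<^sup>2 \<ge> (\<sigma> N)\<^sup>2 * (1 - (\<Sum>n<k. (\<beta> (n + N))\<^sup>2))" for k
  proof (induction k)
    case (Suc k)
    let ?s = "\<Sum>n<k. (\<beta> (n + N))\<^sup>2" and ?b = "(\<beta> (k + N))\<^sup>2"
    have b: "0 \<le> ?b" "?b \<le> 1" using beta_less_1[of "k + N"] N(2) by auto
    have "0 \<le> ?s" by (simp add: sum_nonneg)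
    then have "0 \<le> ?s * ?b" using b by simp
    then have "1 - (?s + ?b) \<le> (1 - ?s) * (1 - ?b)" by (simp add: algebra_simps)
    then have "(\<sigma> N)\<^sup>2 * (1 - (?s + ?b)) \<le> (\<sigma> N)\<^sup>2 * ((1 - ?s) * (1 - ?b))"
      by (rule mult_left_mono) simp
    also have "\<dots> = ((\<sigma> N)\<^sup>2 * (1 - ?s)) * (1 - ?b)" by (simp add: mult.assoc)
    also have "\<dots> \<le> (\<sigma> (k + N))\<^sup>2 * (1 - ?b)" using Suc b by (intro mult_right_mono) auto
    also have "\<dots> = (\<sigma> (Suc k + N))\<^sup>2" using sig_Suc[of "k + N"] N(2) by simp
    finally show ?case by simp
  qed simp
  define s where "s = \<sigma> N / 2"
  have sN: "\<sigma> N > 0" using sig_pos N(2) by simp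
  have tail: "s \<le> \<sigma> (k + N)" for k
  proof -
    have "(\<Sum>n<k. (\<beta> (n + N))\<^sup>2) \<le> (\<Sum>n. (\<beta> (n + N))\<^sup>2)"
      by (rule sum_le_suminf) (simp_all add: summable_ignore_initial_segment[OF beta_summable])
    also have "\<dots> \<le> 1 / 2" using N(1) by simp
    finally have "(\<sigma> N)\<^sup>2 * (1 / 2) \<le> (\<sigma> N)\<^sup>2 * (1 - (\<Sum>n<k. (\<beta> (n + N))\<^sup>2))"
      by (intro mult_left_mono) auto
    then have "(\<sigma> N)\<^sup>2 * (1 / 2) \<le> (\<sigma> (k + N))\<^sup>2" using low[of k] by linarith
    moreover have "s\<^sup>2 \<le> (\<sigma> N)\<^sup>2 * (1 / 2)" by (simp add: s_def power_divide)
    ultimately have "s\<^sup>2 \<le> (\<sigma> (k + N))\<^sup>2" by linarith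
    moreover have "0 \<le> \<sigma> (k + N)" using sig_pos[of "k + N"] N(2) by simp
    ultimately show ?thesis by (rule power2_le_imp_le)
  qed
  define s' where "s' = Min (insert s (\<sigma> ` {1..N}))"
  have "s' > 0" unfolding s'_def using sN sig_pos by (subst Min_gr_iff) (auto simp: s_def)
  moreover have "s' \<le> \<sigma> n" if "n \<ge> 1" for n
  proof (cases "n \<le> N")
    case True
    then show ?thesis unfolding s'_def using that by (intro Min_le) auto
  next
    case False
    have "s' \<le> s" unfolding s'_def by (intro Min_le) auto
    also have "s \<le> \<sigma> n" using tail[of "n - N"] False by simp
    finally show ?thesis .
  qed
  ultimately show ?thesis by blast
qed


section \<open>Uniform fourth moment bounds\<close>

lemma anorm_L4:
  assumes "\<And>i. i < p \<Longrightarrow> L4 M (X i)"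
  shows "L4 M (\<lambda>\<omega>. anorm (\<lambda>i. X i \<omega>))"
proof -
  have abs: "L4 M (\<lambda>\<omega>. \<bar>f \<omega>\<bar>)" if "L4 M f" for f
    using that by (auto simp: L4_def intro: borel_measurable_abs)
  show ?thesis
    unfolding anorm_def step_norm_def
    by (intro L4_sum[OF L4_cmult] L4_sum[OF abs] L4_sum[OF L4_cmult] L4_cmult assms abs) auto
qed

lemma anorm_zero: "anorm (\<lambda>i. 0) = 0"
  using anorm_scale[of 0 "\<lambda>i. 0"] by simp

text \<open>One application of Cauchy--Schwarz pairs the norms with the square-summable
  \<open>\<beta>\<close>; the fourth power needs a second one against the constant sequence, which
  costs the factor \<open>n\<close>.\<close>

lemma anorm_S: "anorm (S n \<omega>) ^ 4 \<le> bsum\<^sup>2 * real n * (\<Sum>j<n. anorm (Z j \<omega>) ^ 4)"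
  and anorm_S2: "(anorm (S n \<omega>))\<^sup>2 \<le> bsum * (\<Sum>j<n. (anorm (Z j \<omega>))\<^sup>2)"
proof -
  have le: "anorm (S n \<omega>) \<le> (\<Sum>j<n. \<bar>\<beta> j\<bar> * anorm (Z j \<omega>))"
  proof (induction n)
    case 0
    have "anorm (S 0 \<omega>) = anorm (\<lambda>i. 0)" by (rule anorm_cong) (simp add: S_0)
    then show ?case by (simp add: anorm_zero)
  next
    case (Suc n)
    have "anorm (S (Suc n) \<omega>) = anorm (\<lambda>i. S n \<omega> i + \<beta> n * Z n \<omega> i)"
      by (rule anorm_cong) (rule S_Suc)
    also have "\<dots> \<le> anorm (S n \<omega>) + \<bar>\<beta> n\<bar> * anorm (Z n \<omega>)"
      using anorm_add[of "S n \<omega>" "\<lambda>i. \<beta> n * Z n \<omega> i"] anorm_scale[of "\<beta> n" "Z n \<omega>"] by simp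
    finally show ?case using Suc by simp
  qed
  have "(anorm (S n \<omega>))\<^sup>2 \<le> (\<Sum>j<n. \<bar>\<beta> j\<bar> * anorm (Z j \<omega>))\<^sup>2"
    by (rule power_mono[OF le anorm_nonneg])
  also have "\<dots> \<le> (\<Sum>j<n. \<bar>\<beta> j\<bar>\<^sup>2) * (\<Sum>j<n. (anorm (Z j \<omega>))\<^sup>2)"
    by (rule Cauchy_Schwarz_ineq_sum)
  also have "\<dots> \<le> bsum * (\<Sum>j<n. (anorm (Z j \<omega>))\<^sup>2)"
    using bsum(1)[of n] by (intro mult_right_mono sum_nonneg) auto
  finally show 2: "(anorm (S n \<omega>))\<^sup>2 \<le> bsum * (\<Sum>j<n. (anorm (Z j \<omega>))\<^sup>2)" .
  have "anorm (S n \<omega>) ^ 4 = ((anorm (S n \<omega>))\<^sup>2)\<^sup>2" by simp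
  also have "\<dots> \<le> (bsum * (\<Sum>j<n. (anorm (Z j \<omega>))\<^sup>2))\<^sup>2"
    by (rule power_mono[OF 2]) simp
  also have "\<dots> = bsum\<^sup>2 * (\<Sum>j<n. (anorm (Z j \<omega>))\<^sup>2)\<^sup>2" by (simp add: power_mult_distrib)
  also have "\<dots> \<le> bsum\<^sup>2 * (real n * (\<Sum>j<n. ((anorm (Z j \<omega>))\<^sup>2)\<^sup>2))"
    by (intro mult_left_mono sum_square_le) simp
  finally show "anorm (S n \<omega>) ^ 4 \<le> bsum\<^sup>2 * real n * (\<Sum>j<n. anorm (Z j \<omega>) ^ 4)"
    by (simp add: mult.assoc)
qed

text \<open>The triangle inequality for the contracted norm is raised to the fourth power with
  weight \<open>rate\<close>. \<open>K\<close> combines the factor (1 - rate)^(-3) of that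
  inequality with the 8 from splitting a fourth power of a sum.\<close>

lemma Z_fourth_moment_step:
  fixes K nb :: real
  defines "K \<equiv> 8 / (1 - rate) ^ 3" and "nb \<equiv> anorm (\<lambda>i. if i = 0 then 1 else 0)"
  shows "anorm (Z (Suc n) \<omega>) ^ 4 \<le> rate * anorm (Z n \<omega>) ^ 4
    + K * ((\<beta> n) ^ 4 * anorm (S n \<omega>) ^ 4 + nb ^ 4 * \<epsilon> (Suc n) \<omega> ^ 4)"
proof -
  let ?a = "anorm (Z n \<omega>)" and ?s = "anorm (S n \<omega>)" and ?e = "\<epsilon> (Suc n) \<omega>"
  have nb: "nb \<ge> 0" unfolding nb_def by (rule anorm_nonneg)
  have "anorm (Z (Suc n) \<omega>)
      = anorm (\<lambda>i. mv (U n \<omega>) i + (\<sigma> (Suc n) * ?e) * (if i = 0 then 1 else 0))"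
    by (rule anorm_cong) (simp add: Z_Suc)
  also have "\<dots> \<le> anorm (mv (U n \<omega>)) + \<bar>\<sigma> (Suc n) * ?e\<bar> * nb"
    using anorm_add[of "mv (U n \<omega>)" "\<lambda>i. (\<sigma> (Suc n) * ?e) * (if i = 0 then 1 else 0)"]
      anorm_scale[of "\<sigma> (Suc n) * ?e" "\<lambda>i. if i = 0 then 1 else 0"]
    unfolding nb_def by argo
  also have "\<dots> \<le> rate * (?a + \<bar>\<beta> n\<bar> * ?s) + \<bar>?e\<bar> * nb"
  proof (rule add_mono)
    have "anorm (U n \<omega>) = anorm (\<lambda>i. Z n \<omega> i + \<beta> n * S n \<omega> i)"
      by (rule anorm_cong) (simp add: U_def)
    also have "\<dots> \<le> ?a + \<bar>\<beta> n\<bar> * ?s"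
      using anorm_add[of "Z n \<omega>" "\<lambda>i. \<beta> n * S n \<omega> i"] anorm_scale[of "\<beta> n" "S n \<omega>"] by simp
    finally have "rate * anorm (U n \<omega>) \<le> rate * (?a + \<bar>\<beta> n\<bar> * ?s)"
      using rate by (intro mult_left_mono) auto
    then show "anorm (mv (U n \<omega>)) \<le> rate * (?a + \<bar>\<beta> n\<bar> * ?s)"
      using anorm_mv[of "U n \<omega>"] by linarith
    have "\<bar>\<sigma> (Suc n)\<bar> \<le> 1" using sig_le_1[of "Suc n"] sig_pos[of "Suc n"] by simp
    then have "\<bar>\<sigma> (Suc n) * ?e\<bar> \<le> 1 * \<bar>?e\<bar>" unfolding abs_mult by (rule mult_right_mono) simp
    then show "\<bar>\<sigma> (Suc n) * ?e\<bar> * nb \<le> \<bar>?e\<bar> * nb" using nb by (intro mult_right_mono) auto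
  qed
  also have "\<dots> \<le> rate * ?a + (\<bar>\<beta> n\<bar> * ?s + \<bar>?e\<bar> * nb)"
  proof -
    have "rate * (\<bar>\<beta> n\<bar> * ?s) \<le> 1 * (\<bar>\<beta> n\<bar> * ?s)"
      using rate anorm_nonneg by (intro mult_right_mono) auto
    then show ?thesis by (simp add: distrib_left)
  qed
  finally have "anorm (Z (Suc n) \<omega>) ^ 4 \<le> (rate * ?a + (\<bar>\<beta> n\<bar> * ?s + \<bar>?e\<bar> * nb)) ^ 4"
    by (intro power_mono anorm_nonneg)
  also have "\<dots> \<le> (rate * ?a) ^ 4 / rate ^ 3 + (\<bar>\<beta> n\<bar> * ?s + \<bar>?e\<bar> * nb) ^ 4 / (1 - rate) ^ 3"
    by (rule weighted_quartic[OF rate(1,2)])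
  also have "(rate * ?a) ^ 4 / rate ^ 3 = rate * ?a ^ 4"
    using rate by (simp add: power_mult_distrib power4_eq_xxxx power3_eq_cube)
  also have "(\<bar>\<beta> n\<bar> * ?s + \<bar>?e\<bar> * nb) ^ 4 / (1 - rate) ^ 3
      \<le> 8 * ((\<bar>\<beta> n\<bar> * ?s) ^ 4 + (\<bar>?e\<bar> * nb) ^ 4) / (1 - rate) ^ 3"
    using rate by (intro divide_right_mono quartic_bounds(4)) auto
  also have "\<dots> = K * ((\<beta> n) ^ 4 * ?s ^ 4 + nb ^ 4 * ?e ^ 4)"
    by (simp add: K_def power_mult_distrib power_even_abs mult.commute)
  finally show ?thesis by simp
qed

lemma Z_L4_anorm: "L4 M (\<lambda>\<omega>. anorm (Z n \<omega>))" and S_L4_anorm: "L4 M (\<lambda>\<omega>. anorm (S n \<omega>))"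
  using anorm_L4[of "\<lambda>i \<omega>. Z n \<omega> i"] anorm_L4[of "\<lambda>i \<omega>. S n \<omega> i"] Z_L4 S_L4 by simp_all

text \<open>The square of n beta_n^2 is isolated on the right because this quantity tends to zero:
  the past then weighs arbitrarily little against the contraction.\<close>

lemma S_fourth_moment:
  assumes "\<And>j. j \<le> n \<Longrightarrow> expectation (\<lambda>\<omega>. anorm (Z j \<omega>) ^ 4) \<le> Y"
  shows "(\<beta> n) ^ 4 * expectation (\<lambda>\<omega>. anorm (S n \<omega>) ^ 4) \<le> bsum\<^sup>2 * ((\<beta> n)\<^sup>2 * real n)\<^sup>2 * Y"
proof -
  have "expectation (\<lambda>\<omega>. anorm (S n \<omega>) ^ 4)
      \<le> expectation (\<lambda>\<omega>. bsum\<^sup>2 * real n * (\<Sum>j<n. anorm (Z j \<omega>) ^ 4))"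
    by (rule integral_mono[OF L4_integrable[OF S_L4_anorm] _ anorm_S])
      (intro integrable_mult_right Bochner_Integration.integrable_sum L4_integrable Z_L4_anorm)
  also have "\<dots> = bsum\<^sup>2 * real n * (\<Sum>j<n. expectation (\<lambda>\<omega>. anorm (Z j \<omega>) ^ 4))"
    using L4_integrable[OF Z_L4_anorm] by simp
  also have "\<dots> \<le> bsum\<^sup>2 * real n * (\<Sum>j<n. Y)"
    using assms by (intro mult_left_mono sum_mono) auto
  finally have "(\<beta> n) ^ 4 * expectation (\<lambda>\<omega>. anorm (S n \<omega>) ^ 4)
      \<le> (\<beta> n) ^ 4 * (bsum\<^sup>2 * real n * (real n * Y))"
    by (intro mult_left_mono) auto
  also have "\<dots> = bsum\<^sup>2 * ((\<beta> n)\<^sup>2 * real n)\<^sup>2 * Y"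
    by (simp add: power2_eq_square power4_eq_xxxx mult_ac)
  finally show ?thesis .
qed

lemma Z_fourth_moment: "\<exists>C. \<forall>n. expectation (\<lambda>\<omega>. anorm (Z n \<omega>) ^ 4) \<le> C"
proof -
  define K where "K = 8 / (1 - rate) ^ 3"
  define nb where "nb = anorm (\<lambda>i. if i = 0 then 1 else 0)"
  have K: "K > 0" using rate by (simp add: K_def)
  define y where "y n = expectation (\<lambda>\<omega>. anorm (Z n \<omega>) ^ 4)" for n
  have step: "y (Suc n) \<le> rate * y n + K * ((\<beta> n) ^ 4 * expectation (\<lambda>\<omega>. anorm (S n \<omega>) ^ 4) + nb ^ 4 * 3)" for n
  proof -
    have e: "integrable M (\<lambda>\<omega>. \<epsilon> (Suc n) \<omega> ^ 4)" by (rule eps_integrable) simp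
    have "y (Suc n) \<le> expectation (\<lambda>\<omega>. rate * anorm (Z n \<omega>) ^ 4
        + K * ((\<beta> n) ^ 4 * anorm (S n \<omega>) ^ 4 + nb ^ 4 * \<epsilon> (Suc n) \<omega> ^ 4))"
      unfolding y_def K_def nb_def
      by (rule integral_mono[OF _ _ Z_fourth_moment_step])
        (intro integrable_mult_right Bochner_Integration.integrable_add L4_integrable Z_L4_anorm S_L4_anorm e)+
    then show ?thesis
      using e L4_integrable[OF Z_L4_anorm] L4_integrable[OF S_L4_anorm] eps_moments(4)[of "Suc n"]
      by (simp add: y_def)
  qed
  \<comment> \<open>Eventually the past consumes less than half of the gap 1 - rate, which leaves
    the contraction factor (1 + rate) / 2.\<close>
  have "(\<lambda>n. K * (bsum\<^sup>2 * ((\<beta> n)\<^sup>2 * real n)\<^sup>2)) \<longlonglongrightarrow> K * (bsum\<^sup>2 * 0\<^sup>2)"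
    by (intro tendsto_intros beta_n_lim)
  then have "\<forall>\<^sub>F n in sequentially. K * (bsum\<^sup>2 * ((\<beta> n)\<^sup>2 * real n)\<^sup>2) < (1 - rate) / 2"
    using rate by (intro order_tendstoD) auto
  then obtain N where N: "\<And>n. n \<ge> N \<Longrightarrow> K * (bsum\<^sup>2 * ((\<beta> n)\<^sup>2 * real n)\<^sup>2) < (1 - rate) / 2"
    by (auto simp: eventually_sequentially)
  have "\<exists>C. \<forall>n. y n \<le> C"
  proof (rule bounded_if_contracting[where q = "(1 + rate) / 2" and D = "K * (nb ^ 4 * 3)" and N = N])
    show "y n \<ge> 0" for n by (simp add: y_def)
    fix n Y assume n: "n \<ge> N" and Y: "\<And>j. j \<le> n \<Longrightarrow> y j \<le> Y"
    have Y0: "Y \<ge> 0" using Y[of 0] order_trans[of 0 "y 0" Y] by (simp add: y_def)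
    have "y (Suc n) \<le> rate * y n + K * ((\<beta> n) ^ 4 * expectation (\<lambda>\<omega>. anorm (S n \<omega>) ^ 4) + nb ^ 4 * 3)"
      by (rule step)
    also have "\<dots> \<le> rate * Y + K * (bsum\<^sup>2 * ((\<beta> n)\<^sup>2 * real n)\<^sup>2 * Y + nb ^ 4 * 3)"
      using S_fourth_moment[of n Y] Y K rate
      by (intro add_mono mult_left_mono) (auto simp: y_def)
    also have "\<dots> = rate * Y + (K * (bsum\<^sup>2 * ((\<beta> n)\<^sup>2 * real n)\<^sup>2)) * Y + K * (nb ^ 4 * 3)"
      by (simp add: algebra_simps)
    also have "\<dots> \<le> rate * Y + (1 - rate) / 2 * Y + K * (nb ^ 4 * 3)"
      using N[OF n] Y0 by (intro add_mono mult_right_mono) auto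
    also have "\<dots> = (1 + rate) / 2 * Y + K * (nb ^ 4 * 3)" by (simp add: field_simps)
    finally show "y (Suc n) \<le> (1 + rate) / 2 * Y + K * (nb ^ 4 * 3)" .
  qed (use rate K in auto)
  then show ?thesis by (simp add: y_def)
qed

end

subsection \<open>Convergence of the Gram matrices\<close>

context ar_noise begin

lemma U_fourth_moment: "\<exists>C. \<forall>n. expectation (\<lambda>\<omega>. anorm (U n \<omega>) ^ 4) \<le> C"
proof -
  obtain C where C: "\<And>n. expectation (\<lambda>\<omega>. anorm (Z n \<omega>) ^ 4) \<le> C" using Z_fourth_moment by blast
  have C0: "C \<ge> 0" by (rule order_trans[OF Bochner_Integration.integral_nonneg C[of 0]]) simp
  have "expectation (\<lambda>\<omega>. anorm (U n \<omega>) ^ 4) \<le> 8 * (C + bsum\<^sup>2 * H\<^sup>2 * C)" for n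
  proof -
    have UL: "L4 M (\<lambda>\<omega>. anorm (U n \<omega>))" using anorm_L4[of "\<lambda>i \<omega>. U n \<omega> i"] U_L4 by simp
    have "expectation (\<lambda>\<omega>. anorm (U n \<omega>) ^ 4)
        \<le> expectation (\<lambda>\<omega>. 8 * (anorm (Z n \<omega>) ^ 4 + (\<beta> n) ^ 4 * anorm (S n \<omega>) ^ 4))"
    proof (rule integral_mono[OF L4_integrable[OF UL]])
      fix \<omega>
      have "anorm (U n \<omega>) = anorm (\<lambda>i. Z n \<omega> i + \<beta> n * S n \<omega> i)"
        by (rule anorm_cong) (simp add: U_def)
      also have "\<dots> \<le> anorm (Z n \<omega>) + \<bar>\<beta> n\<bar> * anorm (S n \<omega>)"
        using anorm_add[of "Z n \<omega>" "\<lambda>i. \<beta> n * S n \<omega> i"] anorm_scale[of "\<beta> n" "S n \<omega>"] by simp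
      finally have "anorm (U n \<omega>) ^ 4 \<le> (anorm (Z n \<omega>) + \<bar>\<beta> n\<bar> * anorm (S n \<omega>)) ^ 4"
        by (intro power_mono anorm_nonneg)
      also have "\<dots> \<le> 8 * (anorm (Z n \<omega>) ^ 4 + (\<bar>\<beta> n\<bar> * anorm (S n \<omega>)) ^ 4)"
        by (rule quartic_bounds(4))
      finally show "anorm (U n \<omega>) ^ 4 \<le> 8 * (anorm (Z n \<omega>) ^ 4 + (\<beta> n) ^ 4 * anorm (S n \<omega>) ^ 4)"
        by (simp add: power_mult_distrib power_even_abs)
    qed (intro integrable_mult_right Bochner_Integration.integrable_add L4_integrable Z_L4_anorm S_L4_anorm)
    also have "\<dots> = 8 * (expectation (\<lambda>\<omega>. anorm (Z n \<omega>) ^ 4) + (\<beta> n) ^ 4 * expectation (\<lambda>\<omega>. anorm (S n \<omega>) ^ 4))"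
      using L4_integrable[OF Z_L4_anorm] L4_integrable[OF S_L4_anorm] by simp
    also have "\<dots> \<le> 8 * (C + bsum\<^sup>2 * ((\<beta> n)\<^sup>2 * real n)\<^sup>2 * C)"
      using S_fourth_moment[of n C] C by (intro mult_left_mono add_mono) auto
    also have "\<dots> \<le> 8 * (C + bsum\<^sup>2 * H\<^sup>2 * C)"
      using beta_n_le C0 by (intro mult_left_mono add_left_mono mult_right_mono power_mono) auto
    finally show ?thesis .
  qed
  then show ?thesis by blast
qed

definition sig_inf :: real where "sig_inf = (SOME s. s > 0 \<and> (\<forall>n\<ge>1. s \<le> \<sigma> n))"

lemma sig_inf: "sig_inf > 0" "n \<ge> 1 \<Longrightarrow> sig_inf \<le> \<sigma> n"
  using someI_ex[OF sig_lower] unfolding sig_inf_def by auto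

lemma fourth_moment_quotient:
  assumes X: "\<And>n. L4 M (\<lambda>\<omega>. X n \<omega> i)" "\<And>n. L4 M (\<lambda>\<omega>. anorm (X n \<omega>))"
    and C: "\<And>n. expectation (\<lambda>\<omega>. anorm (X n \<omega>) ^ 4) \<le> C" and i: "i < p" and s: "s \<ge> sig_inf"
  shows "expectation (\<lambda>\<omega>. (X n \<omega> i / s) ^ 4) \<le> C / sig_inf ^ 4"
proof -
  have "expectation (\<lambda>\<omega>. (X n \<omega> i / s) ^ 4) \<le> expectation (\<lambda>\<omega>. anorm (X n \<omega>) ^ 4 / sig_inf ^ 4)"
  proof (rule integral_mono)
    show "integrable M (\<lambda>\<omega>. (X n \<omega> i / s) ^ 4)" using L4_integrable[OF X(1)] by (simp add: power_divide)
    show "integrable M (\<lambda>\<omega>. anorm (X n \<omega>) ^ 4 / sig_inf ^ 4)" using L4_integrable[OF X(2)] by simp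
    fix \<omega>
    have "\<bar>X n \<omega> i / s\<bar> \<le> anorm (X n \<omega>) / sig_inf"
      unfolding abs_divide using sig_inf(1) s by (intro frac_le anorm_ge i anorm_nonneg) auto
    then have "\<bar>X n \<omega> i / s\<bar> ^ 4 \<le> (anorm (X n \<omega>) / sig_inf) ^ 4" by (intro power_mono) auto
    then show "(X n \<omega> i / s) ^ 4 \<le> anorm (X n \<omega>) ^ 4 / sig_inf ^ 4"
      by (simp add: power_even_abs power_divide)
  qed
  also have "\<dots> = expectation (\<lambda>\<omega>. anorm (X n \<omega>) ^ 4) / sig_inf ^ 4" by simp
  also have "\<dots> \<le> C / sig_inf ^ 4" using C sig_inf(1) by (intro divide_right_mono) auto
  finally show ?thesis .
qed

lemma u_fourth_moment: "\<exists>C. \<forall>n. \<forall>i<p. expectation (\<lambda>\<omega>. u i n \<omega> ^ 4) \<le> C"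
proof -
  obtain C where C: "\<And>n. expectation (\<lambda>\<omega>. anorm (U n \<omega>) ^ 4) \<le> C" using U_fourth_moment by blast
  have "expectation (\<lambda>\<omega>. u i n \<omega> ^ 4) \<le> C / sig_inf ^ 4" if "i < p" for i n
    unfolding u_def using anorm_L4[of "\<lambda>i \<omega>. U _ \<omega> i"] U_L4
    by (intro fourth_moment_quotient[OF U_L4 _ C that]) (auto intro: sig_inf)
  then show ?thesis by blast
qed

text \<open>With \<open>u\<^sub>n = U\<^sub>n / \<sigma>\<^sub>n\<^sub>+\<^sub>1\<close> the recursion becomes \<open>u\<^sub>n\<^sub>+\<^sub>1 = A u\<^sub>n + b \<epsilon>\<^sub>n\<^sub>+\<^sub>1 + v\<^sub>n\<^sub>+\<^sub>1\<close>: a stationary autoregression driven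
  by the innovations, perturbed by a negligible term \<open>v\<close>.\<close>

definition z :: "nat \<Rightarrow> nat \<Rightarrow> 'a \<Rightarrow> real" where "z i n \<omega> = Z n \<omega> i / \<sigma> n"
definition v :: "nat \<Rightarrow> nat \<Rightarrow> 'a \<Rightarrow> real" where "v i n \<omega> = u i n \<omega> - z i n \<omega>"

lemma z_L4: "L4 M (z i n)"
  using L4_cmult[OF Z_L4, of "1 / \<sigma> n" n i] by (simp add: z_def[abs_def])

lemma v_L4: "L4 M (v i n)"
  unfolding v_def[abs_def] by (rule L4_diff[OF u_L4 z_L4])

lemma z_Suc: "z i (Suc n) \<omega> = mv (\<lambda>j. u j n \<omega>) i + (if i = 0 then \<epsilon> (Suc n) \<omega> else 0)"
  using sig_pos[of "Suc n"]
  by (simp add: z_def Z_Suc mv_def u_def add_divide_distrib sum_divide_distrib)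

lemma z_fourth_moment: "\<exists>C. \<forall>n\<ge>1. \<forall>i<p. expectation (\<lambda>\<omega>. z i n \<omega> ^ 4) \<le> C"
proof -
  obtain C where C: "\<And>n. expectation (\<lambda>\<omega>. anorm (Z n \<omega>) ^ 4) \<le> C" using Z_fourth_moment by blast
  have "expectation (\<lambda>\<omega>. z i n \<omega> ^ 4) \<le> C / sig_inf ^ 4" if "i < p" "n \<ge> 1" for i n
    unfolding z_def
    by (rule fourth_moment_quotient[OF Z_L4 Z_L4_anorm C that(1) sig_inf(2)[OF that(2)]])
  then show ?thesis by blast
qed

text \<open>v_n is the sum of (1 / sigma_{n+1} - 1 / sigma_n) Z_n and (beta_n / sigma_{n+1}) S_n. By
  the recursion for the variances and a difference of squares the first coefficient is of order
  beta_n^2, hence also of order |beta_n| like the second.\<close>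

lemma v_bound:
  assumes n: "n \<ge> 1" and i: "i < p"
  shows "(v i n \<omega>)\<^sup>2 \<le> 2 * (1 / sig_inf\<^sup>2 + 1 / sig_inf)\<^sup>2 * (\<beta> n)\<^sup>2 * ((anorm (Z n \<omega>))\<^sup>2 + (anorm (S n \<omega>))\<^sup>2)"
proof -
  let ?s = "\<sigma> n" and ?t = "\<sigma> (Suc n)" and ?k = "1 / sig_inf\<^sup>2 + 1 / sig_inf"
  have s: "?s \<ge> sig_inf" "?s \<le> 1" and t: "?t \<ge> sig_inf" using sig_inf(2) sig_le_1 n by auto
  have k: "1 / sig_inf\<^sup>2 \<ge> 0" "1 / sig_inf \<ge> 0" using sig_inf(1) by auto
  have bb: "(\<beta> n)\<^sup>2 \<le> \<bar>\<beta> n\<bar>"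
    using beta_less_1[OF n] by (metis abs_ge_zero abs_square_less_1 less_imp_le mult_left_le power2_abs power2_eq_square)
  have "(?s - ?t) * (?s + ?t) = ?s\<^sup>2 * (\<beta> n)\<^sup>2"
    using sig_Suc[OF n] by (simp add: power2_eq_square algebra_simps)
  then have d: "?s - ?t = ?s\<^sup>2 * (\<beta> n)\<^sup>2 / (?s + ?t)"
    using s t sig_inf(1) by (simp add: field_simps)
  have "1 / ?t - 1 / ?s = (?s - ?t) / (?s * ?t)" using s t sig_inf(1) by (simp add: field_simps)
  also have "\<dots> = ?s / (?s + ?t) * ((\<beta> n)\<^sup>2 / ?t)"
    unfolding d using s t sig_inf(1) by (simp add: power2_eq_square)
  finally have e: "1 / ?t - 1 / ?s = ?s / (?s + ?t) * ((\<beta> n)\<^sup>2 / ?t)" .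
  have "\<bar>1 / ?t - 1 / ?s\<bar> \<le> 1 * (\<bar>\<beta> n\<bar> / sig_inf)"
    unfolding e abs_mult using s t sig_inf(1) bb by (intro mult_mono) (auto simp: abs_divide intro!: frac_le)
  also have "\<dots> \<le> ?k * \<bar>\<beta> n\<bar>"
    using k by (simp add: distrib_right)
  finally have c1: "\<bar>1 / ?t - 1 / ?s\<bar> \<le> ?k * \<bar>\<beta> n\<bar>" .
  have "\<bar>\<beta> n / ?t\<bar> \<le> \<bar>\<beta> n\<bar> / sig_inf"
    using t sig_inf(1) by (auto simp: abs_divide intro!: frac_le)
  also have "\<dots> \<le> ?k * \<bar>\<beta> n\<bar>" using k by (simp add: distrib_right)
  finally have c2: "\<bar>\<beta> n / ?t\<bar> \<le> ?k * \<bar>\<beta> n\<bar>" .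
  have "v i n \<omega> = (1 / ?t - 1 / ?s) * Z n \<omega> i + \<beta> n / ?t * S n \<omega> i"
    by (simp add: v_def u_def U_def z_def left_diff_distrib add_divide_distrib)
  then have "\<bar>v i n \<omega>\<bar> \<le> \<bar>1 / ?t - 1 / ?s\<bar> * \<bar>Z n \<omega> i\<bar> + \<bar>\<beta> n / ?t\<bar> * \<bar>S n \<omega> i\<bar>"
    by (simp only: abs_mult[symmetric] abs_triangle_ineq)
  also have "\<dots> \<le> ?k * \<bar>\<beta> n\<bar> * anorm (Z n \<omega>) + ?k * \<bar>\<beta> n\<bar> * anorm (S n \<omega>)"
    using k by (intro add_mono mult_mono c1 c2 anorm_ge i) auto
  also have "\<dots> = ?k * \<bar>\<beta> n\<bar> * (anorm (Z n \<omega>) + anorm (S n \<omega>))" by (simp add: distrib_left)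
  finally have "\<bar>v i n \<omega>\<bar>\<^sup>2 \<le> (?k * \<bar>\<beta> n\<bar> * (anorm (Z n \<omega>) + anorm (S n \<omega>)))\<^sup>2"
    by (intro power_mono) auto
  also have "\<dots> = ?k\<^sup>2 * (\<beta> n)\<^sup>2 * (anorm (Z n \<omega>) + anorm (S n \<omega>))\<^sup>2"
    by (simp add: power_mult_distrib)
  also have "\<dots> \<le> ?k\<^sup>2 * (\<beta> n)\<^sup>2 * (2 * ((anorm (Z n \<omega>))\<^sup>2 + (anorm (S n \<omega>))\<^sup>2))"
  proof (rule mult_left_mono)
    show "(anorm (Z n \<omega>) + anorm (S n \<omega>))\<^sup>2 \<le> 2 * ((anorm (Z n \<omega>))\<^sup>2 + (anorm (S n \<omega>))\<^sup>2)"
      using sum_squares_bound[of "anorm (Z n \<omega>)" "anorm (S n \<omega>)"] by (simp add: power2_sum)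
  qed (intro mult_nonneg_nonneg zero_le_power2)
  finally show ?thesis by (simp only: power2_abs mult_ac)
qed

text \<open>The second moment of Z_n is O(1) and that of S_n is O(n) by Cauchy--Schwarz; the factor
  beta_n^2 turns the larger of the two into n^(1 - \<alpha>).\<close>

lemma v_second_moment: "\<exists>C\<ge>0. \<forall>n\<ge>1. \<forall>i<p. expectation (\<lambda>\<omega>. (v i n \<omega>)\<^sup>2) \<le> C * real n powr (1 - \<alpha>)"
proof -
  obtain C0 where C0: "\<And>n. expectation (\<lambda>\<omega>. anorm (Z n \<omega>) ^ 4) \<le> C0" using Z_fourth_moment by blast
  define C where "C = 1 + C0"
  have C: "expectation (\<lambda>\<omega>. (anorm (Z n \<omega>))\<^sup>2) \<le> C" for n
    using L4_second_moment[OF Z_L4_anorm, of n] C0[of n] by (simp add: C_def)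
  have Cpos: "C \<ge> 0" by (rule order_trans[OF Bochner_Integration.integral_nonneg C[of 0]]) simp
  define k where "k = 2 * (1 / sig_inf\<^sup>2 + 1 / sig_inf)\<^sup>2"
  have k: "k \<ge> 0" by (simp add: k_def)
  note I2 = L4_products(5)[OF Z_L4_anorm Z_L4_anorm] L4_products(5)[OF S_L4_anorm S_L4_anorm]
  have "expectation (\<lambda>\<omega>. (v i n \<omega>)\<^sup>2) \<le> (k * (C + bsum * C) * H) * real n powr (1 - \<alpha>)"
    if n: "n \<ge> 1" and i: "i < p" for n i
  proof -
    have "expectation (\<lambda>\<omega>. (anorm (S n \<omega>))\<^sup>2) \<le> expectation (\<lambda>\<omega>. bsum * (\<Sum>j<n. (anorm (Z j \<omega>))\<^sup>2))"
      by (rule integral_mono[OF _ _ anorm_S2]) (intro I2 integrable_mult_right Bochner_Integration.integrable_sum)+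
    also have "\<dots> = bsum * (\<Sum>j<n. expectation (\<lambda>\<omega>. (anorm (Z j \<omega>))\<^sup>2))" using I2 by simp
    also have "\<dots> \<le> bsum * (\<Sum>j<n. C)" by (intro mult_left_mono sum_mono C bsum)
    finally have ES: "expectation (\<lambda>\<omega>. (anorm (S n \<omega>))\<^sup>2) \<le> bsum * (real n * C)" by simp
    have "expectation (\<lambda>\<omega>. (v i n \<omega>)\<^sup>2)
        \<le> expectation (\<lambda>\<omega>. k * (\<beta> n)\<^sup>2 * ((anorm (Z n \<omega>))\<^sup>2 + (anorm (S n \<omega>))\<^sup>2))"
      unfolding k_def
      by (rule integral_mono[OF _ _ v_bound[OF n i]])
        (intro L4_products(5)[OF v_L4 v_L4] integrable_mult_right Bochner_Integration.integrable_add I2)+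
    also have "\<dots> = k * (\<beta> n)\<^sup>2 * (expectation (\<lambda>\<omega>. (anorm (Z n \<omega>))\<^sup>2) + expectation (\<lambda>\<omega>. (anorm (S n \<omega>))\<^sup>2))"
      using I2 by simp
    also have "\<dots> \<le> k * (\<beta> n)\<^sup>2 * (real n * C + bsum * (real n * C))"
    proof (intro mult_left_mono add_mono ES)
      have "C \<le> real n * C" using Cpos n mult_right_mono[of 1 "real n" C] by simp
      then show "expectation (\<lambda>\<omega>. (anorm (Z n \<omega>))\<^sup>2) \<le> real n * C" using C[of n] by linarith
    qed (use k in auto)
    also have "\<dots> = k * (C + bsum * C) * ((\<beta> n)\<^sup>2 * real n)" by (simp add: algebra_simps)
    also have "\<dots> \<le> k * (C + bsum * C) * (H * real n powr (1 - \<alpha>))"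
      using k Cpos bsum(2) by (intro mult_left_mono beta_n[OF n]) auto
    finally show ?thesis by (simp add: mult.assoc)
  qed
  moreover have "0 \<le> k * (C + bsum * C) * H" using k Cpos bsum(2) H_nonneg by simp
  ultimately show ?thesis by blast
qed

text \<open>Divided by n, the expected absolute products are O(n^(s - 1)) with s < 0, hence
  summable, and Kronecker's lemma converts the convergent series into vanishing averages.\<close>

lemma v_cross:
  assumes X: "\<And>n. L4 M (X n)" and C: "\<And>n. n \<ge> 1 \<Longrightarrow> expectation (\<lambda>\<omega>. X n \<omega> ^ 4) \<le> C" and i: "i < p"
  shows "AE \<omega> in M. (\<lambda>N. (\<Sum>n<N. v i (Suc n) \<omega> * X (Suc n) \<omega>) / real N) \<longlonglongrightarrow> 0"
proof -
  obtain D where D: "\<And>n. n \<ge> 1 \<Longrightarrow> expectation (\<lambda>\<omega>. (v i n \<omega>)\<^sup>2) \<le> D * real n powr (1 - \<alpha>)"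
    using v_second_moment i by blast
  define E where "E = D + (1 + C)"
  \<comment> \<open>Half of the decay exponent of E v_n^2: Young's inequality with weight n^s then
    makes both resulting terms of order n^s.\<close>
  define s where "s = (1 - \<alpha>) / 2"
  have vI: "integrable M (\<lambda>\<omega>. (v i n \<omega>)\<^sup>2)" and XI: "integrable M (\<lambda>\<omega>. (X n \<omega>)\<^sup>2)" for n
    by (rule L4_products(5)[OF v_L4 v_L4] L4_products(5)[OF X X])+
  have b: "expectation (\<lambda>\<omega>. \<bar>v i n \<omega> * X n \<omega>\<bar>) \<le> E * real n powr s" if n: "n \<ge> 1" for n
  proof -
    let ?t = "real n powr s"
    have t: "?t > 0" using n by simp
    have "expectation (\<lambda>\<omega>. \<bar>v i n \<omega> * X n \<omega>\<bar>) \<le> expectation (\<lambda>\<omega>. (1 / ?t) * (v i n \<omega>)\<^sup>2 + ?t * (X n \<omega>)\<^sup>2)"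
    proof (rule integral_mono[OF L4_products(8)[OF v_L4 X]])
      fix \<omega>
      have gen: "\<bar>a * x\<bar> \<le> (1 / ?t) * a\<^sup>2 + ?t * x\<^sup>2" for a x :: real
      proof -
        have "0 \<le> (\<bar>a\<bar> - ?t * \<bar>x\<bar>)\<^sup>2" by simp
        then have "2 * (?t * \<bar>a * x\<bar>) \<le> a\<^sup>2 + (?t * x)\<^sup>2"
          by (simp add: power2_diff power_mult_distrib abs_mult mult_ac)
        moreover have "0 \<le> ?t * \<bar>a * x\<bar>" using t by simp
        ultimately have "?t * \<bar>a * x\<bar> \<le> a\<^sup>2 + (?t * x)\<^sup>2" by linarith
        also have "\<dots> = ?t * ((1 / ?t) * a\<^sup>2 + ?t * x\<^sup>2)"
          using t by (simp add: distrib_left power_mult_distrib power2_eq_square)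
        finally show ?thesis using t by (simp only: mult_le_cancel_left_pos)
      qed
      show "\<bar>v i n \<omega> * X n \<omega>\<bar> \<le> (1 / ?t) * (v i n \<omega>)\<^sup>2 + ?t * (X n \<omega>)\<^sup>2" by (rule gen)
    qed (intro Bochner_Integration.integrable_add integrable_mult_right vI XI)
    also have "\<dots> = (1 / ?t) * expectation (\<lambda>\<omega>. (v i n \<omega>)\<^sup>2) + ?t * expectation (\<lambda>\<omega>. (X n \<omega>)\<^sup>2)"
      using vI XI by simp
    also have "\<dots> \<le> (1 / ?t) * (D * real n powr (1 - \<alpha>)) + ?t * (1 + C)"
      using t L4_second_moment[OF X, of n] C[OF n] by (intro add_mono mult_left_mono D n) auto
    also have "real n powr (1 - \<alpha>) = ?t * ?t"
      by (simp add: s_def powr_add[symmetric])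
    finally show ?thesis using t by (simp add: E_def algebra_simps)
  qed
  have "AE \<omega> in M. summable (\<lambda>n. \<bar>v i (Suc n) \<omega> * X (Suc n) \<omega>\<bar> / real (Suc n))"
  proof (rule AE_summable_if_summable_integral)
    show "integrable M (\<lambda>\<omega>. \<bar>v i (Suc n) \<omega> * X (Suc n) \<omega>\<bar> / real (Suc n))" for n
      by (intro integrable_divide L4_products(8)[OF v_L4 X])
    have "summable (\<lambda>n. real n powr (s - 1))"
      using alpha by (simp add: summable_real_powr_iff s_def)
    then have sm: "summable (\<lambda>n. E * real (Suc n) powr (s - 1))"
      by (intro summable_mult) (subst summable_Suc_iff)
    show "summable (\<lambda>n. expectation (\<lambda>\<omega>. \<bar>v i (Suc n) \<omega> * X (Suc n) \<omega>\<bar> / real (Suc n)))"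
    proof (rule summable_comparison_test'[OF sm, of 0])
      fix n
      have "expectation (\<lambda>\<omega>. \<bar>v i (Suc n) \<omega> * X (Suc n) \<omega>\<bar> / real (Suc n))
          = expectation (\<lambda>\<omega>. \<bar>v i (Suc n) \<omega> * X (Suc n) \<omega>\<bar>) / real (Suc n)" by simp
      also have "\<dots> \<le> E * real (Suc n) powr s / real (Suc n)"
        by (intro divide_right_mono b) auto
      also have "\<dots> = E * real (Suc n) powr (s - 1)"
        by (simp add: powr_diff)
      finally show "norm (expectation (\<lambda>\<omega>. \<bar>v i (Suc n) \<omega> * X (Suc n) \<omega>\<bar> / real (Suc n)))
          \<le> E * real (Suc n) powr (s - 1)"
        by (subst real_norm_def, subst abs_of_nonneg) (auto intro!: Bochner_Integration.integral_nonneg)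
    qed
  qed simp
  then show ?thesis
  proof eventually_elim
    case (elim \<omega>)
    have "summable (\<lambda>n. v i (Suc n) \<omega> * X (Suc n) \<omega> / real (Suc n))"
      by (rule summable_rabs_cancel) (use elim in \<open>simp add: abs_divide del: of_nat_Suc\<close>)
    then show ?case by (rule kronecker_average)
  qed
qed


section \<open>The approximate Lyapunov equation\<close>

definition Au :: "nat \<Rightarrow> nat \<Rightarrow> 'a \<Rightarrow> real" where "Au i n \<omega> = mv (\<lambda>j. u j n \<omega>) i"

lemma u_0: "u i 0 \<omega> = 0"
  by (simp add: u_def U_0)

text \<open>Since u = z + v and z is the exact autoregressive step, u_i u_j = z_i z_j + v_i u_j +
  v_j z_i pairs each perturbation with a factor of bounded fourth moment.\<close>

lemma u_Suc_product:
  assumes "i < p" "j < p"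
  shows "u i (Suc n) \<omega> * u j (Suc n) \<omega> = congr 1 (\<lambda>a b. u a n \<omega> * u b n \<omega>) i j
    + (if j = 0 then Au i n \<omega> * \<epsilon> (Suc n) \<omega> else 0) + (if i = 0 then Au j n \<omega> * \<epsilon> (Suc n) \<omega> else 0)
    + (if i = 0 \<and> j = 0 then (\<epsilon> (Suc n) \<omega>)\<^sup>2 else 0)
    + v i (Suc n) \<omega> * u j (Suc n) \<omega> + v j (Suc n) \<omega> * z i (Suc n) \<omega>"
proof -
  have cg: "congr 1 (\<lambda>a b. u a n \<omega> * u b n \<omega>) i j = Au i n \<omega> * Au j n \<omega>"
    unfolding congr_1[OF assms] Au_def mv_def sum_product by (simp add: mult_ac)
  have "u i (Suc n) \<omega> * u j (Suc n) \<omega> = z i (Suc n) \<omega> * z j (Suc n) \<omega>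
      + v i (Suc n) \<omega> * u j (Suc n) \<omega> + v j (Suc n) \<omega> * z i (Suc n) \<omega>"
    by (simp add: v_def algebra_simps)
  also have "z i (Suc n) \<omega> * z j (Suc n) \<omega> = Au i n \<omega> * Au j n \<omega>
    + (if j = 0 then Au i n \<omega> * \<epsilon> (Suc n) \<omega> else 0) + (if i = 0 then Au j n \<omega> * \<epsilon> (Suc n) \<omega> else 0)
    + (if i = 0 \<and> j = 0 then (\<epsilon> (Suc n) \<omega>)\<^sup>2 else 0)"
    by (simp add: z_Suc Au_def algebra_simps power2_eq_square)
  finally show ?thesis unfolding cg .
qed

definition G :: "nat \<Rightarrow> 'a \<Rightarrow> nat \<Rightarrow> nat \<Rightarrow> real" where
  "G N \<omega> i j = (\<Sum>n<N. u i n \<omega> * u j n \<omega>) / real N"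

lemma congr_G: "congr 1 (G N \<omega>) i j = (\<Sum>n<N. congr 1 (\<lambda>a b. u a n \<omega> * u b n \<omega>) i j) / real N"
proof -
  have "congr 1 (G N \<omega>) i j
      = (\<Sum>a<p. \<Sum>b<p. \<Sum>n<N. pw 1 i a * (u a n \<omega> * u b n \<omega>) * pw 1 j b / real N)"
    by (simp add: congr_def G_def sum_distrib_left sum_distrib_right sum_divide_distrib)
  also have "\<dots> = (\<Sum>a<p. \<Sum>n<N. \<Sum>b<p. pw 1 i a * (u a n \<omega> * u b n \<omega>) * pw 1 j b / real N)"
    by (intro sum.cong refl sum.swap)
  also have "\<dots> = (\<Sum>n<N. \<Sum>a<p. \<Sum>b<p. pw 1 i a * (u a n \<omega> * u b n \<omega>) * pw 1 j b / real N)"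
    by (rule sum.swap)
  finally show ?thesis by (simp add: congr_def sum_divide_distrib)
qed

text \<open>The product recursion is summed and the index shifted by one. The boundary term at time
  0 vanishes because u starts at 0; the one at time \<open>N\<close> is the subtracted term.\<close>

lemma G_equation:
  assumes ij: "i < p" "j < p"
  shows "G N \<omega> i j = congr 1 (G N \<omega>) i j
    + ((if j = 0 then mart (Au i) N \<omega> / real N else 0) + (if i = 0 then mart (Au j) N \<omega> / real N else 0)
      + (if i = 0 \<and> j = 0 then (\<Sum>n<N. (\<epsilon> (Suc n) \<omega>)\<^sup>2) / real N else 0)
      + (\<Sum>n<N. v i (Suc n) \<omega> * u j (Suc n) \<omega>) / real N
      + (\<Sum>n<N. v j (Suc n) \<omega> * z i (Suc n) \<omega>) / real N
      - u i N \<omega> * u j N \<omega> / real N)"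
proof -
  have "(\<Sum>n<N. u i n \<omega> * u j n \<omega>) + u i N \<omega> * u j N \<omega> = (\<Sum>n<N. u i (Suc n) \<omega> * u j (Suc n) \<omega>)"
    using sum.lessThan_Suc_shift[of "\<lambda>n. u i n \<omega> * u j n \<omega>" N] by (simp add: u_0)
  also have "\<dots> = (\<Sum>n<N. congr 1 (\<lambda>a b. u a n \<omega> * u b n \<omega>) i j)
    + (if j = 0 then mart (Au i) N \<omega> else 0) + (if i = 0 then mart (Au j) N \<omega> else 0)
      + (if i = 0 \<and> j = 0 then (\<Sum>n<N. (\<epsilon> (Suc n) \<omega>)\<^sup>2) else 0)
      + (\<Sum>n<N. v i (Suc n) \<omega> * u j (Suc n) \<omega>)
      + (\<Sum>n<N. v j (Suc n) \<omega> * z i (Suc n) \<omega>)"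
    unfolding u_Suc_product[OF ij] sum.distrib msum_def by simp
  finally have "(\<Sum>n<N. u i n \<omega> * u j n \<omega>) = (\<Sum>n<N. congr 1 (\<lambda>a b. u a n \<omega> * u b n \<omega>) i j)
    + (if j = 0 then mart (Au i) N \<omega> else 0) + (if i = 0 then mart (Au j) N \<omega> else 0)
      + (if i = 0 \<and> j = 0 then (\<Sum>n<N. (\<epsilon> (Suc n) \<omega>)\<^sup>2) else 0)
      + (\<Sum>n<N. v i (Suc n) \<omega> * u j (Suc n) \<omega>)
      + (\<Sum>n<N. v j (Suc n) \<omega> * z i (Suc n) \<omega>) - u i N \<omega> * u j N \<omega>"
    by simp
  then show ?thesis unfolding congr_G unfolding G_def
    by (simp add: add_divide_distrib diff_divide_distrib)
qed

lemma u_square_negligible: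
  assumes i: "i < p"
  shows "AE \<omega> in M. (\<lambda>N. (u i N \<omega>)\<^sup>2 / real N) \<longlonglongrightarrow> 0"
proof -
  obtain C where C: "\<And>n. expectation (\<lambda>\<omega>. u i n \<omega> ^ 4) \<le> C" using u_fourth_moment i by blast
  have "AE \<omega> in M. (\<lambda>N. ((u i N \<omega>)\<^sup>2 / real N)\<^sup>2) \<longlonglongrightarrow> 0"
  proof (rule AE_tendsto_0_if_summable_integral[where N = 0])
    have eq: "((u i n \<omega>)\<^sup>2 / real n)\<^sup>2 = u i n \<omega> ^ 4 / (real n)\<^sup>2" for n \<omega>
      by (simp add: power_divide)
    show "integrable M (\<lambda>\<omega>. ((u i n \<omega>)\<^sup>2 / real n)\<^sup>2)" for n
      unfolding eq using L4_integrable[OF u_L4] by simp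
    show "summable (\<lambda>n. C * (1 / (real n)\<^sup>2))"
      using inverse_power_summable[of 2] by (intro summable_mult) (simp add: inverse_eq_divide)
    show "expectation (\<lambda>\<omega>. ((u i n \<omega>)\<^sup>2 / real n)\<^sup>2) \<le> C * (1 / (real n)\<^sup>2)" for n
      unfolding eq using C[of n] by (simp add: divide_right_mono)
  qed simp
  then show ?thesis
    by eventually_elim (simp only: power_tendsto_0_iff zero_less_numeral)
qed

lemma Au_F: "Au i n \<in> borel_measurable (F n)"
  unfolding Au_def mv_def using u_F by measurable

lemma Au_L4: "L4 M (Au i n)"
  unfolding Au_def[abs_def] mv_def by (intro L4_sum L4_cmult u_L4)

lemma L4_sum_fourth_moment:
  assumes "finite I" "\<And>a. a \<in> I \<Longrightarrow> L4 M (X a)"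
  shows "expectation (\<lambda>\<omega>. (\<Sum>a\<in>I. X a \<omega>) ^ 4) \<le> (\<Sum>a\<in>I. 8 ^ card I * expectation (\<lambda>\<omega>. X a \<omega> ^ 4))"
  using assms
proof (induction I rule: finite_induct)
  case (insert a I)
  have X: "L4 M (X a)" "L4 M (\<lambda>\<omega>. \<Sum>a\<in>I. X a \<omega>)" using insert by (auto intro: L4_sum)
  have "expectation (\<lambda>\<omega>. (\<Sum>b\<in>insert a I. X b \<omega>) ^ 4)
      \<le> expectation (\<lambda>\<omega>. 8 * (X a \<omega> ^ 4 + (\<Sum>b\<in>I. X b \<omega>) ^ 4))"
    using insert(1,2) L4_integrable[OF L4_add[OF X]] L4_integrable[OF X(1)] L4_integrable[OF X(2)]
    by (intro integral_mono) (auto intro!: quartic_bounds(4)[unfolded distrib_left])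
  also have "\<dots> = 8 * (expectation (\<lambda>\<omega>. X a \<omega> ^ 4) + expectation (\<lambda>\<omega>. (\<Sum>b\<in>I. X b \<omega>) ^ 4))"
    using L4_integrable[OF X(1)] L4_integrable[OF X(2)] by simp
  also have "\<dots> \<le> 8 * (8 ^ card I * expectation (\<lambda>\<omega>. X a \<omega> ^ 4)
      + (\<Sum>b\<in>I. 8 ^ card I * expectation (\<lambda>\<omega>. X b \<omega> ^ 4)))"
  proof (intro mult_left_mono add_mono)
    have "1 * expectation (\<lambda>\<omega>. X a \<omega> ^ 4) \<le> 8 ^ card I * expectation (\<lambda>\<omega>. X a \<omega> ^ 4)"
      by (intro mult_right_mono Bochner_Integration.integral_nonneg) auto
    then show "expectation (\<lambda>\<omega>. X a \<omega> ^ 4) \<le> 8 ^ card I * expectation (\<lambda>\<omega>. X a \<omega> ^ 4)" by simp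
  qed (use insert in auto)
  also have "\<dots> = (\<Sum>b\<in>insert a I. 8 ^ card (insert a I) * expectation (\<lambda>\<omega>. X b \<omega> ^ 4))"
    using insert(1,2) by (simp add: sum_distrib_left distrib_left mult.assoc)
  finally show ?case .
qed simp

lemma Au_fourth_moment:
  assumes "i < p"
  shows "\<exists>C. \<forall>n. expectation (\<lambda>\<omega>. Au i n \<omega> ^ 4) \<le> C"
proof -
  obtain C where C: "\<And>n i. i < p \<Longrightarrow> expectation (\<lambda>\<omega>. u i n \<omega> ^ 4) \<le> C" using u_fourth_moment by blast
  have "expectation (\<lambda>\<omega>. Au i n \<omega> ^ 4) \<le> (\<Sum>j<p. 8 ^ card {..<p} * (A $$ (i, j) ^ 4 * C))" for n
  proof -
    have "expectation (\<lambda>\<omega>. Au i n \<omega> ^ 4)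
        \<le> (\<Sum>j<p. 8 ^ card {..<p} * expectation (\<lambda>\<omega>. (A $$ (i, j) * u j n \<omega>) ^ 4))"
      unfolding Au_def mv_def by (rule L4_sum_fourth_moment) (auto intro: L4_cmult u_L4)
    also have "\<dots> \<le> (\<Sum>j<p. 8 ^ card {..<p} * (A $$ (i, j) ^ 4 * C))"
      unfolding power_mult_distrib integral_mult_right_zero
      by (intro sum_mono mult_left_mono C) auto
    finally show ?thesis .
  qed
  then show ?thesis by blast
qed

text \<open>The strong law for unit weights and g = x^2 - 1. Its fourth moment involves the eighth
  moment of the innovations; by equality of laws the value at index 1 serves as the uniform
  constant.\<close>

lemma eps_square_law: "AE \<omega> in M. (\<lambda>N. (\<Sum>n<N. (\<epsilon> (Suc n) \<omega>)\<^sup>2) / real N) \<longlonglongrightarrow> 1"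
proof -
  let ?g = "\<lambda>x::real. x\<^sup>2 - 1"
  have eq: "(?g x) ^ 4 = x ^ 8 - 4 * x ^ 6 + 6 * x ^ 4 - 4 * x\<^sup>2 + 1" for x :: real
  proof -
    have "(?g x) ^ 4 = (?g x)\<^sup>2 * (?g x)\<^sup>2" by (simp add: power2_eq_square power4_eq_xxxx)
    also have "\<dots> = (x ^ 4 - 2 * x\<^sup>2 + 1) * (x ^ 4 - 2 * x\<^sup>2 + 1)"
    proof -
      have "(?g x)\<^sup>2 = x ^ 4 - 2 * x\<^sup>2 + 1" by (simp add: power2_diff)
      then show ?thesis by (simp only:)
    qed
    also have "\<dots> = x ^ 8 - 4 * x ^ 6 + 6 * x ^ 4 - 4 * x\<^sup>2 + 1"
      by (simp add: algebra_simps flip: power_add)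
    finally show ?thesis .
  qed
  have I: "integrable M (\<lambda>\<omega>. \<epsilon> (Suc n) \<omega> ^ k)" for n k by (rule eps_integrable) simp
  have gI: "integrable M (\<lambda>\<omega>. ?g (\<epsilon> (Suc n) \<omega>) ^ 4)" for n
    unfolding eq by (intro Bochner_Integration.integrable_add Bochner_Integration.integrable_diff
        integrable_mult_right I integrable_const)
  have g0: "expectation (\<lambda>\<omega>. ?g (\<epsilon> (Suc n) \<omega>)) = 0" for n
    using I[of n 2] eps_moments(2)[of "Suc n"] by (simp add: prob_space)
  have gK: "expectation (\<lambda>\<omega>. ?g (\<epsilon> (Suc n) \<omega>) ^ 4) = expectation (\<lambda>\<omega>. ?g (\<epsilon> 1 \<omega>) ^ 4)" for n
    using distributed_integral[OF normal[of "Suc n"], of "\<lambda>x. ?g x ^ 4"]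
      distributed_integral[OF normal[of 1], of "\<lambda>x. ?g x ^ 4"] by simp
  have "AE \<omega> in M. (\<lambda>N. msum (\<lambda>_ _. 1) ?g N \<omega> / real N) \<longlonglongrightarrow> 0"
    by (rule msum_strong_law[where C = 1, OF _ _ _ _ gI g0 eq_refl[OF gK]])
      (auto simp: L4_const prob_space)
  then show ?thesis
  proof eventually_elim
    case (elim \<omega>)
    have "(\<lambda>N. msum (\<lambda>_ _. 1) ?g N \<omega> / real N + 1) \<longlonglongrightarrow> 0 + 1"
      by (intro tendsto_add elim tendsto_const)
    then have "(\<lambda>N. msum (\<lambda>_ _. 1) ?g N \<omega> / real N + 1) \<longlonglongrightarrow> 1" by simp
    then show ?case
    proof (rule Lim_transform_eventually)
      show "\<forall>\<^sub>F N in sequentially. msum (\<lambda>_ _. 1) ?g N \<omega> / real N + 1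
          = (\<Sum>n<N. (\<epsilon> (Suc n) \<omega>)\<^sup>2) / real N"
        using eventually_gt_at_top[of 0]
        by eventually_elim (simp add: msum_def sum_subtractf diff_divide_distrib)
    qed
  qed
qed

text \<open>Path by path the averages solve a Lyapunov equation whose remainder tends to b b^T:
  cross terms with the innovations are martingales divided by N, cross terms with v average out, and
  only the mean of the squared innovations survives.\<close>

theorem gram_law:
  "AE \<omega> in M. \<forall>i<p. \<forall>j<p. (\<lambda>N. G N \<omega> i j) \<longlonglongrightarrow> gram i j"
proof -
  obtain Cu where Cu: "\<And>n i. i < p \<Longrightarrow> expectation (\<lambda>\<omega>. u i n \<omega> ^ 4) \<le> Cu" using u_fourth_moment by blast
  obtain Cz where Cz: "\<And>n i. n \<ge> 1 \<Longrightarrow> i < p \<Longrightarrow> expectation (\<lambda>\<omega>. z i n \<omega> ^ 4) \<le> Cz"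
    using z_fourth_moment by blast
  have A1: "AE \<omega> in M. \<forall>i\<in>{..<p}. (\<lambda>N. mart (Au i) N \<omega> / real N) \<longlonglongrightarrow> 0"
  proof (rule AE_finite_allI)
    fix i assume "i \<in> {..<p}"
    then obtain C where C: "\<And>n. expectation (\<lambda>\<omega>. Au i n \<omega> ^ 4) \<le> C" using Au_fourth_moment by blast
    show "AE \<omega> in M. (\<lambda>N. mart (Au i) N \<omega> / real N) \<longlonglongrightarrow> 0"
      by (rule msum_strong_law[OF Au_F Au_L4 C eps_id_moments])
  qed simp
  have A2: "AE \<omega> in M. \<forall>i\<in>{..<p}. \<forall>j\<in>{..<p}.
      (\<lambda>N. (\<Sum>n<N. v i (Suc n) \<omega> * u j (Suc n) \<omega>) / real N) \<longlonglongrightarrow> 0"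
    by (intro AE_finite_allI v_cross[OF u_L4]) (auto intro: Cu)
  have A3: "AE \<omega> in M. \<forall>i\<in>{..<p}. \<forall>j\<in>{..<p}.
      (\<lambda>N. (\<Sum>n<N. v j (Suc n) \<omega> * z i (Suc n) \<omega>) / real N) \<longlonglongrightarrow> 0"
    by (intro AE_finite_allI v_cross[OF z_L4]) (auto intro: Cz)
  have A4: "AE \<omega> in M. \<forall>i\<in>{..<p}. (\<lambda>N. (u i N \<omega>)\<^sup>2 / real N) \<longlonglongrightarrow> 0"
    by (intro AE_finite_allI u_square_negligible) auto
  show ?thesis
    using A1 A2 A3 A4 eps_square_law
  proof eventually_elim
    case (elim \<omega>)
    let ?R = "\<lambda>N i j. (if j = 0 then mart (Au i) N \<omega> / real N else 0)
      + (if i = 0 then mart (Au j) N \<omega> / real N else 0)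
      + (if i = 0 \<and> j = 0 then (\<Sum>n<N. (\<epsilon> (Suc n) \<omega>)\<^sup>2) / real N else 0)
      + (\<Sum>n<N. v i (Suc n) \<omega> * u j (Suc n) \<omega>) / real N
      + (\<Sum>n<N. v j (Suc n) \<omega> * z i (Suc n) \<omega>) / real N
      - u i N \<omega> * u j N \<omega> / real N"
    have R: "(\<lambda>N. ?R N i j) \<longlonglongrightarrow> (if i = 0 \<and> j = 0 then 1 else 0)" if ij: "i < p" "j < p" for i j
    proof -
      have uu: "(\<lambda>N. u i N \<omega> * u j N \<omega> / real N) \<longlonglongrightarrow> 0"
      proof (rule Lim_null_comparison)
        have "(\<lambda>N. (u i N \<omega>)\<^sup>2 / real N + (u j N \<omega>)\<^sup>2 / real N) \<longlonglongrightarrow> 0 + 0"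
          using elim(4) ij by (intro tendsto_add) auto
        then show "(\<lambda>N. (u i N \<omega>)\<^sup>2 / real N + (u j N \<omega>)\<^sup>2 / real N) \<longlonglongrightarrow> 0" by simp
        have "\<bar>x * y\<bar> \<le> x\<^sup>2 + y\<^sup>2" for x y :: real
        proof -
          have "2 * (\<bar>x\<bar> * \<bar>y\<bar>) \<le> x\<^sup>2 + y\<^sup>2" using sum_squares_bound[of "\<bar>x\<bar>" "\<bar>y\<bar>"] by (simp add: mult.assoc)
          moreover have "0 \<le> \<bar>x\<bar> * \<bar>y\<bar>" by simp
          ultimately show ?thesis unfolding abs_mult by linarith
        qed
        then have "\<bar>u i N \<omega> * u j N \<omega>\<bar> / real N \<le> ((u i N \<omega>)\<^sup>2 + (u j N \<omega>)\<^sup>2) / real N" for N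
          by (intro divide_right_mono) auto
        then show "\<forall>\<^sub>F N in sequentially. norm (u i N \<omega> * u j N \<omega> / real N)
            \<le> (u i N \<omega>)\<^sup>2 / real N + (u j N \<omega>)\<^sup>2 / real N"
          by (simp add: abs_divide add_divide_distrib)
      qed
      have "(\<lambda>N. ?R N i j) \<longlonglongrightarrow> 0 + 0 + (if i = 0 \<and> j = 0 then 1 else 0) + 0 + 0 - 0"
      proof (intro tendsto_add tendsto_diff uu)
        show "(\<lambda>N. if j = 0 then mart (Au i) N \<omega> / real N else 0) \<longlonglongrightarrow> 0"
          "(\<lambda>N. if i = 0 then mart (Au j) N \<omega> / real N else 0) \<longlonglongrightarrow> 0"
          "(\<lambda>N. if i = 0 \<and> j = 0 then (\<Sum>n<N. (\<epsilon> (Suc n) \<omega>)\<^sup>2) / real N else 0)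
            \<longlonglongrightarrow> (if i = 0 \<and> j = 0 then 1 else 0)"
          using elim(1,5) ij by (cases "i = 0"; cases "j = 0"; simp)+
      qed (use elim(2,3) ij in auto)
      then show ?thesis by simp
    qed
    show ?case
      by (intro allI impI) (rule lyapunov_limit[where G = "\<lambda>N. G N \<omega>" and R = ?R, OF G_equation gram_eq R])
  qed
qed

theorem vector_quadratic_strong_law:
  "AE \<omega> in M. \<forall>i<p. \<forall>j<p.
    (\<lambda>N. (\<Sum>k<N. (mart (u i) k \<omega> / real k) * (mart (u j) k \<omega> / real k)) / ln (real N)) \<longlonglongrightarrow> gram i j"
proof -
  obtain Cu where Cu: "\<And>n i. i < p \<Longrightarrow> expectation (\<lambda>\<omega>. u i n \<omega> ^ 4) \<le> Cu" using u_fourth_moment by blast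
  have Q1: "AE \<omega> in M. \<forall>i\<in>{..<p}. (\<lambda>N. (\<Sum>k<N. (mart (u i) k \<omega> / real k)\<^sup>2) / ln (real N)) \<longlonglongrightarrow> gram i i"
  proof (rule AE_finite_allI)
    fix i assume i: "i \<in> {..<p}"
    have "AE \<omega> in M. (\<lambda>N. (\<Sum>k<N. (u i k \<omega>)\<^sup>2) / real N) \<longlonglongrightarrow> gram i i"
      using gram_law by eventually_elim (use i in \<open>simp add: G_def power2_eq_square\<close>)
    then show "AE \<omega> in M. (\<lambda>N. (\<Sum>k<N. (mart (u i) k \<omega> / real k)\<^sup>2) / ln (real N)) \<longlonglongrightarrow> gram i i"
      using i by (intro quadratic_strong_law[OF u_F u_L4 Cu]) auto
  qed simp
  have Q2: "AE \<omega> in M. \<forall>i\<in>{..<p}. \<forall>j\<in>{..<p}.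
      (\<lambda>N. (\<Sum>k<N. (mart (\<lambda>n \<omega>. u i n \<omega> + u j n \<omega>) k \<omega> / real k)\<^sup>2) / ln (real N))
        \<longlonglongrightarrow> gram i i + 2 * gram i j + gram j j"
  proof (intro AE_finite_allI)
    fix i j assume ij: "i \<in> {..<p}" "j \<in> {..<p}"
    let ?w = "\<lambda>n \<omega>. u i n \<omega> + u j n \<omega>"
    show "AE \<omega> in M. (\<lambda>N. (\<Sum>k<N. (mart ?w k \<omega> / real k)\<^sup>2) / ln (real N))
        \<longlonglongrightarrow> gram i i + 2 * gram i j + gram j j"
    proof (rule quadratic_strong_law)
      show "?w n \<in> borel_measurable (F n)" for n using u_F by measurable
      show "L4 M (?w n)" for n by (rule L4_add[OF u_L4 u_L4])
      show "expectation (\<lambda>\<omega>. ?w n \<omega> ^ 4) \<le> 8 * (Cu + Cu)" for n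
      proof -
        have "expectation (\<lambda>\<omega>. ?w n \<omega> ^ 4) \<le> expectation (\<lambda>\<omega>. 8 * (u i n \<omega> ^ 4 + u j n \<omega> ^ 4))"
          by (rule integral_mono[OF L4_integrable[OF L4_add[OF u_L4 u_L4]] _ quartic_bounds(4)])
            (intro integrable_mult_right Bochner_Integration.integrable_add L4_integrable u_L4)
        also have "\<dots> = 8 * (expectation (\<lambda>\<omega>. u i n \<omega> ^ 4) + expectation (\<lambda>\<omega>. u j n \<omega> ^ 4))"
          using L4_integrable[OF u_L4] by simp
        also have "\<dots> \<le> 8 * (Cu + Cu)" using ij by (intro mult_left_mono add_mono Cu) auto
        finally show ?thesis .
      qed
      show "AE \<omega> in M. (\<lambda>N. (\<Sum>k<N. (?w k \<omega>)\<^sup>2) / real N) \<longlonglongrightarrow> gram i i + 2 * gram i j + gram j j"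
        using gram_law
      proof eventually_elim
        case (elim \<omega>)
        have "(\<lambda>N. G N \<omega> i i + 2 * G N \<omega> i j + G N \<omega> j j) \<longlonglongrightarrow> gram i i + 2 * gram i j + gram j j"
          using elim ij by (intro tendsto_intros) auto
        moreover have "(\<Sum>k<N. (?w k \<omega>)\<^sup>2) / real N = G N \<omega> i i + 2 * G N \<omega> i j + G N \<omega> j j" for N
          by (simp add: G_def power2_eq_square algebra_simps sum.distrib add_divide_distrib
              flip: sum_distrib_left)
        ultimately show ?case by simp
      qed
    qed
  qed simp_all
  show ?thesis
    using Q1 Q2
  proof eventually_elim
    case (elim \<omega>)
    show ?case
    proof (intro allI impI)
      fix i j assume ij: "i < p" "j < p"
      let ?m = "\<lambda>i k. mart (u i) k \<omega> / real k"
      have "(\<lambda>N. ((\<Sum>k<N. (mart (\<lambda>n \<omega>. u i n \<omega> + u j n \<omega>) k \<omega> / real k)\<^sup>2) / ln (real N)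
          - (\<Sum>k<N. (?m i k)\<^sup>2) / ln (real N) - (\<Sum>k<N. (?m j k)\<^sup>2) / ln (real N)) / 2)
        \<longlonglongrightarrow> (gram i i + 2 * gram i j + gram j j - gram i i - gram j j) / 2"
        using elim ij by (intro tendsto_intros) auto
      moreover have "((\<Sum>k<N. (mart (\<lambda>n \<omega>. u i n \<omega> + u j n \<omega>) k \<omega> / real k)\<^sup>2) / ln (real N)
          - (\<Sum>k<N. (?m i k)\<^sup>2) / ln (real N) - (\<Sum>k<N. (?m j k)\<^sup>2) / ln (real N)) / 2
          = (\<Sum>k<N. ?m i k * ?m j k) / ln (real N)" for N
      proof -
        have mm: "mart (\<lambda>n \<omega>. u i n \<omega> + u j n \<omega>) k \<omega> / real k = ?m i k + ?m j k" for k
          by (simp add: msum_def distrib_right sum.distrib add_divide_distrib)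
        have "(\<Sum>k<N. (x k + y k)\<^sup>2) = (\<Sum>k<N. (x k)\<^sup>2) + (\<Sum>k<N. (y k)\<^sup>2) + 2 * (\<Sum>k<N. x k * y k)"
          for x y :: "nat \<Rightarrow> real"
          by (simp add: power2_sum sum.distrib mult.assoc flip: sum_distrib_left)
        from this[of "?m i" "?m j"] show ?thesis unfolding mm by (simp add: add_divide_distrib)
      qed
      ultimately show "(\<lambda>N. (\<Sum>k<N. ?m i k * ?m j k) / ln (real N)) \<longlonglongrightarrow> gram i j" by simp
    qed
  qed
qed

end

subsection \<open>The Durbin--Levinson recursion\<close>

locale innovation_process = gaussian_noise M \<epsilon>
  for M :: "'a measure" and \<epsilon> +
  fixes \<xi> :: "nat \<Rightarrow> 'a \<Rightarrow> real" and \<sigma> :: "nat \<Rightarrow> real" and k :: "nat \<Rightarrow> nat \<Rightarrow> real"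
  assumes stationary: "stationary_process M \<xi>"
    and sig_pos: "\<And>n. n \<ge> 1 \<Longrightarrow> \<sigma> n > 0"
    and coeffs: "innovation_coeffs M \<xi> \<sigma> \<epsilon> k"
begin

lemma k_diag: "n \<ge> 1 \<Longrightarrow> k n n = 1"
  using coeffs by (simp add: innovation_coeffs_def)

text \<open>Inverting the triangular system gives a version of the noise that is a function of the
  innovations everywhere, not only almost surely.\<close>

fun x :: "nat \<Rightarrow> 'a \<Rightarrow> real" where
  "x n \<omega> = \<sigma> n * \<epsilon> n \<omega> - (\<Sum>i\<in>{1..<n}. k n i * x i \<omega>)"

declare x.simps [simp del]

lemma x_eq: "AE \<omega> in M. \<forall>n\<ge>1. \<xi> n \<omega> = x n \<omega>"
proof -
  have "AE \<omega> in M. \<forall>n. n \<ge> 1 \<longrightarrow> \<sigma> n * \<epsilon> n \<omega> = (\<Sum>i=1..n. k n i * \<xi> i \<omega>)"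
    using coeffs unfolding innovation_coeffs_def AE_all_countable by (auto intro: AE_impI)
  then show ?thesis
  proof eventually_elim
    case (elim \<omega>)
    have "n \<ge> 1 \<Longrightarrow> \<xi> n \<omega> = x n \<omega>" for n
    proof (induction n rule: less_induct)
      case (less n)
      have "{1..n} = insert n {1..<n}" using less.prems by auto
      then have "\<sigma> n * \<epsilon> n \<omega> = \<xi> n \<omega> + (\<Sum>i\<in>{1..<n}. k n i * \<xi> i \<omega>)"
        using elim[rule_format, OF less.prems] k_diag[OF less.prems] by simp
      moreover have "(\<Sum>i\<in>{1..<n}. k n i * \<xi> i \<omega>) = (\<Sum>i\<in>{1..<n}. k n i * x i \<omega>)"
        using less.IH by (intro sum.cong) auto
      ultimately show ?case by (simp add: x.simps[of n])
    qed
    then show ?case by blast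
  qed
qed

lemma x_innovation:
  assumes "n \<ge> 1"
  shows "(\<Sum>i=1..n. k n i * x i \<omega>) = \<sigma> n * \<epsilon> n \<omega>"
proof -
  have "{1..n} = insert n {1..<n}" using assms by auto
  then show ?thesis using k_diag[OF assms] by (simp add: x.simps[of n])
qed

lemma x_F: "n \<ge> 1 \<Longrightarrow> x n \<in> borel_measurable (F n)"
proof (induction n rule: less_induct)
  case (less n)
  have "x i \<in> borel_measurable (F n)" if "i \<in> {1..<n}" for i
    using less.IH[of i] F_mono[of i n] that by auto
  then show ?case
    unfolding x.simps[of n, abs_def] using eps_F[of n n] less.prems
    by (intro borel_measurable_diff borel_measurable_sum borel_measurable_times borel_measurable_const) auto
qed

lemma x_L4: "n \<ge> 1 \<Longrightarrow> L4 M (x n)"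
proof (induction n rule: less_induct)
  case (less n)
  show ?case
    unfolding x.simps[of n, abs_def]
    by (intro L4_diff L4_cmult eps_L4 L4_sum less) auto
qed

section \<open>Covariances and the normal equations\<close>

lemma x_integrable: "i \<ge> 1 \<Longrightarrow> j \<ge> 1 \<Longrightarrow> integrable M (\<lambda>\<omega>. x i \<omega> * x j \<omega>)"
  and x_eps_integrable: "i \<ge> 1 \<Longrightarrow> j \<ge> 1 \<Longrightarrow> integrable M (\<lambda>\<omega>. x i \<omega> * \<epsilon> j \<omega>)"
  by (intro L4_products(4) x_L4 eps_L4; assumption)+

definition \<gamma> :: "nat \<Rightarrow> nat \<Rightarrow> real" where "\<gamma> i j = expectation (\<lambda>\<omega>. x i \<omega> * x j \<omega>)"

lemma gamma_sym: "\<gamma> i j = \<gamma> j i"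
  by (simp add: \<gamma>_def mult.commute)

text \<open>Stationarity is an equality of joint laws of \<open>\<xi>\<close>. It reaches the
  version \<open>x\<close> through the almost sure equality of the two and a change of variables for
  the product of two coordinates.\<close>

lemma gamma_shift:
  assumes ij: "i \<ge> 1" "j \<ge> 1"
  shows "\<gamma> (i + h) (j + h) = \<gamma> i j"
proof -
  let ?J = "{i, j}" and ?P = "Pi\<^sub>M {i, j} (\<lambda>_. borel :: real measure)"
  have xm: "\<xi> n \<in> borel_measurable M" if "n \<ge> 1" for n
    using stationary that by (simp add: stationary_process_def)
  have meas: "(\<lambda>\<omega>. \<lambda>n\<in>?J. \<xi> (n + h) \<omega>) \<in> measurable M ?P" for h
    using ij by (intro measurable_restrict xm) auto
  have phi: "(\<lambda>y. y i * y j) \<in> borel_measurable ?P"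
    by (intro borel_measurable_times) (auto intro!: measurable_component_singleton)
  have ex: "\<gamma> (i + h) (j + h) = integral\<^sup>L (distr M ?P (\<lambda>\<omega>. \<lambda>n\<in>?J. \<xi> (n + h) \<omega>)) (\<lambda>y. y i * y j)" for h
  proof -
    have "\<gamma> (i + h) (j + h) = expectation (\<lambda>\<omega>. \<xi> (i + h) \<omega> * \<xi> (j + h) \<omega>)"
      unfolding \<gamma>_def
    proof (rule integral_cong_AE)
      show "AE \<omega> in M. x (i + h) \<omega> * x (j + h) \<omega> = \<xi> (i + h) \<omega> * \<xi> (j + h) \<omega>"
        using x_eq by eventually_elim (use ij in simp)
    qed (use ij x_integrable[of "i + h" "j + h"] xm in auto)
    also have "\<dots> = integral\<^sup>L (distr M ?P (\<lambda>\<omega>. \<lambda>n\<in>?J. \<xi> (n + h) \<omega>)) (\<lambda>y. y i * y j)"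
      by (subst integral_distr[OF meas phi]) simp
    finally show ?thesis .
  qed
  have "distr M ?P (\<lambda>\<omega>. \<lambda>n\<in>?J. \<xi> (n + h) \<omega>) = distr M ?P (\<lambda>\<omega>. \<lambda>n\<in>?J. \<xi> (n + 0) \<omega>)"
    using stationary ij unfolding stationary_process_def by simp
  then show ?thesis using ex[of h] ex[of 0] by simp
qed

definition \<rho> :: "nat \<Rightarrow> real" where "\<rho> d = \<gamma> 1 (1 + d)"

lemma gamma_rho:
  assumes "i \<ge> 1" "j \<ge> 1"
  shows "\<gamma> i j = \<rho> (if i \<le> j then j - i else i - j)"
proof -
  have "\<gamma> i (i + d) = \<rho> d" if "i \<ge> 1" for i d
    using gamma_shift[of 1 "1 + d" "i - 1"] that by (simp add: \<rho>_def add.commute)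
  from this[of i "j - i"] this[of j "i - j"] show ?thesis
    using assms gamma_sym[of i j] by auto
qed

lemma x_eps_past:
  assumes "1 \<le> j" "j < n"
  shows "expectation (\<lambda>\<omega>. x j \<omega> * \<epsilon> n \<omega>) = 0"
proof -
  obtain m where m: "n = Suc m" "j \<le> m" using assms by (cases n) auto
  have "x j \<in> borel_measurable (F m)" using F_mono[OF m(2) x_F] assms by simp
  from expectation_next(2)[OF this L4_products(6)[OF x_L4 x_L4], of j "\<lambda>x. x"]
  show ?thesis using m assms eps_moments(1)[of n] eps_integrable[of n 1] by simp
qed

lemma x_eps_present:
  assumes "n \<ge> 1"
  shows "expectation (\<lambda>\<omega>. x n \<omega> * \<epsilon> n \<omega>) = \<sigma> n"
proof -
  have "x n \<omega> * \<epsilon> n \<omega> = \<sigma> n * (\<epsilon> n \<omega>)\<^sup>2 - (\<Sum>i\<in>{1..<n}. k n i * (x i \<omega> * \<epsilon> n \<omega>))" for \<omega>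
    by (subst x.simps) (simp add: left_diff_distrib power2_eq_square sum_distrib_right mult.assoc)
  then have eq: "(\<lambda>\<omega>. x n \<omega> * \<epsilon> n \<omega>)
      = (\<lambda>\<omega>. \<sigma> n * (\<epsilon> n \<omega>)\<^sup>2 - (\<Sum>i\<in>{1..<n}. k n i * (x i \<omega> * \<epsilon> n \<omega>)))" by blast
  have I: "integrable M (\<lambda>\<omega>. k n i * (x i \<omega> * \<epsilon> n \<omega>))" if "i \<in> {1..<n}" for i
    using that by (intro integrable_mult_right x_eps_integrable) auto
  have "expectation (\<lambda>\<omega>. x n \<omega> * \<epsilon> n \<omega>) = expectation (\<lambda>\<omega>. \<sigma> n * (\<epsilon> n \<omega>)\<^sup>2)
      - expectation (\<lambda>\<omega>. \<Sum>i\<in>{1..<n}. k n i * (x i \<omega> * \<epsilon> n \<omega>))"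
    unfolding eq
    by (intro Bochner_Integration.integral_diff integrable_mult_right eps_integrable[OF assms]
        Bochner_Integration.integrable_sum I)
  also have "expectation (\<lambda>\<omega>. \<Sum>i\<in>{1..<n}. k n i * (x i \<omega> * \<epsilon> n \<omega>))
      = (\<Sum>i\<in>{1..<n}. expectation (\<lambda>\<omega>. k n i * (x i \<omega> * \<epsilon> n \<omega>)))"
    by (rule Bochner_Integration.integral_sum[OF I])
  also have "\<dots> = 0" using x_eps_past by simp
  finally show ?thesis using eps_moments(2)[OF assms] by simp
qed

text \<open>The innovation is uncorrelated with the strictly earlier noise and has covariance
  sigma_n^2 with x_n: these are the Yule--Walker equations for row \<open>n\<close> of
  \<open>k\<close>.\<close>

lemma normal_equations:
  assumes "1 \<le> j" "j \<le> n"
  shows "(\<Sum>i=1..n. k n i * \<gamma> i j) = (if j = n then (\<sigma> n)\<^sup>2 else 0)"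
proof -
  have "(\<Sum>i=1..n. k n i * \<gamma> i j) = (\<Sum>i=1..n. expectation (\<lambda>\<omega>. k n i * (x i \<omega> * x j \<omega>)))"
    by (simp add: \<gamma>_def)
  also have "\<dots> = expectation (\<lambda>\<omega>. \<Sum>i=1..n. k n i * (x i \<omega> * x j \<omega>))"
    using assms
    by (intro Bochner_Integration.integral_sum[symmetric] integrable_mult_right x_integrable) auto
  also have "\<dots> = expectation (\<lambda>\<omega>. \<sigma> n * (x j \<omega> * \<epsilon> n \<omega>))"
  proof (rule Bochner_Integration.integral_cong[OF refl])
    fix \<omega>
    have "(\<Sum>i=1..n. k n i * (x i \<omega> * x j \<omega>)) = (\<Sum>i=1..n. k n i * x i \<omega>) * x j \<omega>"
      by (simp add: sum_distrib_right mult.assoc)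
    then show "(\<Sum>i=1..n. k n i * (x i \<omega> * x j \<omega>)) = \<sigma> n * (x j \<omega> * \<epsilon> n \<omega>)"
      using x_innovation[of n \<omega>] assms by simp
  qed
  also have "\<dots> = (if j = n then (\<sigma> n)\<^sup>2 else 0)"
    using x_eps_past[of j n] x_eps_present[of n] assms by (simp add: power2_eq_square)
  finally show ?thesis .
qed

text \<open>Such a \<open>d\<close> gives a combination of variance zero. Testing it against the
  innovation at the largest index with nonzero coefficient isolates that coefficient, because
  earlier noise is uncorrelated with this innovation.\<close>

lemma covariance_nondegenerate:
  assumes d: "\<And>j. 1 \<le> j \<Longrightarrow> j \<le> n \<Longrightarrow> (\<Sum>i=1..n. d i * \<gamma> i j) = 0"
    and i: "1 \<le> i" "i \<le> n"
  shows "d i = 0"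
proof (rule ccontr)
  assume "d i \<noteq> 0"
  define V where "V \<omega> = (\<Sum>i=1..n. d i * x i \<omega>)" for \<omega>
  have VL: "L4 M V" unfolding V_def by (intro L4_sum L4_cmult x_L4) auto
  have VV: "(V \<omega>)\<^sup>2 = (\<Sum>j=1..n. \<Sum>i=1..n. d j * (d i * (x i \<omega> * x j \<omega>)))" for \<omega>
    by (simp add: V_def power2_eq_square sum_product mult_ac)
  have "expectation (\<lambda>\<omega>. (V \<omega>)\<^sup>2) = (\<Sum>j=1..n. \<Sum>i=1..n. expectation (\<lambda>\<omega>. d j * (d i * (x i \<omega> * x j \<omega>))))"
  proof -
    have I: "integrable M (\<lambda>\<omega>. d j * (d i * (x i \<omega> * x j \<omega>)))" if "i \<in> {1..n}" "j \<in> {1..n}" for i j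
      using that by (intro integrable_mult_right x_integrable) auto
    have "expectation (\<lambda>\<omega>. (V \<omega>)\<^sup>2) = (\<Sum>j=1..n. expectation (\<lambda>\<omega>. \<Sum>i=1..n. d j * (d i * (x i \<omega> * x j \<omega>))))"
      unfolding VV by (intro Bochner_Integration.integral_sum Bochner_Integration.integrable_sum I)
    also have "\<dots> = (\<Sum>j=1..n. \<Sum>i=1..n. expectation (\<lambda>\<omega>. d j * (d i * (x i \<omega> * x j \<omega>))))"
      by (intro sum.cong refl Bochner_Integration.integral_sum I)
    finally show ?thesis .
  qed
  also have "\<dots> = (\<Sum>j=1..n. d j * (\<Sum>i=1..n. d i * \<gamma> i j))"
    by (simp add: \<gamma>_def sum_distrib_left)
  also have "\<dots> = 0" using d by simp
  finally have "AE \<omega> in M. (V \<omega>)\<^sup>2 = 0"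
    using integral_nonneg_eq_0_iff_AE[OF L4_products(5)[OF VL VL]] by simp
  then have V0: "AE \<omega> in M. V \<omega> = 0" by simp
  define m where "m = Max {i\<in>{1..n}. d i \<noteq> 0}"
  have ne: "{i\<in>{1..n}. d i \<noteq> 0} \<noteq> {}" using i \<open>d i \<noteq> 0\<close> by auto
  have m: "m \<in> {i\<in>{1..n}. d i \<noteq> 0}" unfolding m_def by (rule Max_in[OF _ ne]) simp
  have top: "d j = 0" if "m < j" "j \<le> n" for j
  proof (rule ccontr)
    assume "d j \<noteq> 0"
    then have "j \<le> m" unfolding m_def using that by (intro Max_ge) auto
    then show False using that by simp
  qed
  have "0 = expectation (\<lambda>\<omega>. V \<omega> * \<epsilon> m \<omega>)"
  proof -
    have "expectation (\<lambda>\<omega>. V \<omega> * \<epsilon> m \<omega>) = expectation (\<lambda>\<omega>. 0)"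
      using V0 L4_measurable[OF VL] eps_measurable[of m] m
      by (intro integral_cong_AE) (auto elim: eventually_mono)
    then show ?thesis by simp
  qed
  also have "\<dots> = expectation (\<lambda>\<omega>. \<Sum>i=1..n. d i * (x i \<omega> * \<epsilon> m \<omega>))"
    by (simp add: V_def sum_distrib_right mult.assoc)
  also have "\<dots> = (\<Sum>i=1..n. expectation (\<lambda>\<omega>. d i * (x i \<omega> * \<epsilon> m \<omega>)))"
    using m by (intro Bochner_Integration.integral_sum integrable_mult_right x_eps_integrable) auto
  also have "\<dots> = (\<Sum>i=1..n. if i = m then d m * \<sigma> m else 0)"
  proof (rule sum.cong[OF refl])
    fix i assume i: "i \<in> {1..n}"
    consider "i < m" | "i = m" | "m < i" by linarith
    then show "expectation (\<lambda>\<omega>. d i * (x i \<omega> * \<epsilon> m \<omega>)) = (if i = m then d m * \<sigma> m else 0)"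
      using i m top[of i] x_eps_past[of i m] x_eps_present[of m] by cases auto
  qed
  also have "\<dots> = d m * \<sigma> m" using m by simp
  finally show False using m sig_pos[of m] by auto
qed

text \<open>The Durbin--Levinson recursion: the new innovation is the shifted old one minus a multiple of
  the backward prediction error, whose coefficients are the old ones in reverse order.\<close>

theorem durbin_levinson:
  assumes n: "n \<ge> 1"
  shows "\<And>i. 1 \<le> i \<Longrightarrow> i \<le> Suc n \<Longrightarrow> k (Suc n) i = (if i = 1 then 0 else k n (i - 1))
      - pacf k n * (if i = Suc n then 0 else k n (Suc n - i))"
    and "(\<sigma> (Suc n))\<^sup>2 = (\<sigma> n)\<^sup>2 * (1 - (pacf k n)\<^sup>2)"
proof -
  \<comment> \<open>The value that makes the candidate row \<open>k'\<close> orthogonal to x_1.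
    Orthogonality to x_2, ..., x_n holds for each of its two parts separately.\<close>
  define c where "c = (\<Sum>i=1..n. k n i * \<gamma> (Suc i) 1) / (\<sigma> n)\<^sup>2"
  define k' where "k' i = (if i = 1 then 0 else k n (i - 1)) - c * (if i = Suc n then 0 else k n (Suc n - i))" for i
  have s: "\<sigma> n > 0" by (rule sig_pos[OF n])
  have sum1: "(\<Sum>i=1..Suc n. (if i = 1 then 0 else k n (i - 1)) * \<gamma> i j) = (\<Sum>i=1..n. k n i * \<gamma> (Suc i) j)" for j
  proof -
    have "(\<Sum>i=1..Suc n. (if i = 1 then 0 else k n (i - 1)) * \<gamma> i j)
        = (\<Sum>i=Suc 1..Suc n. (if i = 1 then 0 else k n (i - 1)) * \<gamma> i j)"
      by (subst sum.atLeast_Suc_atMost) auto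
    also have "\<dots> = (\<Sum>i=1..n. k n i * \<gamma> (Suc i) j)"
      by (subst sum.shift_bounds_cl_Suc_ivl) (auto intro: sum.cong)
    finally show ?thesis .
  qed
  have sum2: "(\<Sum>i=1..Suc n. (if i = Suc n then 0 else k n (Suc n - i)) * \<gamma> i j)
      = (\<Sum>i=1..n. k n i * \<gamma> i (Suc n - j))" if j: "1 \<le> j" "j \<le> n" for j
  proof -
    have "(\<Sum>i=1..Suc n. (if i = Suc n then 0 else k n (Suc n - i)) * \<gamma> i j)
        = (\<Sum>i=1..n. k n (Suc n - i) * \<gamma> i j)"
      by (auto intro: sum.cong)
    also have "\<dots> = (\<Sum>i=1..n. k n i * \<gamma> (Suc n - i) j)"
      by (rule sum.reindex_bij_witness[of _ "\<lambda>i. Suc n - i" "\<lambda>i. Suc n - i"]) auto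
    \<comment> \<open>Time reversal: covariances depend on the lag only.\<close>
    also have "\<dots> = (\<Sum>i=1..n. k n i * \<gamma> i (Suc n - j))"
    proof (rule sum.cong[OF refl])
      fix i assume i: "i \<in> {1..n}"
      have "(if Suc n - i \<le> j then j - (Suc n - i) else Suc n - i - j)
          = (if i \<le> Suc n - j then Suc n - j - i else i - (Suc n - j))"
        using i j by auto
      moreover have "1 \<le> Suc n - i" "1 \<le> i" "1 \<le> Suc n - j" using i j by auto
      ultimately show "k n i * \<gamma> (Suc n - i) j = k n i * \<gamma> i (Suc n - j)"
        using j by (simp only: gamma_rho)
    qed
    finally show ?thesis .
  qed
  have shift: "(\<Sum>i=1..n. k n i * \<gamma> (Suc i) (Suc j)) = (if j = n then (\<sigma> n)\<^sup>2 else 0)" if "1 \<le> j" "j \<le> n" for j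
  proof -
    have "(\<Sum>i=1..n. k n i * \<gamma> (Suc i) (Suc j)) = (\<Sum>i=1..n. k n i * \<gamma> i j)"
      using gamma_shift[of _ j 1] that by (intro sum.cong) auto
    then show ?thesis using normal_equations[OF that] by simp
  qed
  have csum: "(\<Sum>i=1..n. k n i * \<gamma> (Suc i) 1) = c * (\<sigma> n)\<^sup>2" using s by (simp add: c_def)
  have split: "(\<Sum>i=1..Suc n. k' i * \<gamma> i j) = (\<Sum>i=1..Suc n. (if i = 1 then 0 else k n (i - 1)) * \<gamma> i j)
      - c * (\<Sum>i=1..Suc n. (if i = Suc n then 0 else k n (Suc n - i)) * \<gamma> i j)" for j
    unfolding k'_def left_diff_distrib sum_subtractf mult.assoc sum_distrib_left[symmetric] ..
  have orth: "(\<Sum>i=1..Suc n. k' i * \<gamma> i j) = 0" if j: "1 \<le> j" "j \<le> n" for j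
  proof (cases "j = 1")
    case True
    have "(\<Sum>i=1..n. k n i * \<gamma> i n) = (\<sigma> n)\<^sup>2" using normal_equations[of n n] n by simp
    then show ?thesis unfolding split sum1 sum2[OF j] using csum True by simp
  next
    case False
    have "(\<Sum>i=1..n. k n i * \<gamma> (Suc i) j) = 0" using shift[of "j - 1"] False j by simp
    moreover have "(\<Sum>i=1..n. k n i * \<gamma> i (Suc n - j)) = 0"
      using normal_equations[of "Suc n - j" n] False j by simp
    ultimately show ?thesis unfolding split sum1 sum2[OF j] by simp
  qed
  \<comment> \<open>Both rows end in 1, so their difference involves x_1, ..., x_n only and
    nondegeneracy up to \<open>n\<close> suffices.\<close>
  have top: "k' (Suc n) = k (Suc n) (Suc n)" using n k_diag[of n] k_diag[of "Suc n"] by (simp add: k'_def)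
  have eq: "k (Suc n) i = k' i" if i: "1 \<le> i" "i \<le> Suc n" for i
  proof (cases "i = Suc n")
    case True
    then show ?thesis using top by simp
  next
    case False
    have "(\<lambda>i. k (Suc n) i - k' i) i = 0"
    proof (rule covariance_nondegenerate[where n = n])
      fix j assume j: "1 \<le> j" "j \<le> n"
      have "(\<Sum>i=1..Suc n. (k (Suc n) i - k' i) * \<gamma> i j) = 0"
        unfolding left_diff_distrib sum_subtractf orth[OF j]
        using normal_equations[of j "Suc n"] j by simp
      then show "(\<Sum>i=1..n. (k (Suc n) i - k' i) * \<gamma> i j) = 0" using top by simp
    qed (use i False in auto)
    then show ?thesis by simp
  qed
  \<comment> \<open>At \<open>i = 1\<close> the recursion reads k (n+1) 1 = - c k n n = - c.\<close>
  have pc: "pacf k n = c" using eq[of 1] n k_diag[OF n] by (simp add: pacf_def k'_def)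
  show "k (Suc n) i = (if i = 1 then 0 else k n (i - 1)) - pacf k n * (if i = Suc n then 0 else k n (Suc n - i))"
    if "1 \<le> i" "i \<le> Suc n" for i
    using eq[OF that] by (simp add: k'_def pc)
  have last: "(\<Sum>i=1..Suc n. (if i = Suc n then 0 else k n (Suc n - i)) * \<gamma> i (Suc n)) = c * (\<sigma> n)\<^sup>2"
  proof -
    have "(\<Sum>i=1..Suc n. (if i = Suc n then 0 else k n (Suc n - i)) * \<gamma> i (Suc n))
        = (\<Sum>i=1..n. k n (Suc n - i) * \<gamma> i (Suc n))"
      by (auto intro: sum.cong)
    also have "\<dots> = (\<Sum>i=1..n. k n i * \<gamma> (Suc n - i) (Suc n))"
      by (rule sum.reindex_bij_witness[of _ "\<lambda>i. Suc n - i" "\<lambda>i. Suc n - i"]) auto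
    also have "\<dots> = (\<Sum>i=1..n. k n i * \<gamma> (Suc i) 1)"
    proof (rule sum.cong[OF refl])
      fix i assume i: "i \<in> {1..n}"
      have "1 \<le> Suc n - i" "Suc n - (Suc n - i) = i" using i by auto
      then show "k n i * \<gamma> (Suc n - i) (Suc n) = k n i * \<gamma> (Suc i) 1"
        using gamma_rho[of "Suc n - i" "Suc n"] gamma_rho[of "Suc i" 1] by auto
    qed
    finally show ?thesis using csum by simp
  qed
  have "(\<sigma> (Suc n))\<^sup>2 = (\<Sum>i=1..Suc n. k (Suc n) i * \<gamma> i (Suc n))"
    using normal_equations[of "Suc n" "Suc n"] by simp
  also have "\<dots> = (\<Sum>i=1..Suc n. k' i * \<gamma> i (Suc n))" by (intro sum.cong refl) (simp add: eq)
  also have "\<dots> = (\<sigma> n)\<^sup>2 - c * (c * (\<sigma> n)\<^sup>2)"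
    unfolding split last sum1 using shift[of n] n by simp
  finally show "(\<sigma> (Suc n))\<^sup>2 = (\<sigma> n)\<^sup>2 * (1 - (pacf k n)\<^sup>2)"
    by (simp add: pc power2_eq_square algebra_simps)
qed

text \<open>The reversed row defines a backward filter \<open>R\<close>, which starts at zero and at
  each step loses \<open>pacf\<close> times the forward filter; so it is minus the accumulated sum.
  For the regression vectors as \<open>Y\<close> the right-hand side is Z_n + beta_n S_n, which is
  how U_n arises.\<close>

lemma filtered_recursion:
  fixes Y :: "nat \<Rightarrow> real"
  assumes n: "n \<ge> 1"
  shows "(\<Sum>i=1..n. k (Suc n) (Suc i) * Y i) = (\<Sum>i=1..n. k n i * Y i)
    + pacf k n * (\<Sum>j\<in>{1..<n}. pacf k j * (\<Sum>i=1..j. k j i * Y i))"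
proof -
  define Zf where "Zf n = (\<Sum>i=1..n. k n i * Y i)" for n
  define R where "R n = (\<Sum>i=1..n. (if i = n then 0 else k n (n - i)) * Y i)" for n
  have RS: "R (Suc n) = R n - pacf k n * Zf n" if n: "n \<ge> 1" for n
  proof -
    have "R (Suc n) = (\<Sum>i=1..n. k (Suc n) (Suc n - i) * Y i)"
      unfolding R_def by (auto intro: sum.cong)
    also have "\<dots> = (\<Sum>i=1..n. ((if i = n then 0 else k n (n - i)) - pacf k n * k n i) * Y i)"
    proof (rule sum.cong[OF refl])
      fix i assume i: "i \<in> {1..n}"
      then show "k (Suc n) (Suc n - i) * Y i = ((if i = n then 0 else k n (n - i)) - pacf k n * k n i) * Y i"
        using durbin_levinson(1)[OF n, of "Suc n - i"] by (auto simp: Suc_diff_le)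
    qed
    finally show ?thesis
      unfolding R_def Zf_def left_diff_distrib sum_subtractf mult.assoc sum_distrib_left[symmetric] .
  qed
  have R: "R n = - (\<Sum>j\<in>{1..<n}. pacf k j * Zf j)" if "n \<ge> 1" for n
    using that
  proof (induction n rule: dec_induct)
    case (step n)
    have "{1..<Suc n} = insert n {1..<n}" using step by auto
    then show ?case using step RS[of n] by simp
  qed (simp add: R_def)
  have "(\<Sum>i=1..n. k (Suc n) (Suc i) * Y i)
      = (\<Sum>i=1..n. (k n i - pacf k n * (if i = n then 0 else k n (n - i))) * Y i)"
    by (intro sum.cong refl) (use durbin_levinson(1)[OF n] in auto)
  also have "\<dots> = Zf n - pacf k n * R n"
    unfolding R_def Zf_def left_diff_distrib sum_subtractf mult.assoc sum_distrib_left[symmetric] ..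
  finally show ?thesis unfolding R[OF n] by (simp add: Zf_def)
qed

end

subsection \<open>The estimation error\<close>

text \<open>The averages of the estimator run over 1, ..., n and match the idealised terms only
  eventually. The finitely many discrepancies cost a constant, the shifted range one more summand,
  which is harmless because ln (n + 1) / ln n tends to 1.\<close>

lemma log_average_shift:
  fixes e y :: "nat \<Rightarrow> real"
  assumes y: "(\<lambda>n. (\<Sum>k<n. y k) / ln (real n)) \<longlonglongrightarrow> L"
    and ev: "\<forall>\<^sub>F k in sequentially. e k = y k"
  shows "(\<lambda>n. (\<Sum>k=1..n. e k) / ln (real n)) \<longlonglongrightarrow> L"
proof -
  obtain K where K: "\<And>k. k \<ge> K \<Longrightarrow> e k = y k" using ev by (auto simp: eventually_sequentially)
  define D where "D = (\<Sum>k<K. e k - y k) - e 0"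
  have eq: "(\<Sum>k=1..n. e k) = (\<Sum>k<n. y k) + y n + D" if "n \<ge> K" for n
  proof -
    have "(\<Sum>k<Suc n. e k - y k) = (\<Sum>k<K. e k - y k)"
      using that K by (intro sum.mono_neutral_right) auto
    then have "(\<Sum>k<Suc n. e k) = (\<Sum>k<Suc n. y k) + (\<Sum>k<K. e k - y k)"
      by (simp add: sum_subtractf)
    moreover have "(\<Sum>k<Suc n. e k) = e 0 + (\<Sum>k=1..n. e k)"
      by (subst sum.lessThan_Suc_shift) (simp add: sum.atLeast1_atMost_eq)
    ultimately show ?thesis by (simp add: D_def)
  qed
  have inf: "filterlim (\<lambda>n. ln (real n)) at_infinity sequentially"
    by (rule filterlim_mono[OF ln_real_at_top]) (auto simp: at_top_le_at_infinity)
  have ratio: "(\<lambda>n. ln (real (Suc n)) / ln (real n)) \<longlonglongrightarrow> 1"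
  proof -
    have "(\<lambda>n. 1 + ln (real (Suc n) / real n) / ln (real n)) \<longlonglongrightarrow> 1 + 0"
      by (intro tendsto_add tendsto_const tendsto_divide_0[OF _ inf])
        (rule tendsto_ln[OF LIMSEQ_Suc_n_over_n], simp)
    then have "(\<lambda>n. 1 + ln (real (Suc n) / real n) / ln (real n)) \<longlonglongrightarrow> 1" by simp
    then show ?thesis
    proof (rule Lim_transform_eventually)
      show "\<forall>\<^sub>F n in sequentially. 1 + ln (real (Suc n) / real n) / ln (real n) = ln (real (Suc n)) / ln (real n)"
        using eventually_gt_at_top[of 1]
      proof eventually_elim
        case (elim n)
        have "ln (real (Suc n) / real n) = ln (real (Suc n)) - ln (real n)"
          using elim by (subst ln_div) simp_all
        moreover have "ln (real n) > 0" using elim by simp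
        ultimately show ?case by (simp add: field_simps del: of_nat_Suc)
      qed
    qed
  qed
  have "(\<lambda>n. (\<Sum>k<Suc n. y k) / ln (real (Suc n)) * (ln (real (Suc n)) / ln (real n)) + D / ln (real n))
      \<longlonglongrightarrow> L * 1 + 0"
    by (intro tendsto_add tendsto_mult ratio tendsto_divide_0[OF tendsto_const inf] LIMSEQ_Suc[OF y])
  then have "(\<lambda>n. (\<Sum>k<Suc n. y k) / ln (real (Suc n)) * (ln (real (Suc n)) / ln (real n)) + D / ln (real n))
      \<longlonglongrightarrow> L" by simp
  then show ?thesis
  proof (rule Lim_transform_eventually)
    show "\<forall>\<^sub>F n in sequentially. (\<Sum>k<Suc n. y k) / ln (real (Suc n)) * (ln (real (Suc n)) / ln (real n))
        + D / ln (real n) = (\<Sum>k=1..n. e k) / ln (real n)"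
      using eventually_gt_at_top[of 1] eventually_ge_at_top[of K]
    proof eventually_elim
      case (elim n)
      have l: "ln (real (Suc n)) > 0" using elim by simp
      have "(\<Sum>k<Suc n. y k) / ln (real (Suc n)) * (ln (real (Suc n)) / ln (real n))
          = (\<Sum>k<Suc n. y k) / ln (real n)"
        using l by (simp del: of_nat_Suc sum.lessThan_Suc)
      then show ?case unfolding eq[OF elim(2)] by (simp add: add_divide_distrib)
    qed
  qed
qed

text \<open>Expanding the product leaves finitely many scalar averages with convergent weights.
  Their summands may change sign, and |s t| \<le> s^2 + t^2 bounds the absolute sums by the diagonal
  averages.\<close>

lemma quadratic_form_average:
  fixes m :: "nat \<Rightarrow> nat \<Rightarrow> real" and B :: "nat \<Rightarrow> nat \<Rightarrow> nat \<Rightarrow> real"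
  assumes m: "\<And>a b. a < p \<Longrightarrow> b < p \<Longrightarrow> (\<lambda>N. (\<Sum>k<N. m a k * m b k) / ln (real N)) \<longlonglongrightarrow> g a b"
    and B: "\<And>i a. i < p \<Longrightarrow> a < p \<Longrightarrow> (\<lambda>k. B k i a) \<longlonglongrightarrow> J i a"
    and ij: "i < p" "j < p"
  shows "(\<lambda>N. (\<Sum>k<N. (\<Sum>a<p. B k i a * m a k) * (\<Sum>b<p. B k j b * m b k)) / ln (real N))
    \<longlonglongrightarrow> (\<Sum>a<p. \<Sum>b<p. J i a * J j b * g a b)"
proof -
  have 1: "(\<lambda>N. (\<Sum>k<N. (B k i a * B k j b) * (m a k * m b k)) / ln (real N)) \<longlonglongrightarrow> J i a * J j b * g a b"
    if ab: "a < p" "b < p" for a b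
  proof (rule weighted_average[OF ln_real_at_top m[OF ab]])
    show "(\<lambda>k. B k i a * B k j b) \<longlonglongrightarrow> J i a * J j b"
      by (intro tendsto_mult B ij ab)
    have "(\<lambda>N. (\<Sum>k<N. m a k * m a k) / ln (real N) + (\<Sum>k<N. m b k * m b k) / ln (real N)) \<longlonglongrightarrow> g a a + g b b"
      by (intro tendsto_add m ab)
    then have "\<forall>\<^sub>F N in sequentially. (\<Sum>k<N. m a k * m a k) / ln (real N) + (\<Sum>k<N. m b k * m b k) / ln (real N)
        < g a a + g b b + 1"
      by (rule order_tendstoD) simp
    moreover have "\<forall>\<^sub>F N in sequentially. ln (real N) > 0"
      using eventually_gt_at_top[of 1] by eventually_elim simp
    ultimately show "\<forall>\<^sub>F N in sequentially. (\<Sum>k<N. \<bar>m a k * m b k\<bar>) \<le> (g a a + g b b + 1) * ln (real N)"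
    proof eventually_elim
      case (elim N)
      have "\<bar>s * t\<bar> \<le> s * s + t * t" for s t :: real
      proof -
        have "2 * (\<bar>s\<bar> * \<bar>t\<bar>) \<le> s * s + t * t"
          using sum_squares_bound[of "\<bar>s\<bar>" "\<bar>t\<bar>"] by (simp add: mult.assoc power2_eq_square)
        moreover have "0 \<le> \<bar>s\<bar> * \<bar>t\<bar>" by simp
        ultimately show ?thesis unfolding abs_mult by linarith
      qed
      then have "(\<Sum>k<N. \<bar>m a k * m b k\<bar>) \<le> (\<Sum>k<N. m a k * m a k + m b k * m b k)"
        by (rule sum_mono)
      also have "\<dots> \<le> (g a a + g b b + 1) * ln (real N)"
        using elim by (simp add: sum.distrib pos_divide_less_eq flip: add_divide_distrib)
      finally show ?case .
    qed
  qed
  have "(\<lambda>N. \<Sum>a<p. \<Sum>b<p. (\<Sum>k<N. (B k i a * B k j b) * (m a k * m b k)) / ln (real N))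
      \<longlonglongrightarrow> (\<Sum>a<p. \<Sum>b<p. J i a * J j b * g a b)"
    by (intro tendsto_sum 1) auto
  moreover have "(\<Sum>a<p. \<Sum>b<p. (\<Sum>k<N. (B k i a * B k j b) * (m a k * m b k)) / ln (real N))
      = (\<Sum>k<N. (\<Sum>a<p. B k i a * m a k) * (\<Sum>b<p. B k j b * m b k)) / ln (real N)" for N
  proof -
    have "(\<Sum>k<N. (\<Sum>a<p. B k i a * m a k) * (\<Sum>b<p. B k j b * m b k))
        = (\<Sum>k<N. \<Sum>a<p. \<Sum>b<p. (B k i a * B k j b) * (m a k * m b k))"
      by (simp add: sum_product mult_ac)
    also have "\<dots> = (\<Sum>a<p. \<Sum>k<N. \<Sum>b<p. (B k i a * B k j b) * (m a k * m b k))"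
      by (rule sum.swap)
    also have "\<dots> = (\<Sum>a<p. \<Sum>b<p. \<Sum>k<N. (B k i a * B k j b) * (m a k * m b k))"
      by (intro sum.cong refl sum.swap)
    finally show ?thesis by (simp add: sum_divide_distrib)
  qed
  ultimately show ?thesis by simp
qed

section \<open>Entries of the observed vectors and of the normalising matrix\<close>

lemma Y_vec_dim: "dim_vec (Y_vec \<theta> \<xi> n \<omega>) = dim_vec \<theta>"
  by (simp add: Y_vec_def)

lemma Y_vec_0: "j < dim_vec \<theta> \<Longrightarrow> Y_vec \<theta> \<xi> 0 \<omega> $ j = 0"
  by (simp add: Y_vec_def ar.simps)

lemma Y_vec_Suc:
  assumes j: "j < dim_vec \<theta>"
  shows "Y_vec \<theta> \<xi> (Suc n) \<omega> $ j
    = (\<Sum>l<dim_vec \<theta>. companion \<theta> $$ (j, l) * Y_vec \<theta> \<xi> n \<omega> $ l) + (if j = 0 then \<xi> (Suc n) \<omega> else 0)"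
proof (cases j)
  case 0
  have "ar \<theta> \<xi> (int (Suc n)) \<omega>
      = (\<Sum>i=1..dim_vec \<theta>. \<theta> $ (i - 1) * ar \<theta> \<xi> (int (Suc n) - int i) \<omega>) + \<xi> (Suc n) \<omega>"
    by (subst ar.simps) (simp del: of_nat_Suc)
  also have "(\<Sum>i=1..dim_vec \<theta>. \<theta> $ (i - 1) * ar \<theta> \<xi> (int (Suc n) - int i) \<omega>)
      = (\<Sum>l<dim_vec \<theta>. \<theta> $ l * ar \<theta> \<xi> (int n - int l) \<omega>)"
    by (simp add: sum.atLeast1_atMost_eq)
  finally show ?thesis using 0 j by (simp add: Y_vec_def companion_def)
next
  case (Suc l')
  have "(\<Sum>l<dim_vec \<theta>. companion \<theta> $$ (j, l) * Y_vec \<theta> \<xi> n \<omega> $ l)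
      = (\<Sum>l<dim_vec \<theta>. if l = l' then Y_vec \<theta> \<xi> n \<omega> $ l' else 0)"
    using Suc j by (intro sum.cong refl) (auto simp: companion_def)
  then show ?thesis using Suc j by (simp add: Y_vec_def)
qed

lemma a_mat_entry:
  assumes "t < 2 * p" "r < p"
  shows "a_mat k p n $$ (t, r) = (if t < p then (if t = r then 1 else 0) else pacf k n * (if t - p = r then 1 else 0))"
  using assms by (simp add: a_mat_def append_rows_def)

lemma a_mat_carrier: "a_mat k p n \<in> carrier_mat (2 * p) p"
  by (simp add: a_mat_def append_rows_def carrier_matI)

lemma a_mat_sum:
  assumes r: "r < p"
  shows "(\<Sum>t<2 * p. a_mat k p n $$ (t, r) * f t) = f r + pacf k n * f (p + r)"
proof -
  have split: "sum g {..<2 * p} = sum g {..<p} + sum g {p..<2 * p}" for g :: "nat \<Rightarrow> real"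
    using sum.atLeastLessThan_concat[of 0 p "2 * p" g] by (simp add: lessThan_atLeast0)
  have "(\<Sum>t<2 * p. a_mat k p n $$ (t, r) * f t)
      = (\<Sum>t<p. a_mat k p n $$ (t, r) * f t) + (\<Sum>t\<in>{p..<2 * p}. a_mat k p n $$ (t, r) * f t)"
    by (rule split)
  also have "(\<Sum>t<p. a_mat k p n $$ (t, r) * f t) = (\<Sum>t<p. if t = r then f r else 0)"
    using r by (intro sum.cong refl) (auto simp: a_mat_entry)
  also have "(\<Sum>t\<in>{p..<2 * p}. a_mat k p n $$ (t, r) * f t)
      = (\<Sum>t\<in>{p..<2 * p}. if t = p + r then pacf k n * f (p + r) else 0)"
    using r by (intro sum.cong refl) (auto simp: a_mat_entry)
  finally show ?thesis using r by simp
qed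

lemma a_mat_outer:
  assumes v: "v \<in> carrier_vec (2 * p)" and ij: "i < p" "j < p"
  shows "(transpose_mat (a_mat k p n) * outer_prod v v * a_mat k p n) $$ (i, j)
    = (v $ i + pacf k n * v $ (p + i)) * (v $ j + pacf k n * v $ (p + j))"
proof -
  let ?a = "a_mat k p n"
  have "(transpose_mat ?a * outer_prod v v * ?a) $$ (i, j)
      = (\<Sum>s<2 * p. (\<Sum>t<2 * p. ?a $$ (t, i) * (v $ t * v $ s)) * ?a $$ (s, j))"
    using a_mat_carrier[of k p n] v ij
    by (simp add: times_mat_def scalar_prod_def outer_prod_def lessThan_atLeast0)
  also have "\<dots> = (\<Sum>s<2 * p. ?a $$ (s, j) * ((\<Sum>t<2 * p. ?a $$ (t, i) * v $ t) * v $ s))"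
    by (intro sum.cong refl) (simp add: sum_distrib_right sum_distrib_left mult_ac)
  finally show ?thesis unfolding a_mat_sum[OF ij(1)] a_mat_sum[OF ij(2)] by (simp add: algebra_simps)
qed

lemma a_mat_transpose_vec:
  assumes v: "v \<in> carrier_vec (2 * p)" and i: "i < p"
  shows "(transpose_mat (a_mat k p n) *\<^sub>v v) $ i = v $ i + pacf k n * v $ (p + i)"
proof -
  have "(transpose_mat (a_mat k p n) *\<^sub>v v) $ i = (\<Sum>t<2 * p. a_mat k p n $$ (t, i) * v $ t)"
    using a_mat_carrier[of k p n] v i
    by (simp add: mult_mat_vec_def scalar_prod_def lessThan_atLeast0)
  then show ?thesis using a_mat_sum[OF i] by simp
qed

locale mle_model = inn: innovation_process M \<epsilon> \<xi> \<sigma> k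
    + ar: ar_noise M \<epsilon> "companion \<theta>" p c r \<sigma> "pacf k" H \<alpha>
  for M :: "'a measure" and \<epsilon> \<xi> \<sigma> k \<theta> p c r H \<alpha>
begin

lemma dim_theta: "dim_vec \<theta> = p"
proof -
  have "dim_row (companion \<theta>) = p" using ar.A by (rule carrier_matD(1))
  then show ?thesis by (simp add: companion_def)
qed

text \<open>The argument runs at one sample point where the innovation equations hold. Row
  \<open>n\<close> is applied to the autoregression: the lagged part becomes A U_{n-1} by the
  filtered recursion, with Y_0 = 0 removing the first term, and the noise part becomes the
  innovation.\<close>

lemma Z_filter:
  assumes inn: "\<forall>n\<ge>1. \<sigma> n * \<epsilon> n \<omega> = (\<Sum>i=1..n. k n i * \<xi> i \<omega>)" and j: "j < p"
  shows "ar.Z n \<omega> j = (\<Sum>i=1..n. k n i * Y_vec \<theta> \<xi> i \<omega> $ j)"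
  using j
proof (induction n arbitrary: j rule: less_induct)
  case (less n)
  show ?case
  proof (cases n)
    case 0
    then show ?thesis by (simp add: ar.Z_0)
  next
    case (Suc m)
    let ?Y = "\<lambda>i l. Y_vec \<theta> \<xi> i \<omega> $ l"
    have U: "(\<Sum>i<n. k n (Suc i) * ?Y i l) = ar.U m \<omega> l" if l: "l < p" for l
    proof -
      have "(\<Sum>i<n. k n (Suc i) * ?Y i l) = (\<Sum>i=1..m. k n (Suc i) * ?Y i l)"
        using Suc l Y_vec_0[of l \<theta> \<xi> \<omega>] dim_theta
        by (simp add: sum.lessThan_Suc_shift sum.atLeast1_atMost_eq del: sum.lessThan_Suc)
      also have "\<dots> = ar.U m \<omega> l"
      proof (cases "m = 0")
        case True
        then show ?thesis by (simp add: ar.U_0)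
      next
        case False
        have S: "ar.S m \<omega> l = (\<Sum>j\<in>{1..<m}. pacf k j * (\<Sum>i=1..j. k j i * ?Y i l))"
        proof -
          have "ar.S m \<omega> l = (\<Sum>j\<in>{1..<m}. pacf k j * ar.Z j \<omega> l)"
            unfolding ar.S_sum by (intro sum.mono_neutral_right) (auto simp: ar.Z_0 Suc_le_eq)
          also have "\<dots> = (\<Sum>j\<in>{1..<m}. pacf k j * (\<Sum>i=1..j. k j i * ?Y i l))"
            using less.IH Suc l by (intro sum.cong refl) auto
          finally show ?thesis .
        qed
        have "ar.Z m \<omega> l = (\<Sum>i=1..m. k m i * ?Y i l)" using less.IH[of m l] Suc l by simp
        then show ?thesis
          unfolding Suc ar.U_def S using inn.filtered_recursion[of m "\<lambda>i. ?Y i l"] False by simp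
      qed
      finally show ?thesis .
    qed
    have "(\<Sum>i=1..n. k n i * ?Y i j) = (\<Sum>i<n. k n (Suc i) * ?Y (Suc i) j)"
      by (simp add: sum.atLeast1_atMost_eq)
    also have "\<dots> = (\<Sum>i<n. (\<Sum>l<p. companion \<theta> $$ (j, l) * (k n (Suc i) * ?Y i l))
        + (if j = 0 then k n (Suc i) * \<xi> (Suc i) \<omega> else 0))"
      using less.prems dim_theta
      by (intro sum.cong refl) (simp add: Y_vec_Suc distrib_left sum_distrib_left mult_ac)
    also have "\<dots> = (\<Sum>l<p. companion \<theta> $$ (j, l) * (\<Sum>i<n. k n (Suc i) * ?Y i l))
        + (if j = 0 then (\<Sum>i=1..n. k n i * \<xi> i \<omega>) else 0)"
      unfolding sum.distrib by (subst sum.swap) (simp add: sum_distrib_left sum.atLeast1_atMost_eq)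
    also have "\<dots> = (\<Sum>l<p. companion \<theta> $$ (j, l) * ar.U m \<omega> l)
        + (if j = 0 then \<sigma> n * \<epsilon> n \<omega> else 0)"
      using U inn Suc by simp
    also have "\<dots> = ar.Z n \<omega> j" unfolding Suc ar.Z_Suc ar.mv_def ..
    finally show ?thesis ..
  qed
qed

lemma zeta_entries:
  assumes inn: "\<forall>n\<ge>1. \<sigma> n * \<epsilon> n \<omega> = (\<Sum>i=1..n. k n i * \<xi> i \<omega>)"
  shows "zeta k \<theta> \<xi> n \<omega> \<in> carrier_vec (2 * p)"
    and "j < p \<Longrightarrow> zeta k \<theta> \<xi> n \<omega> $ j = ar.Z n \<omega> j"
    and "j < p \<Longrightarrow> zeta k \<theta> \<xi> n \<omega> $ (p + j) = ar.S n \<omega> j"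
proof -
  have Z: "Z_vec k \<theta> \<xi> n \<omega> $ j = ar.Z n \<omega> j" if "j < p" for n j
    using that by (simp add: Z_filter[OF inn that] Z_vec_def vec_sum_def dim_theta Y_vec_dim)
  show "zeta k \<theta> \<xi> n \<omega> \<in> carrier_vec (2 * p)"
    by (rule carrier_vecI) (simp add: zeta_def Z_vec_def vec_sum_def dim_theta)
  show "zeta k \<theta> \<xi> n \<omega> $ j = ar.Z n \<omega> j" if "j < p"
    using that Z[of j n] by (simp add: zeta_def ar.Z_0 dim_theta Z_vec_def vec_sum_def)
  show "zeta k \<theta> \<xi> n \<omega> $ (p + j) = ar.S n \<omega> j" if j: "j < p"
  proof (cases "n = 0")
    case True
    then show ?thesis using j by (simp add: zeta_def ar.S_0 dim_theta)
  next
    case False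
    have dZ: "dim_vec (Z_vec k \<theta> \<xi> i \<omega>) = p" for i by (simp add: Z_vec_def vec_sum_def dim_theta)
    have "zeta k \<theta> \<xi> n \<omega> $ (p + j) = (\<Sum>i\<in>{1..<n}. pacf k i * ar.Z i \<omega> j)"
      using False j dZ Z[OF j] by (simp add: zeta_def vec_sum_def dim_theta)
    also have "\<dots> = ar.S n \<omega> j"
      unfolding ar.S_sum by (intro sum.mono_neutral_left) (auto simp: ar.Z_0 Suc_le_eq)
    finally show ?thesis .
  qed
qed

lemma mle_mat_entry:
  assumes inn: "\<forall>n\<ge>1. \<sigma> n * \<epsilon> n \<omega> = (\<Sum>i=1..n. k n i * \<xi> i \<omega>)" and ij: "i < p" "j < p"
  shows "mle_mat k \<sigma> \<theta> \<xi> N \<omega> $$ (i, j) = (\<Sum>n<N. ar.u i n \<omega> * ar.u j n \<omega>)"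
proof -
  have "mle_mat k \<sigma> \<theta> \<xi> N \<omega> $$ (i, j) = (\<Sum>n=1..N. ((1 / (\<sigma> n)\<^sup>2) \<cdot>\<^sub>m
       (transpose_mat (a_mat k p (n - 1))
          * outer_prod (zeta k \<theta> \<xi> (n - 1) \<omega>) (zeta k \<theta> \<xi> (n - 1) \<omega>)
          * a_mat k p (n - 1))) $$ (i, j))"
    using ij by (simp add: mle_mat_def mat_sum_def dim_theta Let_def)
  also have "\<dots> = (\<Sum>n<N. (1 / (\<sigma> (Suc n))\<^sup>2) * (transpose_mat (a_mat k p n)
          * outer_prod (zeta k \<theta> \<xi> n \<omega>) (zeta k \<theta> \<xi> n \<omega>) * a_mat k p n) $$ (i, j))"
    unfolding One_nat_def sum.atLeast1_atMost_eq using ij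
    by (intro sum.cong refl) (simp add: carrier_matD[OF a_mat_carrier])
  also have "\<dots> = (\<Sum>n<N. ar.u i n \<omega> * ar.u j n \<omega>)"
    unfolding a_mat_outer[OF zeta_entries(1)[OF inn] ij] ar.u_def ar.U_def
    using ij by (simp add: zeta_entries[OF inn] power2_eq_square)
  finally show ?thesis .
qed

text \<open>The first entry of zeta_{n+1} is sigma_{n+1} times the sum of theta . u_n and the next
  innovation, a linear regression on u_n with standard normal errors. The vector is therefore P
  theta + m, and applying the inverse of P leaves the error P^-1 m.\<close>

lemma mle_vec_entry:
  assumes inn: "\<forall>n\<ge>1. \<sigma> n * \<epsilon> n \<omega> = (\<Sum>i=1..n. k n i * \<xi> i \<omega>)" and i: "i < p"
  shows "mle_vec k \<sigma> \<theta> \<xi> N \<omega> $ i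
    = (\<Sum>l<p. mle_mat k \<sigma> \<theta> \<xi> N \<omega> $$ (i, l) * \<theta> $ l) + inn.mart (ar.u i) N \<omega>"
proof -
  have head: "(unit_vec (2 * p) 0 \<bullet> zeta k \<theta> \<xi> (Suc n) \<omega>)
      = \<sigma> (Suc n) * ((\<Sum>l<p. \<theta> $ l * ar.u l n \<omega>) + \<epsilon> (Suc n) \<omega>)" for n
  proof -
    have "(unit_vec (2 * p) 0 \<bullet> zeta k \<theta> \<xi> (Suc n) \<omega>) = zeta k \<theta> \<xi> (Suc n) \<omega> $ 0"
      using scalar_prod_left_unit[OF zeta_entries(1)[OF inn]] ar.p by simp
    also have "\<dots> = (\<Sum>l<p. \<theta> $ l * ar.U n \<omega> l) + \<sigma> (Suc n) * \<epsilon> (Suc n) \<omega>"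
    proof -
      have "companion \<theta> $$ (0, l) = \<theta> $ l" if "l < p" for l
        using that by (simp add: companion_def dim_theta)
      then show ?thesis using ar.p by (simp add: zeta_entries(2)[OF inn] ar.Z_Suc ar.mv_def)
    qed
    finally show ?thesis
      using ar.sig_pos[of "Suc n"] by (simp add: ar.u_def distrib_left sum_distrib_left)
  qed
  have "mle_vec k \<sigma> \<theta> \<xi> N \<omega> $ i = (\<Sum>n<N. ((unit_vec (2 * p) 0 \<bullet> zeta k \<theta> \<xi> (Suc n) \<omega>) / (\<sigma> (Suc n))\<^sup>2)
       * (transpose_mat (a_mat k p n) *\<^sub>v zeta k \<theta> \<xi> n \<omega>) $ i)"
    unfolding mle_vec_def Let_def dim_theta vec_sum_def using i
    by (simp add: sum.atLeast1_atMost_eq carrier_matD[OF a_mat_carrier])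
  also have "\<dots> = (\<Sum>n<N. ((\<Sum>l<p. \<theta> $ l * ar.u l n \<omega>) + \<epsilon> (Suc n) \<omega>) * ar.u i n \<omega>)"
  proof (rule sum.cong[OF refl])
    fix n
    have "(transpose_mat (a_mat k p n) *\<^sub>v zeta k \<theta> \<xi> n \<omega>) $ i = \<sigma> (Suc n) * ar.u i n \<omega>"
      using ar.sig_pos[of "Suc n"] i
      by (simp add: a_mat_transpose_vec[OF zeta_entries(1)[OF inn] i] zeta_entries[OF inn] ar.u_def ar.U_def)
    then show "((unit_vec (2 * p) 0 \<bullet> zeta k \<theta> \<xi> (Suc n) \<omega>) / (\<sigma> (Suc n))\<^sup>2)
        * (transpose_mat (a_mat k p n) *\<^sub>v zeta k \<theta> \<xi> n \<omega>) $ i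
        = ((\<Sum>l<p. \<theta> $ l * ar.u l n \<omega>) + \<epsilon> (Suc n) \<omega>) * ar.u i n \<omega>"
      unfolding head using ar.sig_pos[of "Suc n"] by (simp add: power2_eq_square)
  qed
  also have "\<dots> = (\<Sum>n<N. \<Sum>l<p. ar.u i n \<omega> * ar.u l n \<omega> * \<theta> $ l) + (\<Sum>n<N. ar.u i n \<omega> * \<epsilon> (Suc n) \<omega>)"
    by (simp only: distrib_right sum.distrib sum_distrib_right) (simp only: mult_ac)
  also have "(\<Sum>n<N. \<Sum>l<p. ar.u i n \<omega> * ar.u l n \<omega> * \<theta> $ l)
      = (\<Sum>l<p. mle_mat k \<sigma> \<theta> \<xi> N \<omega> $$ (i, l) * \<theta> $ l)"
    by (subst sum.swap) (simp add: mle_mat_entry[OF inn i] sum_distrib_right)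
  finally show ?thesis by (simp add: inn.msum_def)
qed

lemma mle_mat_carrier: "mle_mat k \<sigma> \<theta> \<xi> N \<omega> \<in> carrier_mat p p"
  by (simp add: mle_mat_def mat_sum_def dim_theta Let_def)

lemma mle_error:
  assumes inn: "\<forall>n\<ge>1. \<sigma> n * \<epsilon> n \<omega> = (\<Sum>i=1..n. k n i * \<xi> i \<omega>)" and i: "i < p"
    and B: "mat_inverse (mle_mat k \<sigma> \<theta> \<xi> N \<omega>) = Some B"
  shows "(mle v\<^sub>0 k \<sigma> \<theta> \<xi> N \<omega> - \<theta>) $ i = (\<Sum>a<p. B $$ (i, a) * inn.mart (ar.u a) N \<omega>)"
proof -
  let ?P = "mle_mat k \<sigma> \<theta> \<xi> N \<omega>"
  have Bc: "B \<in> carrier_mat p p" and BP: "B * ?P = 1\<^sub>m p"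
    using mat_inverse(2)[OF mle_mat_carrier B] by auto
  have vc: "mle_vec k \<sigma> \<theta> \<xi> N \<omega> \<in> carrier_vec p"
    by (simp add: mle_vec_def vec_sum_def dim_theta Let_def)
  have "(B *\<^sub>v mle_vec k \<sigma> \<theta> \<xi> N \<omega>) $ i = (\<Sum>a<p. B $$ (i, a) * mle_vec k \<sigma> \<theta> \<xi> N \<omega> $ a)"
    using Bc vc i by (simp add: mult_mat_vec_def scalar_prod_def lessThan_atLeast0)
  also have "\<dots> = (\<Sum>a<p. (\<Sum>l<p. B $$ (i, a) * ?P $$ (a, l) * \<theta> $ l) + B $$ (i, a) * inn.mart (ar.u a) N \<omega>)"
    by (intro sum.cong refl) (simp add: mle_vec_entry[OF inn] distrib_left sum_distrib_left mult.assoc)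
  also have "\<dots> = (\<Sum>l<p. (\<Sum>a<p. B $$ (i, a) * ?P $$ (a, l)) * \<theta> $ l) + (\<Sum>a<p. B $$ (i, a) * inn.mart (ar.u a) N \<omega>)"
    unfolding sum.distrib by (subst sum.swap) (simp add: sum_distrib_right)
  also have "(\<Sum>l<p. (\<Sum>a<p. B $$ (i, a) * ?P $$ (a, l)) * \<theta> $ l) = (\<Sum>l<p. if l = i then \<theta> $ i else 0)"
  proof (intro sum.cong refl)
    fix l assume l: "l \<in> {..<p}"
    have "(B * ?P) $$ (i, l) = (\<Sum>a<p. B $$ (i, a) * ?P $$ (a, l))"
      using carrier_matD[OF Bc] carrier_matD[OF mle_mat_carrier[of N \<omega>]] i l
      by (simp add: times_mat_def scalar_prod_def lessThan_atLeast0)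
    then show "(\<Sum>a<p. B $$ (i, a) * ?P $$ (a, l)) * \<theta> $ l = (if l = i then \<theta> $ i else 0)"
      unfolding BP using i l by auto
  qed
  finally show ?thesis using i by (simp add: mle_def B dim_theta)
qed

text \<open>The error is the product of N P_N^-1, which converges to \<open>J\<close>, with m_N / N,
  whose logarithmic averages converge to the Gramian G; the limit J G J^T collapses to
  \<open>J\<close> because G is symmetric and inverse to \<open>J\<close>.\<close>

lemma mle_error_law:
  assumes inn: "\<forall>n\<ge>1. \<sigma> n * \<epsilon> n \<omega> = (\<Sum>i=1..n. k n i * \<xi> i \<omega>)"
    and G: "\<And>i j. i < p \<Longrightarrow> j < p \<Longrightarrow> (\<lambda>N. ar.G N \<omega> i j) \<longlonglongrightarrow> ar.gram i j"
    and Q: "\<And>i j. i < p \<Longrightarrow> j < p \<Longrightarrow> (\<lambda>N. (\<Sum>n<N. (inn.mart (ar.u i) n \<omega> / real n)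
      * (inn.mart (ar.u j) n \<omega> / real n)) / ln (real N)) \<longlonglongrightarrow> ar.gram i j"
    and J: "J \<in> carrier_mat p p" "ar.gram_mat * J = 1\<^sub>m p"
    and ij: "i < p" "j < p"
  shows "(\<lambda>N. (\<Sum>n=1..N. (mle v\<^sub>0 k \<sigma> \<theta> \<xi> n \<omega> - \<theta>) $ i * (mle v\<^sub>0 k \<sigma> \<theta> \<xi> n \<omega> - \<theta>) $ j)
    / ln (real N)) \<longlonglongrightarrow> J $$ (i, j)"
proof -
  let ?P = "\<lambda>N. mle_mat k \<sigma> \<theta> \<xi> N \<omega>"
  define H' where "H' N = (1 / real N) \<cdot>\<^sub>m ?P N" for N
  \<comment> \<open>The default for singular matrices is arbitrary: along the given path it is taken
    finitely often, and the averages ignore finitely many terms.\<close>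
  define B where "B N = (case mat_inverse (?P N) of Some C \<Rightarrow> real N \<cdot>\<^sub>m C | None \<Rightarrow> 0\<^sub>m p p)" for N
  define m where "m a N = inn.mart (ar.u a) N \<omega> / real N" for a N
  have H'c: "H' N \<in> carrier_mat p p" for N using mle_mat_carrier[of N \<omega>] by (simp add: H'_def)
  have gc: "ar.gram_mat \<in> carrier_mat p p" by (simp add: ar.gram_mat_def)
  have H'lim: "(\<lambda>N. H' N $$ (a, b)) \<longlonglongrightarrow> ar.gram_mat $$ (a, b)" if "a < p" "b < p" for a b
  proof -
    have "H' N $$ (a, b) = ar.G N \<omega> a b" for N
      using that carrier_matD[OF mle_mat_carrier[of N \<omega>]]
      by (simp add: H'_def ar.G_def mle_mat_entry[OF inn that])
    then show ?thesis using G[OF that] that by (simp add: ar.gram_mat_def)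
  qed
  have inv: "\<exists>C. mat_inverse (?P N) = Some C \<and> B N = real N \<cdot>\<^sub>m C \<and> N > 0" if d: "det (H' N) \<noteq> 0" for N
  proof -
    have d': "(1 / real N) ^ p * det (?P N) \<noteq> 0"
      using d carrier_matD[OF mle_mat_carrier[of N \<omega>]] by (simp add: H'_def)
    \<comment> \<open>At N = 0 the scaling factor 1 / N is 0, so a nonzero determinant excludes this
      case because p > 0.\<close>
    then have N: "N > 0" using ar.p by (cases "N = 0") auto
    have "det (?P N) \<noteq> 0" using d' by auto
    from det_non_zero_imp_unit[OF mle_mat_carrier this, where b = "()"] obtain C where "mat_inverse (?P N) = Some C"
      using mat_inverse(1)[OF mle_mat_carrier, where b = "()"] by (cases "mat_inverse (?P N)") auto
    then show ?thesis using N by (simp add: B_def)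
  qed
  have BH: "B N \<in> carrier_mat p p \<and> B N * H' N = 1\<^sub>m p" if d: "det (H' N) \<noteq> 0" for N
  proof -
    obtain C where C: "mat_inverse (?P N) = Some C" "B N = real N \<cdot>\<^sub>m C" "N > 0" using inv[OF d] by blast
    have Cc: "C \<in> carrier_mat p p" and CP: "C * ?P N = 1\<^sub>m p"
      using mat_inverse(2)[OF mle_mat_carrier C(1)] by auto
    have "B N * H' N = real N \<cdot>\<^sub>m ((1 / real N) \<cdot>\<^sub>m (C * ?P N))"
      unfolding C(2) H'_def mult_smult_assoc_mat[OF Cc smult_carrier_mat[OF mle_mat_carrier]]
        mult_smult_distrib[OF Cc mle_mat_carrier] ..
    also have "\<dots> = 1\<^sub>m p" unfolding CP using C(3) by (intro eq_matI) auto
    finally show ?thesis using C(2) Cc by simp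
  qed
  have Blim: "(\<lambda>N. B N $$ (a, b)) \<longlonglongrightarrow> J $$ (a, b)" if "a < p" "b < p" for a b
    by (rule tendsto_mat_inverse(1)[OF H'c gc H'lim J BH that])
  have ev: "\<forall>\<^sub>F N in sequentially. det (H' N) \<noteq> 0"
    by (rule tendsto_mat_inverse(2)[OF H'c gc H'lim J BH ij])
  have lim: "(\<lambda>N. (\<Sum>n<N. (\<Sum>a<p. B n $$ (i, a) * m a n) * (\<Sum>b<p. B n $$ (j, b) * m b n)) / ln (real N))
    \<longlonglongrightarrow> (\<Sum>a<p. \<Sum>b<p. J $$ (i, a) * J $$ (j, b) * ar.gram a b)"
    by (rule quadratic_form_average[OF Q[folded m_def] Blim ij])
  have "(\<Sum>a<p. \<Sum>b<p. J $$ (i, a) * J $$ (j, b) * ar.gram a b) = (\<Sum>a<p. if a = j then J $$ (i, j) else 0)"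
  proof (intro sum.cong refl)
    fix a assume a: "a \<in> {..<p}"
    have JG: "J * ar.gram_mat = 1\<^sub>m p" by (rule mat_mult_left_right_inverse[OF gc J])
    have "(\<Sum>b<p. J $$ (j, b) * ar.gram b a) = (J * ar.gram_mat) $$ (j, a)"
      using J(1) ij a by (simp add: times_mat_def scalar_prod_def lessThan_atLeast0 ar.gram_mat_def)
    also have "\<dots> = (if a = j then 1 else 0)" unfolding JG using ij a by auto
    finally have "(\<Sum>b<p. J $$ (j, b) * ar.gram a b) = (if a = j then 1 else 0)"
      by (simp add: ar.gram_sym[of a])
    then show "(\<Sum>b<p. J $$ (i, a) * J $$ (j, b) * ar.gram a b) = (if a = j then J $$ (i, j) else 0)"
      by (simp add: mult.assoc flip: sum_distrib_left)
  qed
  also have "\<dots> = J $$ (i, j)" using ij by simp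
  finally have val: "(\<Sum>a<p. \<Sum>b<p. J $$ (i, a) * J $$ (j, b) * ar.gram a b) = J $$ (i, j)" .
  show ?thesis
  proof (rule log_average_shift[OF lim[unfolded val]])
    show "\<forall>\<^sub>F N in sequentially. (mle v\<^sub>0 k \<sigma> \<theta> \<xi> N \<omega> - \<theta>) $ i * (mle v\<^sub>0 k \<sigma> \<theta> \<xi> N \<omega> - \<theta>) $ j
        = (\<Sum>a<p. B N $$ (i, a) * m a N) * (\<Sum>b<p. B N $$ (j, b) * m b N)"
      using ev
    proof eventually_elim
      case (elim N)
      obtain C where C: "mat_inverse (?P N) = Some C" "B N = real N \<cdot>\<^sub>m C" "N > 0" using inv[OF elim] by blast
      have Cc: "C \<in> carrier_mat p p" using mat_inverse(2)[OF mle_mat_carrier C(1)] by auto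
      have "(mle v\<^sub>0 k \<sigma> \<theta> \<xi> N \<omega> - \<theta>) $ i = (\<Sum>a<p. B N $$ (i, a) * m a N)" if "i < p" for i
        unfolding mle_error[OF inn that C(1)] m_def C(2) using Cc C(3) that
        by (intro sum.cong refl) simp
      then show ?case using ij by simp
    qed
  qed
qed

end

text \<open>The first conjunct gives the definite description in \<open>fisher\<close> its meaning,
  and stating the limit through \<open>mat_inverse\<close> makes invertibility part of the
  conclusion.\<close>

theorem theorem3p2:
  fixes M :: "'a measure"
    and \<xi> \<epsilon> :: "nat \<Rightarrow> 'a \<Rightarrow> real"
    and \<sigma> :: "nat \<Rightarrow> real"
    and k :: "nat \<Rightarrow> nat \<Rightarrow> real"
    and f :: "real \<Rightarrow> real"
    and p :: nat
    and \<theta> v\<^sub>0 :: "real vec"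
    and \<alpha>\<^sub>1 \<alpha>\<^sub>2 :: real
  assumes "prob_space M"
    and "gaussian_process M \<xi>"
    and "stationary_process M \<xi>"
    and "centered_process M \<xi>"
    and "autocov M \<xi> 0 = 1"
    and "is_spectral_density f (autocov M \<xi>)"
    and "innovations M \<xi> \<sigma> \<epsilon>"
    and "innovation_coeffs M \<xi> \<sigma> \<epsilon> k"
    and "1 \<le> p"
    and "\<theta> \<in> Theta p"
    and "v\<^sub>0 \<in> carrier_vec p"
    and "\<alpha>\<^sub>1 > 0" and "autocov M \<xi> \<in> O(\<lambda>n. real n powr (- \<alpha>\<^sub>1))"
    and "log_integrable f"
    and "\<alpha>\<^sub>2 > 1" and "(\<lambda>n. (pacf k n)\<^sup>2) \<in> O(\<lambda>n. real n powr (- \<alpha>\<^sub>2))"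
  shows "(\<exists>!S. lyapunov_solution \<theta> S) \<and>
    (\<exists>J. mat_inverse (fisher \<theta>) = Some J \<and>
      (AE \<omega> in M. mat_tendsto
        (\<lambda>n. (1 / ln (real n)) \<cdot>\<^sub>m
           mat_sum p p (\<lambda>i. outer_prod (mle v\<^sub>0 k \<sigma> \<theta> \<xi> i \<omega> - \<theta>) (mle v\<^sub>0 k \<sigma> \<theta> \<xi> i \<omega> - \<theta>)) {1..n})
        J))"
proof -
  obtain c r where st: "stable_matrix (companion \<theta>) p c r"
    using stable_matrix_companion[OF assms(10) assms(9)] by blast
  have inn: "innovation_process M \<epsilon> \<xi> \<sigma> k"
    using assms(1,3,7,8)
    by (simp add: innovation_process_def innovation_process_axioms_def gaussian_noise_def
        gaussian_noise_axioms_def innovations_def)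
  have s1: "\<sigma> 1 = 1" using assms(7) by (simp add: innovations_def)
  obtain C where C: "\<forall>\<^sub>F n in sequentially. norm ((pacf k n)\<^sup>2) \<le> C * norm (real n powr (- \<alpha>\<^sub>2))"
    using landau_o.bigE[OF assms(16)] by blast
  then obtain N where N: "\<And>n. n \<ge> N \<Longrightarrow> (pacf k n)\<^sup>2 \<le> C * real n powr (- \<alpha>\<^sub>2)"
    by (auto simp: eventually_sequentially)
  \<comment> \<open>The decay hypothesis is only eventual. Adding the finitely many earlier
    coefficients, normalised by the power of n, gives one constant valid for all n \<ge> 1.\<close>
  define H where "H = \<bar>C\<bar> + (\<Sum>n<N. (pacf k n)\<^sup>2 * real n powr \<alpha>\<^sub>2)"
  have S: "(\<Sum>n<N. (pacf k n)\<^sup>2 * real n powr \<alpha>\<^sub>2) \<ge> 0" by (intro sum_nonneg) auto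
  have H: "(pacf k n)\<^sup>2 \<le> H * real n powr (- \<alpha>\<^sub>2)" if n: "n \<ge> 1" for n
  proof (cases "n \<ge> N")
    case True
    have "(pacf k n)\<^sup>2 \<le> C * real n powr (- \<alpha>\<^sub>2)" by (rule N[OF True])
    also have "\<dots> \<le> H * real n powr (- \<alpha>\<^sub>2)" using S by (intro mult_right_mono) (auto simp: H_def)
    finally show ?thesis .
  next
    case False
    have "(pacf k n)\<^sup>2 * real n powr \<alpha>\<^sub>2 \<le> (\<Sum>n<N. (pacf k n)\<^sup>2 * real n powr \<alpha>\<^sub>2)"
      using False by (intro member_le_sum) auto
    then have "(pacf k n)\<^sup>2 * real n powr \<alpha>\<^sub>2 \<le> H" by (simp add: H_def)
    then show ?thesis using n by (simp add: powr_minus field_simps)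
  qed
  \<comment> \<open>The variance recursion demanded of \<open>\<sigma>\<close> is the second half of
    the Durbin--Levinson theorem, with \<open>pacf k\<close> in the place of
    \<open>\<beta>\<close>.\<close>
  interpret mle_model M \<epsilon> \<xi> \<sigma> k \<theta> p c r H \<alpha>\<^sub>2
  proof -
    interpret innovation_process M \<epsilon> \<xi> \<sigma> k by (rule inn)
    interpret stable_matrix "companion \<theta>" p c r by (rule st)
    show "mle_model M \<epsilon> \<xi> \<sigma> k \<theta> p c r H \<alpha>\<^sub>2"
      by unfold_locales (use s1 durbin_levinson(2) assms(15) H sig_pos in auto)
  qed
  have lyap: "lyapunov_solution \<theta> S \<longleftrightarrow> S = ar.gram_mat" for S
    by (rule ar.gram_mat_lyapunov) simp
  have fisher: "fisher \<theta> = ar.gram_mat" by (simp add: fisher_def lyap)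
  have gc: "ar.gram_mat \<in> carrier_mat p p" by (simp add: ar.gram_mat_def)
  have "det ar.gram_mat \<noteq> 0" by (rule ar.gram_mat_det) simp
  from det_non_zero_imp_unit[OF gc this, where b = "()"] obtain J where J: "mat_inverse ar.gram_mat = Some J"
    using mat_inverse(1)[OF gc, where b = "()"] by (cases "mat_inverse ar.gram_mat") auto
  have Jc: "J \<in> carrier_mat p p" "ar.gram_mat * J = 1\<^sub>m p" using mat_inverse(2)[OF gc J] by auto
  have dim: "dim_row J = p" "dim_col J = p" using Jc by auto
  \<comment> \<open>Countably many almost sure equations hold on one common event; there the
    observed vectors coincide with those rebuilt from the innovations.\<close>
  have "AE \<omega> in M. \<forall>n. n \<ge> 1 \<longrightarrow> \<sigma> n * \<epsilon> n \<omega> = (\<Sum>i=1..n. k n i * \<xi> i \<omega>)"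
    using assms(8) unfolding innovation_coeffs_def AE_all_countable by (auto intro: AE_impI)
  then have "AE \<omega> in M. mat_tendsto
        (\<lambda>n. (1 / ln (real n)) \<cdot>\<^sub>m
           mat_sum p p (\<lambda>i. outer_prod (mle v\<^sub>0 k \<sigma> \<theta> \<xi> i \<omega> - \<theta>) (mle v\<^sub>0 k \<sigma> \<theta> \<xi> i \<omega> - \<theta>)) {1..n}) J"
    using ar.gram_law ar.vector_quadratic_strong_law
  proof eventually_elim
    case (elim \<omega>)
    show ?case
      unfolding mat_tendsto_def dim
    proof (intro conjI allI impI)
      fix i j assume ij: "i < p" "j < p"
      have "(\<lambda>N. (\<Sum>n=1..N. (mle v\<^sub>0 k \<sigma> \<theta> \<xi> n \<omega> - \<theta>) $ i * (mle v\<^sub>0 k \<sigma> \<theta> \<xi> n \<omega> - \<theta>) $ j)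
          / ln (real N)) \<longlonglongrightarrow> J $$ (i, j)"
        by (rule mle_error_law[OF _ _ _ Jc ij]) (use elim in auto)
      then show "(\<lambda>n. ((1 / ln (real n)) \<cdot>\<^sub>m mat_sum p p (\<lambda>i. outer_prod (mle v\<^sub>0 k \<sigma> \<theta> \<xi> i \<omega> - \<theta>)
          (mle v\<^sub>0 k \<sigma> \<theta> \<xi> i \<omega> - \<theta>)) {1..n}) $$ (i, j)) \<longlonglongrightarrow> J $$ (i, j)"
        using ij by (simp add: mat_sum_def outer_prod_def dim_theta)
    qed (simp add: mat_sum_def)
  qed
  then show ?thesis using J by (auto simp: lyap fisher)
qed

end
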